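(* Let $k$ be a field, $G$ a group, and let $M$, $N$ be Majid bimodules over $G$ (that is, $M$ is a $(kG,\Phi)$-Majid bimodule and $N$ is a $(kG,\Phi')$-Majid bimodule for some normalized 3-cocycles $\Phi,\Phi'$ on $G$), with corresponding admissible collections $(M_C)_{C\in\mathcal{C}}$ and $(N_C)_{C\in\mathcal{C}}$. Then the following are equivalent: (1) $H(M)$ and $H(N)$ are gauge equivalent. (2) $B(M)$ and $B(N)$ are gauge equivalent. (3) $M$ and $N$ are gauge equivalent. (4) $(M_C)_{C\in\mathcal{C}}$ and $(N_C)_{C\in\mathcal{C}}$ are gauge equivalent. (5) $(M_C)_{C\in\mathcal{C}}$ and $(N_C)_{C\in\mathcal{C}}$ are uniformly projective equivalent.
   Context: Tensor products are over $k$; $\epsilon$ is the unit of $G$. A (normalized) 3-cocycle $\Phi:G^3\to k^*$ satisfies $\Phi(e,f,g)\Phi(e,fg,h)\Phi(f,g,h)=\Phi(ef,g,h)\Phi(e,f,gh)$ and $\Phi(\epsilon,e,f)=\Phi(e,\epsilon,f)=\Phi(e,f,\epsilon)=1$. Majid algebras. A Majid algebra (dual quasi-Hopf algebra) is a coalgebra $(H,\Delta,\varepsilon)$ with a coalgebra map $H\otimes H\to H$ (product), a group-like unit $1$, a convolution-invertible linear map $\Phi:H^{\otimes3}\to k$ (reassociator), a coalgebra antimorphism $\mathcal{S}:H\to H$ and linear maps $\alpha,\beta:H\to k$ (quasi-antipode) such that: $1a=a=a1$; $a_1(b_1c_1)\Phi(a_2,b_2,c_2)=\Phi(a_1,b_1,c_1)(a_2b_2)c_2$;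 $\Phi(a_1,b_1,c_1d_1)\Phi(a_2b_2,c_2,d_2)=\Phi(b_1,c_1,d_1)\Phi(a_1,b_2c_2,d_2)\Phi(a_2,b_3,c_3)$; $\Phi(a,1,b)=\varepsilon(a)\varepsilon(b)$; $\mathcal{S}(a_1)\alpha(a_2)a_3=\alpha(a)1$; $a_1\beta(a_2)\mathcal{S}(a_3)=\beta(a)1$; $\Phi(a_1,\mathcal{S}(a_3),a_5)\beta(a_2)\alpha(a_4)=\varepsilon(a)=\Phi^{-1}(\mathcal{S}(a_1),a_3,\mathcal{S}(a_5))\alpha(a_2)\beta(a_4)$. It is graded if $H=\bigoplus_{n\ge0}H_n$ is a graded coalgebra and all structure maps are homogeneous of degree $0$ ($k$ in degree $0$). A sub Majid algebra is a subcoalgebra containing $1$, closed under product and $\mathcal{S}$. An isomorphism of Majid algebras is a coalgebra isomorphism preserving product, unit and reassociator. $kG$ with $\Phi$ extended linearly is a Majid algebra with $\mathcal{S}(g)=g^{-1}$, $\alpha(g)=1$, $\beta(g)=1/\Phi(g,g^{-1},g)$. Gauge equivalence of Majid algebras. A gauge transformation on $H$ is a convolution-invertible linear map $F:H\otimes H\to k$ with $F(h,1)=F(1,h)=\varepsilon(h)$. The Majid algebra $H_F$ is the coalgebra $H$ with the same unit and $\mathcal{S}$ and with $g\cdot_Fh=F^{-1}(g_1,h_1)\,g_2h_2\,F(g_3,h_3)$, $\Phi_F(f,g,h)=F^{-1}(g_1,h_1)F^{-1}(f_1,g_2h_2)\Phi(f_2,g_3,h_3)F(f_3g_4,h_4)F(f_4,g_5)$,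 $\alpha_F(h)=F(\mathcal{S}(h_1),h_3)\alpha(h_2)$, $\beta_F(h)=F^{-1}(h_1,\mathcal{S}(h_3))\beta(h_2)$. $H$ and $H'$ are gauge equivalent if $H_F\cong H'$ as Majid algebras for some gauge transformation $F$ on $H$. Majid bimodules. A $(kG,\Phi)$-Majid bimodule is a $kG$-bicomodule $M=\bigoplus_{g,h\in G}{}^gM^h$ (${}^gM^h$ being the part with left coaction $m\mapsto g\otimes m$ and right coaction $m\mapsto m\otimes h$) with linear actions $f.m$, $m.f$ satisfying $f.{}^gM^h\subseteq{}^{fg}M^{fh}$, ${}^gM^h.f\subseteq{}^{gf}M^{hf}$, $\epsilon.m=m=m.\epsilon$ and, for $m\in{}^gM^h$, $e.(f.m)=\frac{\Phi(e,f,g)}{\Phi(e,f,h)}(ef).m$, $(m.e).f=\frac{\Phi(h,e,f)}{\Phi(g,e,f)}m.(ef)$, $(e.m).f=\frac{\Phi(e,h,f)}{\Phi(e,g,f)}e.(m.f)$. Morphisms are linear maps commuting with coactions and actions. Gauge equivalence of Majid bimodules. A gauge transformation on $G$ is a map $F:G\times G\to k^*$ with $F(g,\epsilon)=F(\epsilon,g)=1$. Put $\Phi_F(e,f,g)=\frac{F(e,f)F(ef,g)}{F(e,fg)F(f,g)}\Phi(e,f,g)$. For a $(kG,\Phi)$-Majid bimodule $M$, $M_F$ is the $(kG,\Phi_F)$-Majid bimodule with the same bicomodule and $f._Fm=\frac{F(f,h)}{F(f,g)}f.m$, $m._Ff=\frac{F(h,f)}{F(g,f)}m.f$ for $m\in{}^gM^h$.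 A $(kG,\Phi)$-Majid bimodule $M$ and a $(kG,\Phi')$-Majid bimodule $N$ are gauge equivalent if there is a gauge transformation $F$ on $G$ with $\Phi'=\Phi_F$ and $M_F\cong N$ as $(kG,\Phi')$-Majid bimodules. Collections. $\mathcal{C}$ is the set of conjugacy classes of $G$; for each $C$ fix $g(C)\in C$ with centralizer $Z_C$. Put $\tilde{\Phi}(e,f,g)=\frac{\Phi(e,f,g)\Phi(ef,f^{-1},e^{-1})\Phi(e,fg,f^{-1})}{\Phi(efg,f^{-1},e^{-1})\Phi(e,f,f^{-1})}$ and $\tilde{\Phi}_C(e,f)=\tilde{\Phi}(e,f,g(C))$ for $e,f\in Z_C$. A $\tilde{\Phi}_C$-representation of $Z_C$ is a space $V$ with $\rho:Z_C\to GL(V)$, $\rho(\epsilon)=\mathrm{Id}$, $\rho(e)\rho(f)=\tilde{\Phi}_C(e,f)\rho(ef)$. A $\Phi$-collection is a family $(M_C)_{C\in\mathcal{C}}$ of $\tilde{\Phi}_C$-representations $M_C$ of $Z_C$; a collection is admissible if it is a $\Phi$-collection for some 3-cocycle $\Phi$. The collection corresponding to a $(kG,\Phi)$-Majid bimodule $M$ is $M_C={}^{g(C)}M^{\epsilon}$ with action $f\triangleright m=(f.m).f^{-1}$. Given a $\Phi$-collection $(M_C)$ and a gauge transformation $F$ on $G$, let $\mu^F_C(f)=\frac{F(f,f^{-1})}{F(f,g(C))F(fg(C),f^{-1})}$ for $f\in Z_C$, and let $(M^F_C)$ be the $\Phi_F$-collection with the same spaces and action $f\triangleright_Fm=\mu^F_C(f)\,f\triangleright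 m$. A $\Phi$-collection $(M_C)$ and a $\Phi'$-collection $(N_C)$ are gauge equivalent if there is a gauge transformation $F$ on $G$ with $\Phi'=\Phi_F$ and $M^F_C\cong N_C$ as $\tilde{\Phi'}_C$-representations of $Z_C$ for all $C$. They are uniformly projective equivalent if for some gauge transformation $F$ on $G$ they are $F$-uniformly projective equivalent, i.e. $\Phi'=\Phi_F$ and for every $C$ there is a linear isomorphism $\phi_C:M_C\to N_C$ with $f\triangleright\phi_C(m)=\mu^F_C(f)\phi_C(f\triangleright m)$ for all $f\in Z_C$, $m\in M_C$. $H(M)$ and $B(M)$. For a $(kG,\Phi)$-Majid bimodule $M$, let $R_C=\dim_k{}^{g(C)}M^{\epsilon}$ (assumed finite for every $C$) and let $Q$ be the Hopf quiver with vertex set $G$ and, for each $x\in G$, $C\in\mathcal{C}$, $c\in C$, $R_C$ arrows from $x$ to $cx$. The path coalgebra $kQ$ has basis all paths, graded by length, with $\Delta(a_n\cdots a_1)=\sum_{i=0}^n(a_n\cdots a_{i+1})\otimes(a_i\cdots a_1)$ (paths composed right to left) and counit $1$ on vertices, $0$ on longer paths. $kQ_0=kG$ and $kQ_1$, with an arrow $x\to cx$ placed in bidegree $(cx,x)$, is identified with $M$ as a $kG$-bicomodule. $H(M)$ is the unique graded Majid algebra on $kQ$ whose degree $0$ part is $(kG,\Phi,\mathcal{S},\alpha,\beta)$ and whose products $H_0\otimes H_1\to H_1$, $H_1\otimes H_0\to H_1$ are the actions of $M$. $B(M)$ is the smallest sub Majid algebra of $H(M)$ containing $G$ and $M$.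
   Formalization: In (1) and (2), the isomorphism of Majid algebras in "gauge equivalent" is also required to fix every element of G; without this the claim fails (e.g. G=Z/3, M and N supported on {g} and {g²}, swapped by inversion). *)

theory Defs
  imports
    "HOL-Algebra.Group"
    "HOL-Library.Poly_Mapping"
    "Graph_Theory.Arc_Walk"
begin

section \<open>Vector spaces and tensor products\<close>

text \<open>
  Up to isomorphism every vector space over a field is a subspace \<open>V\<close> of a space
  \<open>'b \<Rightarrow>\<^sub>0 'k\<close> of finitely supported functions.  The space \<open>('b \<times> 'c) \<Rightarrow>\<^sub>0 'k\<close> together with
  \<open>tens\<close> is the tensor product of \<open>'b \<Rightarrow>\<^sub>0 'k\<close> and \<open>'c \<Rightarrow>\<^sub>0 'k\<close>, and for subspaces \<open>V\<close>, \<open>W\<close> the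
  tensor product of \<open>V\<close> and \<open>W\<close> is the subspace \<open>tensor V W\<close> spanned by the pure tensors.

  As \<open>'k\<close> is a field, every (multi)linear map on \<open>V\<close> extends to the ambient space.  Structure
  maps on \<open>V\<close> are therefore given by (multi)linear maps on the ambient space; all conditions
  below only involve their restrictions to \<open>V\<close> and its tensor powers.
\<close>

definition fscale :: "'k::comm_ring_1 \<Rightarrow> ('b \<Rightarrow>\<^sub>0 'k) \<Rightarrow> ('b \<Rightarrow>\<^sub>0 'k)" where
  "fscale c a = Poly_Mapping.map ((*) c) a"

lemma lookup_fscale [simp]: "Poly_Mapping.lookup (fscale c a) x = c * Poly_Mapping.lookup a x"
  by (simp add: fscale_def Poly_Mapping.map.rep_eq when_def)

interpretation free: vector_space "fscale :: 'k::field \<Rightarrow> ('b \<Rightarrow>\<^sub>0 'k) \<Rightarrow> ('b \<Rightarrow>\<^sub>0 'k)"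
  by unfold_locales (auto intro!: poly_mapping_eqI simp: lookup_add algebra_simps)

abbreviation bas :: "'b \<Rightarrow> 'b \<Rightarrow>\<^sub>0 'k::field" where
  "bas x \<equiv> Poly_Mapping.single x 1"

definition tens :: "('b \<Rightarrow>\<^sub>0 'k::field) \<Rightarrow> ('c \<Rightarrow>\<^sub>0 'k) \<Rightarrow> ('b \<times> 'c \<Rightarrow>\<^sub>0 'k)" where
  "tens u v = (\<Sum>x\<in>Poly_Mapping.keys u. \<Sum>y\<in>Poly_Mapping.keys v.
     Poly_Mapping.single (x, y) (Poly_Mapping.lookup u x * Poly_Mapping.lookup v y))"

definition tensor :: "('b \<Rightarrow>\<^sub>0 'k::field) set \<Rightarrow> ('c \<Rightarrow>\<^sub>0 'k) set \<Rightarrow> ('b \<times> 'c \<Rightarrow>\<^sub>0 'k) set" where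
  "tensor V W = free.span {tens u v |u v. u \<in> V \<and> v \<in> W}"

text \<open>In the following, \<open>s\<close> is the scalar multiplication of the codomain: \<open>fscale\<close> for maps
  into \<open>'c \<Rightarrow>\<^sub>0 'k\<close> and \<open>(*)\<close> for forms.\<close>

definition bilin ::
  "('k::field \<Rightarrow> 'w \<Rightarrow> 'w) \<Rightarrow> (('b \<Rightarrow>\<^sub>0 'k) \<Rightarrow> ('b \<Rightarrow>\<^sub>0 'k) \<Rightarrow> 'w::ab_group_add) \<Rightarrow> bool" where
  "bilin s f \<longleftrightarrow> (\<forall>u. Vector_Spaces.linear fscale s (f u)) \<and>
                (\<forall>v. Vector_Spaces.linear fscale s (\<lambda>u. f u v))"

definition trilin ::
  "('k::field \<Rightarrow> 'w \<Rightarrow> 'w) \<Rightarrow>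
   (('b \<Rightarrow>\<^sub>0 'k) \<Rightarrow> ('b \<Rightarrow>\<^sub>0 'k) \<Rightarrow> ('b \<Rightarrow>\<^sub>0 'k) \<Rightarrow> 'w::ab_group_add) \<Rightarrow> bool" where
  "trilin s f \<longleftrightarrow> (\<forall>u. bilin s (f u)) \<and> (\<forall>v w. Vector_Spaces.linear fscale s (\<lambda>u. f u v w))"


section \<open>Coalgebras and Sweedler notation\<close>

record (overloaded) ('b, 'k::field) coalg =
  car :: "('b \<Rightarrow>\<^sub>0 'k::field) set"
  comul :: "('b \<Rightarrow>\<^sub>0 'k) \<Rightarrow> ('b \<times> 'b \<Rightarrow>\<^sub>0 'k)"
  counit :: "('b \<Rightarrow>\<^sub>0 'k) \<Rightarrow> 'k"

text \<open>\<open>sw2 s H a (\<lambda>a\<^sub>1 a\<^sub>2. t)\<close> is the element denoted by \<open>t\<close> in Sweedler notation, i.e. the linear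
  map on the tensor square induced by the bilinear map \<open>(a\<^sub>1, a\<^sub>2) \<mapsto> t\<close>, applied to the
  coproduct of \<open>a\<close>; \<open>sw3\<close>, \<open>sw4\<close>, \<open>sw5\<close> do the same for iterated coproducts.\<close>

definition sw2 ::
  "('k \<Rightarrow> 'w \<Rightarrow> 'w) \<Rightarrow> ('b, 'k::field, 'z) coalg_scheme \<Rightarrow> ('b \<Rightarrow>\<^sub>0 'k) \<Rightarrow>
   (('b \<Rightarrow>\<^sub>0 'k) \<Rightarrow> ('b \<Rightarrow>\<^sub>0 'k) \<Rightarrow> 'w) \<Rightarrow> 'w::comm_monoid_add" where
  "sw2 s H a f =
     (\<Sum>(x, y)\<in>Poly_Mapping.keys (comul H a). s (Poly_Mapping.lookup (comul H a) (x, y)) (f (bas x) (bas y)))"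

definition sw3 where
  "sw3 s H a f = sw2 s H a (\<lambda>a1 b. sw2 s H b (\<lambda>a2 a3. f a1 a2 a3))"

definition sw4 where
  "sw4 s H a f = sw2 s H a (\<lambda>a1 b. sw3 s H b (\<lambda>a2 a3 a4. f a1 a2 a3 a4))"

definition sw5 where
  "sw5 s H a f = sw2 s H a (\<lambda>a1 b. sw4 s H b (\<lambda>a2 a3 a4 a5. f a1 a2 a3 a4 a5))"

locale coalgebra =
  fixes H :: "('b, 'k::field, 'z) coalg_scheme"
  assumes subspace: "free.subspace (car H)"
    and comul_linear: "Vector_Spaces.linear fscale fscale (comul H)"
    and counit_linear: "Vector_Spaces.linear fscale (*) (counit H)"
    and comul_closed: "a \<in> car H \<Longrightarrow> comul H a \<in> tensor (car H) (car H)"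
    and coassoc: "a \<in> car H \<Longrightarrow>
      sw2 fscale H a (\<lambda>b a3. sw2 fscale H b (\<lambda>a1 a2. tens a1 (tens a2 a3))) =
      sw2 fscale H a (\<lambda>a1 b. sw2 fscale H b (\<lambda>a2 a3. tens a1 (tens a2 a3)))"
    and counit_left: "a \<in> car H \<Longrightarrow> sw2 fscale H a (\<lambda>a1 a2. fscale (counit H a1) a2) = a"
    and counit_right: "a \<in> car H \<Longrightarrow> sw2 fscale H a (\<lambda>a1 a2. fscale (counit H a2) a1) = a"


section \<open>Majid algebras\<close>

record (overloaded) ('b, 'k::field) majid = "('b, 'k) coalg" +
  prd :: "('b \<Rightarrow>\<^sub>0 'k::field) \<Rightarrow> ('b \<Rightarrow>\<^sub>0 'k) \<Rightarrow> ('b \<Rightarrow>\<^sub>0 'k)"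
  unt :: "'b \<Rightarrow>\<^sub>0 'k"
  reass :: "('b \<Rightarrow>\<^sub>0 'k) \<Rightarrow> ('b \<Rightarrow>\<^sub>0 'k) \<Rightarrow> ('b \<Rightarrow>\<^sub>0 'k) \<Rightarrow> 'k"
  antip :: "('b \<Rightarrow>\<^sub>0 'k) \<Rightarrow> ('b \<Rightarrow>\<^sub>0 'k)"
  alph :: "('b \<Rightarrow>\<^sub>0 'k) \<Rightarrow> 'k"
  bet :: "('b \<Rightarrow>\<^sub>0 'k) \<Rightarrow> 'k"

definition conv_inverse3 ::
  "('b, 'k::field, 'z) coalg_scheme \<Rightarrow> (('b \<Rightarrow>\<^sub>0 'k) \<Rightarrow> ('b \<Rightarrow>\<^sub>0 'k) \<Rightarrow> ('b \<Rightarrow>\<^sub>0 'k) \<Rightarrow> 'k) \<Rightarrow>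
   (('b \<Rightarrow>\<^sub>0 'k) \<Rightarrow> ('b \<Rightarrow>\<^sub>0 'k) \<Rightarrow> ('b \<Rightarrow>\<^sub>0 'k) \<Rightarrow> 'k) \<Rightarrow> bool" where
  "conv_inverse3 H P Q \<longleftrightarrow> trilin (*) P \<and> trilin (*) Q \<and>
     (\<forall>a\<in>car H. \<forall>b\<in>car H. \<forall>c\<in>car H.
        sw2 (*) H a (\<lambda>a1 a2. sw2 (*) H b (\<lambda>b1 b2. sw2 (*) H c (\<lambda>c1 c2.
          P a1 b1 c1 * Q a2 b2 c2))) = counit H a * counit H b * counit H c \<and>
        sw2 (*) H a (\<lambda>a1 a2. sw2 (*) H b (\<lambda>b1 b2. sw2 (*) H c (\<lambda>c1 c2.
          Q a1 b1 c1 * P a2 b2 c2))) = counit H a * counit H b * counit H c)"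

definition conv_inverse2 ::
  "('b, 'k::field, 'z) coalg_scheme \<Rightarrow> (('b \<Rightarrow>\<^sub>0 'k) \<Rightarrow> ('b \<Rightarrow>\<^sub>0 'k) \<Rightarrow> 'k) \<Rightarrow>
   (('b \<Rightarrow>\<^sub>0 'k) \<Rightarrow> ('b \<Rightarrow>\<^sub>0 'k) \<Rightarrow> 'k) \<Rightarrow> bool" where
  "conv_inverse2 H P Q \<longleftrightarrow> bilin (*) P \<and> bilin (*) Q \<and>
     (\<forall>a\<in>car H. \<forall>b\<in>car H.
        sw2 (*) H a (\<lambda>a1 a2. sw2 (*) H b (\<lambda>b1 b2. P a1 b1 * Q a2 b2)) = counit H a * counit H b \<and>
        sw2 (*) H a (\<lambda>a1 a2. sw2 (*) H b (\<lambda>b1 b2. Q a1 b1 * P a2 b2)) = counit H a * counit H b)"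

locale majid_algebra = coalgebra H for H :: "('b, 'k::field) majid" +
  assumes prd_bilin: "bilin fscale (prd H)"
    and prd_closed: "a \<in> car H \<Longrightarrow> b \<in> car H \<Longrightarrow> prd H a b \<in> car H"
    and comul_prd: "a \<in> car H \<Longrightarrow> b \<in> car H \<Longrightarrow> comul H (prd H a b) =
      sw2 fscale H a (\<lambda>a1 a2. sw2 fscale H b (\<lambda>b1 b2. tens (prd H a1 b1) (prd H a2 b2)))"
    and counit_prd: "a \<in> car H \<Longrightarrow> b \<in> car H \<Longrightarrow> counit H (prd H a b) = counit H a * counit H b"
    and unt_closed: "unt H \<in> car H"
    and comul_unt: "comul H (unt H) = tens (unt H) (unt H)"
    and counit_unt: "counit H (unt H) = 1"
    and antip_linear: "Vector_Spaces.linear fscale fscale (antip H)"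
    and antip_closed: "a \<in> car H \<Longrightarrow> antip H a \<in> car H"
    and comul_antip: "a \<in> car H \<Longrightarrow>
      comul H (antip H a) = sw2 fscale H a (\<lambda>a1 a2. tens (antip H a2) (antip H a1))"
    and counit_antip: "a \<in> car H \<Longrightarrow> counit H (antip H a) = counit H a"
    and alph_linear: "Vector_Spaces.linear fscale (*) (alph H)"
    and bet_linear: "Vector_Spaces.linear fscale (*) (bet H)"
    and unt_left: "a \<in> car H \<Longrightarrow> prd H (unt H) a = a"
    and unt_right: "a \<in> car H \<Longrightarrow> prd H a (unt H) = a"
    and quasi_assoc: "a \<in> car H \<Longrightarrow> b \<in> car H \<Longrightarrow> c \<in> car H \<Longrightarrow>
      sw2 fscale H a (\<lambda>a1 a2. sw2 fscale H b (\<lambda>b1 b2. sw2 fscale H c (\<lambda>c1 c2.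
        fscale (reass H a2 b2 c2) (prd H a1 (prd H b1 c1))))) =
      sw2 fscale H a (\<lambda>a1 a2. sw2 fscale H b (\<lambda>b1 b2. sw2 fscale H c (\<lambda>c1 c2.
        fscale (reass H a1 b1 c1) (prd H (prd H a2 b2) c2))))"
    and reass_pentagon:
      "a \<in> car H \<Longrightarrow> b \<in> car H \<Longrightarrow> c \<in> car H \<Longrightarrow> d \<in> car H \<Longrightarrow>
      sw2 (*) H a (\<lambda>a1 a2. sw2 (*) H b (\<lambda>b1 b2. sw2 (*) H c (\<lambda>c1 c2. sw2 (*) H d (\<lambda>d1 d2.
        reass H a1 b1 (prd H c1 d1) * reass H (prd H a2 b2) c2 d2)))) =
      sw2 (*) H a (\<lambda>a1 a2. sw3 (*) H b (\<lambda>b1 b2 b3. sw3 (*) H c (\<lambda>c1 c2 c3. sw2 (*) H d (\<lambda>d1 d2.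
        reass H b1 c1 d1 * reass H a1 (prd H b2 c2) d2 * reass H a2 b3 c3))))"
    and reass_unt: "a \<in> car H \<Longrightarrow> b \<in> car H \<Longrightarrow> reass H a (unt H) b = counit H a * counit H b"
    and antip_alph: "a \<in> car H \<Longrightarrow>
      sw3 fscale H a (\<lambda>a1 a2 a3. fscale (alph H a2) (prd H (antip H a1) a3)) =
      fscale (alph H a) (unt H)"
    and antip_bet: "a \<in> car H \<Longrightarrow>
      sw3 fscale H a (\<lambda>a1 a2 a3. fscale (bet H a2) (prd H a1 (antip H a3))) =
      fscale (bet H a) (unt H)"
    and reass_antip: "a \<in> car H \<Longrightarrow>
      sw5 (*) H a (\<lambda>a1 a2 a3 a4 a5. reass H a1 (antip H a3) a5 * bet H a2 * alph H a4) = counit H a"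
    and reass_inverse: "\<exists>P. conv_inverse3 H (reass H) P \<and>
      (\<forall>a\<in>car H. sw5 (*) H a (\<lambda>a1 a2 a3 a4 a5.
         P (antip H a1) a3 (antip H a5) * alph H a2 * bet H a4) = counit H a)"

text \<open>All structure maps are homogeneous of degree 0, where \<open>'k\<close> is in degree 0: forms vanish on
  positive degrees.\<close>

locale graded_majid_algebra = majid_algebra H for H :: "('b, 'k::field) majid" +
  fixes gr :: "nat \<Rightarrow> ('b \<Rightarrow>\<^sub>0 'k) set"
  assumes gr_subspace: "free.subspace (gr n)"
    and gr_subset: "gr n \<subseteq> car H"
    and gr_direct_sum: "a \<in> car H \<Longrightarrow>
      \<exists>!f :: nat \<Rightarrow>\<^sub>0 ('b \<Rightarrow>\<^sub>0 'k). (\<forall>n. Poly_Mapping.lookup f n \<in> gr n) \<and>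
        a = (\<Sum>n\<in>Poly_Mapping.keys f. Poly_Mapping.lookup f n)"
    and gr_comul: "a \<in> gr n \<Longrightarrow> comul H a \<in> free.span (\<Union>i\<in>{..n}. tensor (gr i) (gr (n - i)))"
    and gr_counit: "a \<in> gr n \<Longrightarrow> n > 0 \<Longrightarrow> counit H a = 0"
    and gr_prd: "a \<in> gr m \<Longrightarrow> b \<in> gr n \<Longrightarrow> prd H a b \<in> gr (m + n)"
    and gr_unt: "unt H \<in> gr 0"
    and gr_reass: "a \<in> gr l \<Longrightarrow> b \<in> gr m \<Longrightarrow> c \<in> gr n \<Longrightarrow> l + m + n > 0 \<Longrightarrow> reass H a b c = 0"
    and gr_antip: "a \<in> gr n \<Longrightarrow> antip H a \<in> gr n"
    and gr_alph: "a \<in> gr n \<Longrightarrow> n > 0 \<Longrightarrow> alph H a = 0"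
    and gr_bet: "a \<in> gr n \<Longrightarrow> n > 0 \<Longrightarrow> bet H a = 0"

definition sub_majid :: "('b, 'k::field) majid \<Rightarrow> ('b \<Rightarrow>\<^sub>0 'k) set \<Rightarrow> bool" where
  "sub_majid H W \<longleftrightarrow> W \<subseteq> car H \<and> free.subspace W \<and> (\<forall>a\<in>W. comul H a \<in> tensor W W) \<and>
     unt H \<in> W \<and> (\<forall>a\<in>W. \<forall>b\<in>W. prd H a b \<in> W) \<and> (\<forall>a\<in>W. antip H a \<in> W)"

definition majid_iso ::
  "(('b \<Rightarrow>\<^sub>0 'k::field) \<Rightarrow> ('c \<Rightarrow>\<^sub>0 'k)) \<Rightarrow> ('b, 'k) majid \<Rightarrow> ('c, 'k) majid \<Rightarrow> bool" where
  "majid_iso f H H' \<longleftrightarrow>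
     Vector_Spaces.linear fscale fscale f \<and> bij_betw f (car H) (car H') \<and>
     (\<forall>a\<in>car H. comul H' (f a) = sw2 fscale H a (\<lambda>a1 a2. tens (f a1) (f a2))) \<and>
     (\<forall>a\<in>car H. counit H' (f a) = counit H a) \<and>
     (\<forall>a\<in>car H. \<forall>b\<in>car H. f (prd H a b) = prd H' (f a) (f b)) \<and>
     f (unt H) = unt H' \<and>
     (\<forall>a\<in>car H. \<forall>b\<in>car H. \<forall>c\<in>car H. reass H' (f a) (f b) (f c) = reass H a b c)"


subsection \<open>Gauge transformations\<close>

text \<open>\<open>majid_gauge H F Fi\<close>: \<open>F\<close> is a gauge transformation on \<open>H\<close> with convolution inverse \<open>Fi\<close>.\<close>

definition majid_gauge ::
  "('b, 'k::field) majid \<Rightarrow> (('b \<Rightarrow>\<^sub>0 'k) \<Rightarrow> ('b \<Rightarrow>\<^sub>0 'k) \<Rightarrow> 'k) \<Rightarrow>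
   (('b \<Rightarrow>\<^sub>0 'k) \<Rightarrow> ('b \<Rightarrow>\<^sub>0 'k) \<Rightarrow> 'k) \<Rightarrow> bool" where
  "majid_gauge H F Fi \<longleftrightarrow> conv_inverse2 H F Fi \<and>
     (\<forall>h\<in>car H. F h (unt H) = counit H h \<and> F (unt H) h = counit H h)"

definition majid_twist ::
  "('b, 'k::field) majid \<Rightarrow> (('b \<Rightarrow>\<^sub>0 'k) \<Rightarrow> ('b \<Rightarrow>\<^sub>0 'k) \<Rightarrow> 'k) \<Rightarrow>
   (('b \<Rightarrow>\<^sub>0 'k) \<Rightarrow> ('b \<Rightarrow>\<^sub>0 'k) \<Rightarrow> 'k) \<Rightarrow> ('b, 'k) majid" where
  "majid_twist H F Fi = H\<lparr>
     prd := (\<lambda>g h. sw3 fscale H g (\<lambda>g1 g2 g3. sw3 fscale H h (\<lambda>h1 h2 h3.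
       fscale (Fi g1 h1 * F g3 h3) (prd H g2 h2)))),
     reass := (\<lambda>f g h. sw4 (*) H f (\<lambda>f1 f2 f3 f4. sw5 (*) H g (\<lambda>g1 g2 g3 g4 g5.
       sw4 (*) H h (\<lambda>h1 h2 h3 h4.
         Fi g1 h1 * Fi f1 (prd H g2 h2) * reass H f2 g3 h3 * F (prd H f3 g4) h4 * F f4 g5)))),
     alph := (\<lambda>h. sw3 (*) H h (\<lambda>h1 h2 h3. F (antip H h1) h3 * alph H h2)),
     bet := (\<lambda>h. sw3 (*) H h (\<lambda>h1 h2 h3. Fi h1 (antip H h3) * bet H h2))\<rparr>"


section \<open>Three-cocycles and Majid bimodules\<close>

locale cocycle3 = group G for G (structure) +
  fixes \<Phi> :: "'a \<Rightarrow> 'a \<Rightarrow> 'a \<Rightarrow> 'k::field"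
  assumes nonzero: "e \<in> carrier G \<Longrightarrow> f \<in> carrier G \<Longrightarrow> g \<in> carrier G \<Longrightarrow> \<Phi> e f g \<noteq> 0"
    and cocycle: "e \<in> carrier G \<Longrightarrow> f \<in> carrier G \<Longrightarrow> g \<in> carrier G \<Longrightarrow> h \<in> carrier G \<Longrightarrow>
      \<Phi> e f g * \<Phi> e (f \<otimes> g) h * \<Phi> f g h = \<Phi> (e \<otimes> f) g h * \<Phi> e f (g \<otimes> h)"
    and normalized: "e \<in> carrier G \<Longrightarrow> f \<in> carrier G \<Longrightarrow>
      \<Phi> \<one> e f = 1 \<and> \<Phi> e \<one> f = 1 \<and> \<Phi> e f \<one> = 1"

definition gauge :: "('g, 'x) monoid_scheme \<Rightarrow> ('g \<Rightarrow> 'g \<Rightarrow> 'k::field) \<Rightarrow> bool" where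
  "gauge G F \<longleftrightarrow> (\<forall>g\<in>carrier G. \<forall>h\<in>carrier G. F g h \<noteq> 0) \<and>
     (\<forall>g\<in>carrier G. F g \<one>\<^bsub>G\<^esub> = 1 \<and> F \<one>\<^bsub>G\<^esub> g = 1)"

definition cocycle_twist ::
  "('g, 'x) monoid_scheme \<Rightarrow> ('g \<Rightarrow> 'g \<Rightarrow> 'k::field) \<Rightarrow> ('g \<Rightarrow> 'g \<Rightarrow> 'g \<Rightarrow> 'k) \<Rightarrow>
   'g \<Rightarrow> 'g \<Rightarrow> 'g \<Rightarrow> 'k" where
  "cocycle_twist G F \<Phi> e f g =
     F e f * F (e \<otimes>\<^bsub>G\<^esub> f) g / (F e (f \<otimes>\<^bsub>G\<^esub> g) * F f g) * \<Phi> e f g"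

definition cocycle_eq ::
  "('g, 'x) monoid_scheme \<Rightarrow> ('g \<Rightarrow> 'g \<Rightarrow> 'g \<Rightarrow> 'k) \<Rightarrow> ('g \<Rightarrow> 'g \<Rightarrow> 'g \<Rightarrow> 'k) \<Rightarrow> bool" where
  "cocycle_eq G \<Phi> \<Psi> \<longleftrightarrow> (\<forall>e\<in>carrier G. \<forall>f\<in>carrier G. \<forall>g\<in>carrier G. \<Phi> e f g = \<Psi> e f g)"

text \<open>
  The tensor product of the group coalgebra of \<open>G\<close> with a vector space of type \<open>'m\<close> is the space
  of finitely supported functions \<open>'g \<Rightarrow>\<^sub>0 'm\<close>; the function \<open>Poly_Mapping.single g m\<close> is the pure
  tensor of \<open>g\<close> and \<open>m\<close>.  Both coactions of a bicomodule take values in this space.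
\<close>

record (overloaded) ('k, 'g, 'm::zero) bimod =
  scl :: "'k \<Rightarrow> 'm::zero \<Rightarrow> 'm"
  lco :: "'m \<Rightarrow> ('g \<Rightarrow>\<^sub>0 'm)"
  rco :: "'m \<Rightarrow> ('g \<Rightarrow>\<^sub>0 'm)"
  lact :: "'g \<Rightarrow> 'm \<Rightarrow> 'm"
  ract :: "'m \<Rightarrow> 'g \<Rightarrow> 'm"

definition homog :: "('k, 'g, 'm::zero, 'x) bimod_scheme \<Rightarrow> 'g \<Rightarrow> 'g \<Rightarrow> 'm set" where
  "homog M g h = {m. lco M m = Poly_Mapping.single g m \<and> rco M m = Poly_Mapping.single h m}"

locale bicomodule = group G for G (structure) +
  fixes M :: "('k::field, 'a, 'm::ab_group_add) bimod"
  assumes vector_space: "vector_space (scl M)"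
    and lco_linear: "Vector_Spaces.linear (scl M) (scl M) (\<lambda>m. Poly_Mapping.lookup (lco M m) g)"
    and rco_linear: "Vector_Spaces.linear (scl M) (scl M) (\<lambda>m. Poly_Mapping.lookup (rco M m) g)"
    and lco_carrier: "Poly_Mapping.keys (lco M m) \<subseteq> carrier G"
    and rco_carrier: "Poly_Mapping.keys (rco M m) \<subseteq> carrier G"
    and lco_coassoc: "lco M (Poly_Mapping.lookup (lco M m) g) =
      Poly_Mapping.single g (Poly_Mapping.lookup (lco M m) g)"
    and rco_coassoc: "rco M (Poly_Mapping.lookup (rco M m) g) =
      Poly_Mapping.single g (Poly_Mapping.lookup (rco M m) g)"
    and lco_counit: "(\<Sum>g\<in>Poly_Mapping.keys (lco M m). Poly_Mapping.lookup (lco M m) g) = m"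
    and rco_counit: "(\<Sum>g\<in>Poly_Mapping.keys (rco M m). Poly_Mapping.lookup (rco M m) g) = m"
    and lco_rco: "Poly_Mapping.lookup (rco M (Poly_Mapping.lookup (lco M m) g)) h =
      Poly_Mapping.lookup (lco M (Poly_Mapping.lookup (rco M m) h)) g"

locale majid_bimodule = cocycle3 G \<Phi> + bicomodule G M
  for G (structure) and \<Phi> :: "'a \<Rightarrow> 'a \<Rightarrow> 'a \<Rightarrow> 'k::field"
    and M :: "('k, 'a, 'm::ab_group_add) bimod" +
  assumes lact_linear: "f \<in> carrier G \<Longrightarrow> Vector_Spaces.linear (scl M) (scl M) (lact M f)"
    and ract_linear: "f \<in> carrier G \<Longrightarrow> Vector_Spaces.linear (scl M) (scl M) (\<lambda>m. ract M m f)"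
    and lact_homog: "f \<in> carrier G \<Longrightarrow> g \<in> carrier G \<Longrightarrow> h \<in> carrier G \<Longrightarrow>
      m \<in> homog M g h \<Longrightarrow> lact M f m \<in> homog M (f \<otimes> g) (f \<otimes> h)"
    and ract_homog: "f \<in> carrier G \<Longrightarrow> g \<in> carrier G \<Longrightarrow> h \<in> carrier G \<Longrightarrow>
      m \<in> homog M g h \<Longrightarrow> ract M m f \<in> homog M (g \<otimes> f) (h \<otimes> f)"
    and lact_one: "lact M \<one> m = m"
    and ract_one: "ract M m \<one> = m"
    and lact_lact: "e \<in> carrier G \<Longrightarrow> f \<in> carrier G \<Longrightarrow> g \<in> carrier G \<Longrightarrow> h \<in> carrier G \<Longrightarrow>
      m \<in> homog M g h \<Longrightarrow>
      lact M e (lact M f m) = scl M (\<Phi> e f g / \<Phi> e f h) (lact M (e \<otimes> f) m)"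
    and ract_ract: "e \<in> carrier G \<Longrightarrow> f \<in> carrier G \<Longrightarrow> g \<in> carrier G \<Longrightarrow> h \<in> carrier G \<Longrightarrow>
      m \<in> homog M g h \<Longrightarrow>
      ract M (ract M m e) f = scl M (\<Phi> h e f / \<Phi> g e f) (ract M m (e \<otimes> f))"
    and lact_ract: "e \<in> carrier G \<Longrightarrow> f \<in> carrier G \<Longrightarrow> g \<in> carrier G \<Longrightarrow> h \<in> carrier G \<Longrightarrow>
      m \<in> homog M g h \<Longrightarrow>
      ract M (lact M e m) f = scl M (\<Phi> e h f / \<Phi> e g f) (lact M e (ract M m f))"

definition bimod_iso ::
  "('g, 'x) monoid_scheme \<Rightarrow> ('m \<Rightarrow> 'n) \<Rightarrow> ('k::field, 'g, 'm::ab_group_add) bimod \<Rightarrow>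
   ('k, 'g, 'n::ab_group_add) bimod \<Rightarrow> bool" where
  "bimod_iso G \<phi> M N \<longleftrightarrow>
     Vector_Spaces.linear (scl M) (scl N) \<phi> \<and> bij \<phi> \<and>
     (\<forall>m g. Poly_Mapping.lookup (lco N (\<phi> m)) g = \<phi> (Poly_Mapping.lookup (lco M m) g)) \<and>
     (\<forall>m g. Poly_Mapping.lookup (rco N (\<phi> m)) g = \<phi> (Poly_Mapping.lookup (rco M m) g)) \<and>
     (\<forall>f\<in>carrier G. \<forall>m. \<phi> (lact M f m) = lact N f (\<phi> m) \<and> \<phi> (ract M m f) = ract N (\<phi> m) f)"

text \<open>\<open>homog_comp M m g h\<close> is the component of \<open>m\<close> in \<open>homog M g h\<close>; the twisted actions are given on
  homogeneous elements and extended linearly.\<close>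

definition homog_comp :: "('k, 'g, 'm::zero, 'x) bimod_scheme \<Rightarrow> 'm \<Rightarrow> 'g \<Rightarrow> 'g \<Rightarrow> 'm" where
  "homog_comp M m g h = Poly_Mapping.lookup (rco M (Poly_Mapping.lookup (lco M m) g)) h"

definition bimod_twist ::
  "('g \<Rightarrow> 'g \<Rightarrow> 'k::field) \<Rightarrow> ('k, 'g, 'm::ab_group_add) bimod \<Rightarrow> ('k, 'g, 'm) bimod" where
  "bimod_twist F M = M\<lparr>
     lact := (\<lambda>f m. \<Sum>g\<in>Poly_Mapping.keys (lco M m). \<Sum>h\<in>Poly_Mapping.keys (rco M m).
       scl M (F f h / F f g) (lact M f (homog_comp M m g h))),
     ract := (\<lambda>m f. \<Sum>g\<in>Poly_Mapping.keys (lco M m). \<Sum>h\<in>Poly_Mapping.keys (rco M m).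
       scl M (F h f / F g f) (ract M (homog_comp M m g h) f))\<rparr>"

definition bimod_gauge_equiv ::
  "('g, 'x) monoid_scheme \<Rightarrow> ('g \<Rightarrow> 'g \<Rightarrow> 'g \<Rightarrow> 'k::field) \<Rightarrow> ('k, 'g, 'm::ab_group_add) bimod \<Rightarrow>
   ('g \<Rightarrow> 'g \<Rightarrow> 'g \<Rightarrow> 'k) \<Rightarrow> ('k, 'g, 'n::ab_group_add) bimod \<Rightarrow> bool" where
  "bimod_gauge_equiv G \<Phi> M \<Phi>' N \<longleftrightarrow>
     (\<exists>F. gauge G F \<and> cocycle_eq G \<Phi>' (cocycle_twist G F \<Phi>) \<and>
          (\<exists>\<phi>. bimod_iso G \<phi> (bimod_twist F M) N))"


section \<open>Collections of projective representations\<close>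

definition conj_classes :: "('g, 'x) monoid_scheme \<Rightarrow> 'g set set" where
  "conj_classes G = {{x \<otimes>\<^bsub>G\<^esub> a \<otimes>\<^bsub>G\<^esub> inv\<^bsub>G\<^esub> x |x. x \<in> carrier G} |a. a \<in> carrier G}"

definition centralizer_of :: "('g, 'x) monoid_scheme \<Rightarrow> 'g \<Rightarrow> 'g set" where
  "centralizer_of G a = {x \<in> carrier G. x \<otimes>\<^bsub>G\<^esub> a = a \<otimes>\<^bsub>G\<^esub> x}"

definition cocycle_tilde ::
  "('g, 'x) monoid_scheme \<Rightarrow> ('g \<Rightarrow> 'g \<Rightarrow> 'g \<Rightarrow> 'k::field) \<Rightarrow> 'g \<Rightarrow> 'g \<Rightarrow> 'g \<Rightarrow> 'k" where
  "cocycle_tilde G \<Phi> e f g =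
     (\<Phi> e f g * \<Phi> (e \<otimes>\<^bsub>G\<^esub> f) (inv\<^bsub>G\<^esub> f) (inv\<^bsub>G\<^esub> e) * \<Phi> e (f \<otimes>\<^bsub>G\<^esub> g) (inv\<^bsub>G\<^esub> f)) /
     (\<Phi> (e \<otimes>\<^bsub>G\<^esub> f \<otimes>\<^bsub>G\<^esub> g) (inv\<^bsub>G\<^esub> f) (inv\<^bsub>G\<^esub> e) * \<Phi> e f (inv\<^bsub>G\<^esub> f))"

definition lin_on ::
  "('k \<Rightarrow> 'v \<Rightarrow> 'v) \<Rightarrow> ('k \<Rightarrow> 'w \<Rightarrow> 'w) \<Rightarrow> 'v::ab_group_add set \<Rightarrow> ('v \<Rightarrow> 'w::ab_group_add) \<Rightarrow> bool"
  where "lin_on s t V f \<longleftrightarrow> (\<forall>x\<in>V. \<forall>y\<in>V. f (x + y) = f x + f y) \<and> (\<forall>c. \<forall>x\<in>V. f (s c x) = t c (f x))"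

text \<open>The members of a collection are subspaces \<open>space C\<close> of one ambient vector space.  Throughout,
  \<open>r C\<close> is the chosen representative of the conjugacy class \<open>C\<close>.\<close>

record ('k, 'g, 'v) collection =
  cscl :: "'k \<Rightarrow> 'v \<Rightarrow> 'v"
  space :: "'g set \<Rightarrow> 'v set"
  act :: "'g set \<Rightarrow> 'g \<Rightarrow> 'v \<Rightarrow> 'v"

definition is_collection ::
  "('g, 'x) monoid_scheme \<Rightarrow> ('g set \<Rightarrow> 'g) \<Rightarrow> ('g \<Rightarrow> 'g \<Rightarrow> 'g \<Rightarrow> 'k::field) \<Rightarrow>
   ('k, 'g, 'v::ab_group_add) collection \<Rightarrow> bool" where
  "is_collection G r \<Phi> X \<longleftrightarrow> vector_space (cscl X) \<and>
     (\<forall>C\<in>conj_classes G.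
        module.subspace (cscl X) (space X C) \<and>
        (\<forall>f\<in>centralizer_of G (r C).
           lin_on (cscl X) (cscl X) (space X C) (act X C f) \<and>
           bij_betw (act X C f) (space X C) (space X C)) \<and>
        (\<forall>v\<in>space X C. act X C \<one>\<^bsub>G\<^esub> v = v) \<and>
        (\<forall>e\<in>centralizer_of G (r C). \<forall>f\<in>centralizer_of G (r C). \<forall>v\<in>space X C.
           act X C e (act X C f v) = cscl X (cocycle_tilde G \<Phi> e f (r C)) (act X C (e \<otimes>\<^bsub>G\<^esub> f) v)))"

definition bimod_collection ::
  "('g, 'x) monoid_scheme \<Rightarrow> ('g set \<Rightarrow> 'g) \<Rightarrow> ('k::field, 'g, 'm::ab_group_add) bimod \<Rightarrow>
   ('k, 'g, 'm) collection" where
  "bimod_collection G r M = \<lparr>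
     cscl = scl M,
     space = (\<lambda>C. homog M (r C) \<one>\<^bsub>G\<^esub>),
     act = (\<lambda>C f m. ract M (lact M f m) (inv\<^bsub>G\<^esub> f))\<rparr>"

definition gauge_mu ::
  "('g, 'x) monoid_scheme \<Rightarrow> ('g set \<Rightarrow> 'g) \<Rightarrow> ('g \<Rightarrow> 'g \<Rightarrow> 'k::field) \<Rightarrow> 'g set \<Rightarrow> 'g \<Rightarrow> 'k" where
  "gauge_mu G r F C f =
     F f (inv\<^bsub>G\<^esub> f) / (F f (r C) * F (f \<otimes>\<^bsub>G\<^esub> r C) (inv\<^bsub>G\<^esub> f))"

definition collection_twist ::
  "('g, 'x) monoid_scheme \<Rightarrow> ('g set \<Rightarrow> 'g) \<Rightarrow> ('g \<Rightarrow> 'g \<Rightarrow> 'k::field) \<Rightarrow>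
   ('k, 'g, 'v) collection \<Rightarrow> ('k, 'g, 'v) collection" where
  "collection_twist G r F X =
     X\<lparr>act := (\<lambda>C f m. cscl X (gauge_mu G r F C f) (act X C f m))\<rparr>"

definition rep_iso ::
  "('g, 'x) monoid_scheme \<Rightarrow> ('g set \<Rightarrow> 'g) \<Rightarrow> 'g set \<Rightarrow> ('v \<Rightarrow> 'w) \<Rightarrow>
   ('k::field, 'g, 'v::ab_group_add) collection \<Rightarrow> ('k, 'g, 'w::ab_group_add) collection \<Rightarrow> bool"
  where
  "rep_iso G r C \<phi> X Y \<longleftrightarrow>
     lin_on (cscl X) (cscl Y) (space X C) \<phi> \<and> bij_betw \<phi> (space X C) (space Y C) \<and>
     (\<forall>f\<in>centralizer_of G (r C). \<forall>m\<in>space X C. \<phi> (act X C f m) = act Y C f (\<phi> m))"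

definition collection_gauge_equiv ::
  "('g, 'x) monoid_scheme \<Rightarrow> ('g set \<Rightarrow> 'g) \<Rightarrow> ('g \<Rightarrow> 'g \<Rightarrow> 'g \<Rightarrow> 'k::field) \<Rightarrow>
   ('k, 'g, 'v::ab_group_add) collection \<Rightarrow> ('g \<Rightarrow> 'g \<Rightarrow> 'g \<Rightarrow> 'k) \<Rightarrow>
   ('k, 'g, 'w::ab_group_add) collection \<Rightarrow> bool" where
  "collection_gauge_equiv G r \<Phi> X \<Phi>' Y \<longleftrightarrow>
     is_collection G r \<Phi> X \<and> is_collection G r \<Phi>' Y \<and>
     (\<exists>F. gauge G F \<and> cocycle_eq G \<Phi>' (cocycle_twist G F \<Phi>) \<and>
          (\<forall>C\<in>conj_classes G. \<exists>\<phi>. rep_iso G r C \<phi> (collection_twist G r F X) Y))"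

definition uniformly_projective_equiv ::
  "('g, 'x) monoid_scheme \<Rightarrow> ('g set \<Rightarrow> 'g) \<Rightarrow> ('g \<Rightarrow> 'g \<Rightarrow> 'g \<Rightarrow> 'k::field) \<Rightarrow>
   ('k, 'g, 'v::ab_group_add) collection \<Rightarrow> ('g \<Rightarrow> 'g \<Rightarrow> 'g \<Rightarrow> 'k) \<Rightarrow>
   ('k, 'g, 'w::ab_group_add) collection \<Rightarrow> bool" where
  "uniformly_projective_equiv G r \<Phi> X \<Phi>' Y \<longleftrightarrow>
     is_collection G r \<Phi> X \<and> is_collection G r \<Phi>' Y \<and>
     (\<exists>F. gauge G F \<and> cocycle_eq G \<Phi>' (cocycle_twist G F \<Phi>) \<and>
          (\<forall>C\<in>conj_classes G. \<exists>\<phi>.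
             lin_on (cscl X) (cscl Y) (space X C) \<phi> \<and> bij_betw \<phi> (space X C) (space Y C) \<and>
             (\<forall>f\<in>centralizer_of G (r C). \<forall>m\<in>space X C.
                act Y C f (\<phi> m) = cscl Y (gauge_mu G r F C f) (\<phi> (act X C f m)))))"


section \<open>Hopf quivers and the Majid algebras of a bimodule\<close>

text \<open>The arrow \<open>(x, c, i)\<close> is the \<open>i\<close>-th arrow from \<open>x\<close> to \<open>c \<otimes> x\<close>.\<close>

type_synonym 'g arrow = "'g \<times> 'g \<times> nat"

definition hopf_quiver ::
  "('g, 'x) monoid_scheme \<Rightarrow> ('g set \<Rightarrow> nat) \<Rightarrow> ('g, 'g arrow) pre_digraph" where
  "hopf_quiver G R = \<lparr>
     verts = carrier G,
     arcs = {(x, c, i) |x c i C. x \<in> carrier G \<and> C \<in> conj_classes G \<and> c \<in> C \<and> i < R C},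
     tail = (\<lambda>(x, c, i). x),
     head = (\<lambda>(x, c, i). c \<otimes>\<^bsub>G\<^esub> x)\<rparr>"

text \<open>The pair \<open>(u, [a\<^sub>1, \<dots>, a\<^sub>n])\<close> stands for the path \<open>a\<^sub>n \<cdots> a\<^sub>1\<close> starting at \<open>u\<close>, and
  \<open>(u, [])\<close> for the vertex \<open>u\<close>.\<close>

type_synonym 'g path = "'g \<times> 'g arrow list"

definition paths :: "('g, 'g arrow) pre_digraph \<Rightarrow> 'g path set" where
  "paths Q = {(u, p). \<exists>v. pre_digraph.awalk Q u p v}"

definition path_comul ::
  "('g, 'g arrow) pre_digraph \<Rightarrow> ('g path \<Rightarrow>\<^sub>0 'k::field) \<Rightarrow> ('g path \<times> 'g path \<Rightarrow>\<^sub>0 'k)" where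
  "path_comul Q a = (\<Sum>(u, p)\<in>Poly_Mapping.keys a. fscale (Poly_Mapping.lookup a (u, p))
     (\<Sum>i\<le>length p. tens (bas (pre_digraph.awlast Q u (take i p), drop i p)) (bas (u, take i p))))"

definition path_counit :: "('g path \<Rightarrow>\<^sub>0 'k::field) \<Rightarrow> 'k" where
  "path_counit a = (\<Sum>(u, p)\<in>Poly_Mapping.keys a. if p = [] then Poly_Mapping.lookup a (u, p) else 0)"

definition path_coalgebra :: "('g, 'g arrow) pre_digraph \<Rightarrow> ('g path, 'k::field) coalg" where
  "path_coalgebra Q =
     \<lparr>car = {a. Poly_Mapping.keys a \<subseteq> paths Q}, comul = path_comul Q, counit = path_counit\<rparr>"

definition path_degree :: "('g, 'g arrow) pre_digraph \<Rightarrow> nat \<Rightarrow> ('g path \<Rightarrow>\<^sub>0 'k::field) set" where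
  "path_degree Q n = {a. Poly_Mapping.keys a \<subseteq> {(u, p). (u, p) \<in> paths Q \<and> length p = n}}"

definition vertex :: "'g \<Rightarrow> ('g path \<Rightarrow>\<^sub>0 'k::field)" where
  "vertex g = bas (g, [])"

definition bimod_quiver ::
  "('g, 'x) monoid_scheme \<Rightarrow> ('g set \<Rightarrow> 'g) \<Rightarrow> ('k::field, 'g, 'm::ab_group_add) bimod \<Rightarrow>
   ('g, 'g arrow) pre_digraph" where
  "bimod_quiver G r M =
     hopf_quiver G (\<lambda>C. vector_space.dim (scl M) (homog M (r C) \<one>\<^bsub>G\<^esub>))"

text \<open>\<open>arrow_identification G Q M \<theta>\<close>: \<open>\<theta>\<close> identifies \<open>M\<close> with \<open>kQ\<^sub>1\<close> as a bicomodule, where an arrow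
  from \<open>h\<close> to \<open>g\<close> has bidegree \<open>(g, h)\<close>.\<close>

definition arrow_identification ::
  "('g, 'x) monoid_scheme \<Rightarrow> ('g, 'g arrow) pre_digraph \<Rightarrow>
   ('k::field, 'g, 'm::ab_group_add) bimod \<Rightarrow> ('m \<Rightarrow> ('g path \<Rightarrow>\<^sub>0 'k)) \<Rightarrow> bool" where
  "arrow_identification G Q M \<theta> \<longleftrightarrow>
     Vector_Spaces.linear (scl M) fscale \<theta> \<and> bij_betw \<theta> UNIV (path_degree Q 1) \<and>
     (\<forall>g\<in>carrier G. \<forall>h\<in>carrier G. \<forall>m\<in>homog M g h.
        Poly_Mapping.keys (\<theta> m) \<subseteq> {(h, [a]) |a. a \<in> arcs Q \<and> tail Q a = h \<and> head Q a = g})"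

text \<open>\<open>is_HM G r \<Phi> M H\<close>: \<open>H\<close> is the graded Majid algebra \<open>H(M)\<close>.  The maps in the record \<open>H\<close> are
  only determined on the path coalgebra, so \<open>H(M)\<close> is characterized by a predicate.\<close>

definition is_HM ::
  "('g, 'x) monoid_scheme \<Rightarrow> ('g set \<Rightarrow> 'g) \<Rightarrow> ('g \<Rightarrow> 'g \<Rightarrow> 'g \<Rightarrow> 'k::field) \<Rightarrow>
   ('k, 'g, 'm::ab_group_add) bimod \<Rightarrow> ('g path, 'k) majid \<Rightarrow> bool" where
  "is_HM G r \<Phi> M H \<longleftrightarrow> (let Q = bimod_quiver G r M in
     graded_majid_algebra H (path_degree Q) \<and>
     car H = car (path_coalgebra Q) \<and>
     (\<forall>a\<in>car H. comul H a = comul (path_coalgebra Q) a \<and> counit H a = counit (path_coalgebra Q) a) \<and>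
     unt H = vertex \<one>\<^bsub>G\<^esub> \<and>
     (\<forall>g\<in>carrier G. \<forall>h\<in>carrier G. prd H (vertex g) (vertex h) = vertex (g \<otimes>\<^bsub>G\<^esub> h)) \<and>
     (\<forall>e\<in>carrier G. \<forall>f\<in>carrier G. \<forall>g\<in>carrier G.
        reass H (vertex e) (vertex f) (vertex g) = \<Phi> e f g) \<and>
     (\<forall>g\<in>carrier G. antip H (vertex g) = vertex (inv\<^bsub>G\<^esub> g) \<and>
        alph H (vertex g) = 1 \<and> bet H (vertex g) = 1 / \<Phi> g (inv\<^bsub>G\<^esub> g) g) \<and>
     (\<exists>\<theta>. arrow_identification G Q M \<theta> \<and>
        (\<forall>f\<in>carrier G. \<forall>m. prd H (vertex f) (\<theta> m) = \<theta> (lact M f m) \<and>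
                            prd H (\<theta> m) (vertex f) = \<theta> (ract M m f))))"

text \<open>\<open>B_of G r M H\<close> is \<open>B(M)\<close> if \<open>H\<close> is \<open>H(M)\<close>; \<open>M\<close> is the degree 1 part of \<open>H(M)\<close>.\<close>

definition B_of ::
  "('g, 'x) monoid_scheme \<Rightarrow> ('g set \<Rightarrow> 'g) \<Rightarrow> ('k::field, 'g, 'm::ab_group_add) bimod \<Rightarrow>
   ('g path, 'k) majid \<Rightarrow> ('g path, 'k) majid" where
  "B_of G r M H = H\<lparr>car := \<Inter>{W. sub_majid H W \<and> vertex ` carrier G \<subseteq> W \<and>
     path_degree (bimod_quiver G r M) 1 \<subseteq> W}\<rparr>"

text \<open>
  Gauge equivalence for Majid algebras containing the group \<open>G\<close> as vertices.  The isomorphism is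
  required to be one of Majid algebras over \<open>G\<close>, i.e. to fix the elements of \<open>G\<close>.  Gauge
  equivalence of bimodules and of collections is relative to a fixed group \<open>G\<close> in the same way.
  Without this requirement, pulling back a bimodule along an automorphism of \<open>G\<close> would always
  yield an equivalent Majid algebra, although the two bimodules are in general not gauge equivalent.
\<close>

definition majid_gauge_equiv ::
  "('g, 'x) monoid_scheme \<Rightarrow> ('g path, 'k::field) majid \<Rightarrow> ('g path, 'k) majid \<Rightarrow> bool" where
  "majid_gauge_equiv G H H' \<longleftrightarrow>
     (\<exists>F Fi f. majid_gauge H F Fi \<and> majid_iso f (majid_twist H F Fi) H' \<and>
               (\<forall>g\<in>carrier G. f (vertex g) = vertex g))"

definition finite_dim :: "('k::field \<Rightarrow> 'v::ab_group_add \<Rightarrow> 'v) \<Rightarrow> 'v set \<Rightarrow> bool" where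
  "finite_dim s V \<longleftrightarrow> (\<exists>B. finite B \<and> V \<subseteq> module.span s B)"

end

theory Submission
  imports Defs
begin

text \<open>
  Write \<open>F\<close> for a gauge transformation on \<open>G\<close>.  The conditions on collections and on bimodules are
  compared through the category of bimodules over a fixed cocycle, the conditions on Majid algebras
  and on bimodules through the path coalgebra.

  \<^bold>\<open>Bimodules and collections.\<close>  Right multiplication by group elements and conjugation move every
  homogeneous component of a bimodule \<open>M\<close> bijectively onto one of the chosen components
  \<open>homog M (r C) \<one>\<close>.  All relations between these moves hold up to scalars that depend on the cocycle
  and the degrees but not on the bimodule.  Hence an isomorphism of collections extends to
  the bimodules (\<open>collection_iso_imp_bimod_iso\<close>).  As twisting a bimodule by \<open>F\<close> twists its collection
  by \<open>F\<close>, this applies to \<open>M\<^sub>F\<close> and \<open>N\<close>.  Gauge equivalence and uniform projective equivalence of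
  collections differ only in the side on which the scalar is written.

  \<^bold>\<open>From Majid algebras to bimodules.\<close>  A gauge transformation of \<open>H(M)\<close> or \<open>B(M)\<close> restricts to one of
  \<open>G\<close>.  An isomorphism \<open>f\<close> of coalgebras that fixes the vertices maps the arrows from \<open>h\<close> to \<open>g\<close>, which
  are skew-primitive, to skew-primitive elements; in a path coalgebra these are combinations of
  arrows from \<open>h\<close> to \<open>g\<close> and of vertices.  Neither \<open>f\<close> nor the gauge transformation has to respect the
  grading, but the degree 1 part of \<open>f\<close> on arrows is an isomorphism from \<open>M\<^sub>F\<close> to \<open>N\<close>
  (\<open>majid_gauge_imp_bimod_gauge\<close>).

  \<^bold>\<open>From bimodules to Majid algebras.\<close>  Extend \<open>F\<close> by zero to positive degrees.  An isomorphism from \<open>M\<^sub>F\<close>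
  to \<open>N\<close> extends along paths to an isomorphism of path coalgebras.  It is multiplicative from the
  twist of \<open>H(M)\<close> to \<open>H(N)\<close>, because a graded map into a path coalgebra that is compatible with
  coproducts is determined in degrees 0 and 1 (\<open>cofree_unique\<close>), where the products are those of \<open>G\<close>
  and the actions on the bimodules (\<open>bimod_gauge_imp_majid_gauge\<close>).

  \<^bold>\<open>The subalgebras \<open>B(M)\<close>.\<close>  The smallest sub Majid algebra containing \<open>G\<close> and \<open>M\<close> is already generated
  by products: closure under the antipode follows by induction on the degree from the antipode axiom
  (\<open>gen_antip_degree\<close>).  On elements with fixed end points the twisted product is a nonzero multiple of
  the original one, so the isomorphism constructed above maps \<open>B(M)\<close> onto \<open>B(N)\<close>.
\<close>

section \<open>Linear extension and Sweedler sums\<close>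

abbreviation "coeff \<equiv> Poly_Mapping.lookup"
abbreviation "keys \<equiv> Poly_Mapping.keys"
abbreviation "lin \<equiv> Vector_Spaces.linear"

lemma linearI':
  assumes "vector_space s" "vector_space t" "\<And>x y. f (x + y) = f x + f y" "\<And>c x. f (s c x) = t c (f x)"
  shows "lin s t f"
  using assms by (simp add: Vector_Spaces.linear_iff)

lemma vector_space_mult: "vector_space ((*) :: 'k::field \<Rightarrow> 'k \<Rightarrow> 'k)"
  by unfold_locales (auto simp: algebra_simps)

lemma lin_add: "lin s t f \<Longrightarrow> f (x + y) = f x + f y"
  and lin_scale: "lin s t f \<Longrightarrow> f (s c x) = t c (f x)"
  and linear_vs1: "lin s t f \<Longrightarrow> vector_space s"
  and linear_vs2: "lin s t f \<Longrightarrow> vector_space t"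
  by (simp_all add: Vector_Spaces.linear_iff)

lemma linear_mod: "lin s t f \<Longrightarrow> module_hom s t f"
  by (simp add: Vector_Spaces.linear_def)

lemmas lin_zero = module_hom.zero[OF linear_mod]
lemmas lin_sum = module_hom.sum[OF linear_mod]
lemmas lin_diff = module_hom.diff[OF linear_mod]

named_theorems lin_intros

lemma lin_id [lin_intros]: "vector_space s \<Longrightarrow> lin s s (\<lambda>x. x)"
  by (simp add: Vector_Spaces.linear_iff)

lemma linear_comp:
  "lin t u g \<Longrightarrow> lin s t f \<Longrightarrow> lin s u (\<lambda>x. g (f x))"
  by (simp add: Vector_Spaces.linear_iff)

lemma linear_fscale [lin_intros]:
  "lin s fscale f \<Longrightarrow> lin s fscale (\<lambda>x. fscale c (f x))"
  by (auto simp: Vector_Spaces.linear_iff free.scale_right_distrib mult.commute)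

lemma linear_fscale_left [lin_intros]:
  "lin s (*) f \<Longrightarrow> lin s fscale (\<lambda>x. fscale (f x) v)"
  by (auto simp: Vector_Spaces.linear_iff free.scale_left_distrib free.vector_space_axioms)

lemma linear_mult_right [lin_intros]:
  "lin s ((*) :: 'k::field \<Rightarrow> 'k \<Rightarrow> 'k) f \<Longrightarrow> lin s (*) (\<lambda>x. c * f x)"
  by (auto simp: Vector_Spaces.linear_iff algebra_simps)

lemma linear_mult_left [lin_intros]:
  "lin s ((*) :: 'k::field \<Rightarrow> 'k \<Rightarrow> 'k) f \<Longrightarrow> lin s (*) (\<lambda>x. f x * c)"
  by (auto simp: Vector_Spaces.linear_iff algebra_simps)

lemma lin_plus [lin_intros]:
  "lin s t f \<Longrightarrow> lin s t g \<Longrightarrow> lin s t (\<lambda>x. f x + g x)"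
proof -
  assume *: "lin s t f" "lin s t g"
  then interpret t: vector_space t using linear_vs2 by blast
  show ?thesis using *
    by (auto simp: Vector_Spaces.linear_iff t.scale_right_distrib)
qed

lemma linear_setsum:
  assumes "vector_space s" "vector_space t" "\<And>i. i \<in> I \<Longrightarrow> lin s t (f i)"
  shows "lin s t (\<lambda>x. \<Sum>i\<in>I. f i x)"
proof -
  interpret t: vector_space t using assms by blast
  show ?thesis using assms
    by (auto simp: Vector_Spaces.linear_iff sum.distrib t.scale_sum_right intro!: sum.cong)
qed

lemma linear_lookup [lin_intros]: "lin fscale (*) (\<lambda>a. coeff a x)"
  by (rule linearI') (auto simp: free.vector_space_axioms vector_space_mult lookup_add)

lemma lookup_eqI: "(\<And>x y. coeff u (x, y) = coeff v (x, y)) \<Longrightarrow> u = v"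
  by (rule poly_mapping_eqI) auto

lemma lookup_bas: "coeff (Poly_Mapping.single x c) y = (if x = y then c else 0)"
  by (simp add: lookup_single when_def)

lemma lookup_tens [simp]: "coeff (tens u v) (x, y) = coeff u x * coeff v y"
proof -
  have "coeff (tens u v) (x, y) = (\<Sum>x'\<in>keys u. \<Sum>y'\<in>keys v.
     if x' = x then (if y' = y then coeff u x' * coeff v y' else 0) else 0)"
    by (auto simp: tens_def lookup_sum lookup_bas intro!: sum.cong)
  also have "\<dots> = (\<Sum>x'\<in>keys u. if x' = x then coeff u x' * coeff v y else 0)"
    by (intro sum.cong refl) (auto simp: sum.delta' in_keys_iff)
  also have "\<dots> = coeff u x * coeff v y"
    by (auto simp: sum.delta' in_keys_iff)
  finally show ?thesis .
qed

lemma bilinD: "bilin s f \<Longrightarrow> lin fscale s (f u)"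
  "bilin s f \<Longrightarrow> lin fscale s (\<lambda>u. f u v)"
  by (auto simp: bilin_def)

lemma bilinI: "(\<And>u. lin fscale s (f u)) \<Longrightarrow>
  (\<And>v. lin fscale s (\<lambda>u. f u v)) \<Longrightarrow> bilin s f"
  by (auto simp: bilin_def)

lemma linear_tens1 [lin_intros]:
  "lin s fscale f \<Longrightarrow> lin s fscale (\<lambda>x. tens (f x) v)"
  by (auto simp: Vector_Spaces.linear_iff free.vector_space_axioms lookup_add algebra_simps
      intro!: lookup_eqI)

lemma linear_tens2 [lin_intros]:
  "lin s fscale f \<Longrightarrow> lin s fscale (\<lambda>x. tens v (f x))"
  by (auto simp: Vector_Spaces.linear_iff free.vector_space_axioms lookup_add algebra_simps
      intro!: lookup_eqI)

lemma tens_bas: "tens (bas x) (bas y) = bas (x, y)"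
  by (rule lookup_eqI) (auto simp: lookup_bas)

subsection \<open>Linear extension\<close>

definition lext :: "('k::field \<Rightarrow> 'w \<Rightarrow> 'w) \<Rightarrow> ('b \<Rightarrow> 'w) \<Rightarrow> ('b \<Rightarrow>\<^sub>0 'k) \<Rightarrow> 'w::ab_group_add" where
  "lext s g a = (\<Sum>x\<in>keys a. s (coeff a x) (g x))"

lemma lext_superset:
  assumes "vector_space s" "finite A" "keys a \<subseteq> A"
  shows "lext s g a = (\<Sum>x\<in>A. s (coeff a x) (g x))"
proof -
  interpret s: vector_space s by fact
  show ?thesis unfolding lext_def using assms(2,3)
    by (intro sum.mono_neutral_left) (auto simp: in_keys_iff)
qed

lemma linear_lext [lin_intros]:
  assumes "vector_space s"
  shows "lin fscale s (lext s g)"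
proof (rule linearI')
  interpret s: vector_space s by fact
  show "lext s g (a + b) = lext s g a + lext s g b" for a b
  proof -
    let ?A = "keys a \<union> keys b"
    have "lext s g (a + b) = (\<Sum>x\<in>?A. s (coeff (a + b) x) (g x))"
      "lext s g a = (\<Sum>x\<in>?A. s (coeff a x) (g x))" "lext s g b = (\<Sum>x\<in>?A. s (coeff b x) (g x))"
      using assms keys_add[of a b] by (auto intro!: lext_superset)
    thus ?thesis by (simp add: lookup_add s.scale_left_distrib sum.distrib)
  qed
  show "lext s g (fscale c a) = s c (lext s g a)" for c a
  proof -
    have "lext s g (fscale c a) = (\<Sum>x\<in>keys a. s (coeff (fscale c a) x) (g x))"
      using assms by (rule lext_superset) (auto simp: in_keys_iff)
    thus ?thesis by (simp add: lext_def s.scale_sum_right)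
  qed
qed (use assms free.vector_space_axioms in auto)

lemma lext_bas [simp]:
  assumes "vector_space s" shows "lext s g (bas x) = g x"
  using assms vector_space.vector_space_assms(4) by (simp add: lext_def)

lemma expand_bas: "a = (\<Sum>x\<in>keys a. fscale (coeff a x) (bas x))"
proof (rule poly_mapping_eqI)
  fix y
  have "coeff (\<Sum>x\<in>keys a. fscale (coeff a x) (bas x)) y =
      (\<Sum>x\<in>keys a. if x = y then coeff a x else 0)"
    unfolding lookup_sum by (rule sum.cong) (auto simp: lookup_bas)
  thus "coeff a y = coeff (\<Sum>x\<in>keys a. fscale (coeff a x) (bas x)) y"
    by (simp add: in_keys_iff)
qed

lemma linear_expand:
  assumes "lin fscale s f"
  shows "f a = (\<Sum>x\<in>keys a. s (coeff a x) (f (bas x)))"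
proof -
  have "f a = f (\<Sum>x\<in>keys a. fscale (coeff a x) (bas x))"
    using expand_bas[of a] by simp
  thus ?thesis using assms by (simp add: lin_sum lin_scale)
qed

lemma linear_eq_on_bas:
  assumes "lin fscale s f" "lin fscale s g"
    "\<And>x. x \<in> keys a \<Longrightarrow> f (bas x) = g (bas x)"
  shows "f a = g a"
  unfolding linear_expand[OF assms(1), of a] linear_expand[OF assms(2), of a]
  using assms(3) by simp

lemma bilin_eq_on_bas:
  assumes "bilin s f" "bilin s g"
    and "\<And>x y. x \<in> keys a \<Longrightarrow> y \<in> keys b \<Longrightarrow> f (bas x) (bas y) = g (bas x) (bas y)"
  shows "f a b = g a b"
  by (rule linear_eq_on_bas[OF bilinD(2)[OF assms(1)] bilinD(2)[OF assms(2)]],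
      rule linear_eq_on_bas[OF bilinD(1)[OF assms(1)] bilinD(1)[OF assms(2)]], rule assms(3))

lemma linear_in_subspace:
  assumes "lin fscale s f" "module.subspace s X"
    "\<And>x. x \<in> keys a \<Longrightarrow> f (bas x) \<in> X"
  shows "f a \<in> X"
proof -
  interpret s: vector_space s using assms linear_vs2 by blast
  show ?thesis unfolding linear_expand[OF assms(1), of a] using assms
    by (intro s.subspace_sum s.subspace_scale) auto
qed

lemma in_subspace_bas:
  assumes "free.subspace X" "\<And>x. x \<in> keys a \<Longrightarrow> bas x \<in> X"
  shows "a \<in> X"
  by (rule linear_in_subspace[OF lin_id[OF free.vector_space_axioms] assms])

lemma lext_tens:
  assumes "bilin s f"
  shows "lext s (\<lambda>(x, y). f (bas x) (bas y)) (tens u v) = f u v"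
proof -
  interpret s: vector_space s using bilinD(1)[OF assms] linear_vs2 by blast
  have k: "keys (tens u v) \<subseteq> keys u \<times> keys v"
    by (auto simp: in_keys_iff)
  have "lext s (\<lambda>(x, y). f (bas x) (bas y)) (tens u v) =
     (\<Sum>x\<in>keys u. \<Sum>y\<in>keys v. s (coeff u x) (s (coeff v y) (f (bas x) (bas y))))"
    by (subst lext_superset[OF s.vector_space_axioms _ k])
       (auto simp: sum.cartesian_product intro!: sum.cong)
  also have "\<dots> = (\<Sum>x\<in>keys u. s (coeff u x) (f (bas x) v))"
    by (simp add: linear_expand[OF bilinD(1)[OF assms], of _ v] s.scale_sum_right)
  also have "\<dots> = f u v"
    by (simp add: linear_expand[OF bilinD(2)[OF assms], of u])
  finally show ?thesis .
qed

lemma sw2_lext: "sw2 s H a f = lext s (\<lambda>(x, y). f (bas x) (bas y)) (comul H a)"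
  unfolding sw2_def lext_def by (rule sum.cong) auto

lemma linear_sw2:
  assumes "vector_space s" "lin fscale fscale (comul H)"
  shows "lin fscale s (\<lambda>a. sw2 s H a f)"
  unfolding sw2_lext by (rule linear_comp[OF linear_lext assms(2)]) fact

lemma linear_sw2_arg:
  assumes "\<And>x y. lin u s (\<lambda>w. f w x y)" "vector_space u"
  shows "lin u s (\<lambda>w. sw2 s H a (f w))"
proof -
  interpret s: vector_space s using assms linear_vs2 by blast
  show ?thesis unfolding sw2_def case_prod_unfold
  proof (rule linear_setsum[OF assms(2) s.vector_space_axioms])
    fix i
    show "lin u s (\<lambda>x. s (coeff (comul H a) (fst i, snd i)) (f x (bas (fst i)) (bas (snd i))))"
      using assms(1)[of "bas (fst i)" "bas (snd i)"]
      by (auto simp: Vector_Spaces.linear_iff s.scale_right_distrib mult.commute)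
  qed
qed

text \<open>A bilinear map applied in Sweedler notation may be evaluated on any expression of the
  coproduct as a sum of pure tensors.\<close>

lemma sw2_sum_tens:
  assumes "bilin s f" "comul H a = (\<Sum>i\<in>I. tens (u i) (v i))"
  shows "sw2 s H a f = (\<Sum>i\<in>I. f (u i) (v i))"
proof -
  have "vector_space s" using bilinD(1)[OF assms(1)] linear_vs2 by blast
  from linear_lext[OF this] show ?thesis
    unfolding sw2_lext assms(2) by (subst lin_sum) (auto simp: lext_tens[OF assms(1)])
qed

text \<open>The form in which subcoalgebras are used: a bilinear expression in \<open>a\<^sub>1\<close> and \<open>a\<^sub>2\<close> stays in a subspace
  if it does so for all elements of the tensor factors.\<close>

lemma sw2_closed:
  assumes "bilin s f" "comul H a \<in> tensor V W" "module.subspace s X"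
    "\<And>u v. u \<in> V \<Longrightarrow> v \<in> W \<Longrightarrow> f u v \<in> X"
  shows "sw2 s H a f \<in> X"
proof -
  interpret s: vector_space s using bilinD(1)[OF assms(1)] linear_vs2 by blast
  let ?T = "lext s (\<lambda>(x, y). f (bas x) (bas y))"
  have T: "lin fscale s ?T" by (intro linear_lext) unfold_locales
  have "?T b \<in> X" if "b \<in> tensor V W" for b
    using that unfolding tensor_def
  proof (induction rule: free.span_induct_alt)
    case base
    then show ?case using assms(3) T by (simp add: lin_zero s.subspace_0)
  next
    case (step c x y)
    then show ?case using assms T
      by (auto simp: lin_add lin_scale lext_tens intro!: s.subspace_add s.subspace_scale)
  qed
  thus ?thesis using assms(2) by (simp add: sw2_lext)
qed

lemma tensor_subspace: "free.subspace (tensor V W)"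
  unfolding tensor_def by (rule free.subspace_span)

lemma tens_in_tensor:
  assumes "u \<in> V" "v \<in> W" shows "tens u v \<in> tensor V W"
proof -
  have "tens u v \<in> {tens u v |u v. u \<in> V \<and> v \<in> W}" using assms by blast
  thus ?thesis unfolding tensor_def by (rule free.span_base)
qed

section \<open>The path coalgebra of a Hopf quiver\<close>

text \<open>The last vertex of the path that starts at \<open>u\<close>.  It depends on the labels of the arrows only, so
  that Hopf quivers of \<open>G\<close> with different numbers of arrows share this function.\<close>

primrec target :: "('g, 'x) monoid_scheme \<Rightarrow> 'g \<Rightarrow> 'g arrow list \<Rightarrow> 'g" where
  "target G u [] = u"
| "target G u (a # p) = target G (fst (snd a) \<otimes>\<^bsub>G\<^esub> fst a) p"

lemma target_append [simp]: "target G u (p @ q) = target G (target G u p) q"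
  by (induction p arbitrary: u) auto

lemma tail_hopf_quiver [simp]: "tail (hopf_quiver G R) a = fst a"
  and head_hopf_quiver [simp]: "head (hopf_quiver G R) a = fst (snd a) \<otimes>\<^bsub>G\<^esub> fst a"
  and verts_hopf_quiver [simp]: "verts (hopf_quiver G R) = carrier G"
  by (auto simp: hopf_quiver_def split: prod.splits)

lemma awlast_hopf_quiver [simp]: "pre_digraph.awlast (hopf_quiver G R) u p = target G u p"
  by (induction p arbitrary: u) (auto simp: pre_digraph.awalk_verts.simps pre_digraph.awalk_verts_non_Nil)

lemma (in group) conj_class_carrier: "C \<in> conj_classes G \<Longrightarrow> c \<in> C \<Longrightarrow> c \<in> carrier G"
  by (auto simp: conj_classes_def)

lemma (in group) arc_carrier:
  assumes "a \<in> arcs (hopf_quiver G R)"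
  shows "fst a \<in> carrier G" "fst (snd a) \<in> carrier G" "fst (snd a) \<otimes> fst a \<in> carrier G"
  using assms conj_class_carrier by (auto simp: hopf_quiver_def)

lemma (in group) paths_Nil [simp]: "(u, []) \<in> paths (hopf_quiver G R) \<longleftrightarrow> u \<in> carrier G"
  by (auto simp: paths_def pre_digraph.awalk_def pre_digraph.cas.simps)

lemma (in group) paths_Cons [simp]: "(u, a # p) \<in> paths (hopf_quiver G R) \<longleftrightarrow>
    a \<in> arcs (hopf_quiver G R) \<and> u = fst a \<and> (fst (snd a) \<otimes> fst a, p) \<in> paths (hopf_quiver G R)"
  using arc_carrier[of a R]
  by (auto simp: paths_def pre_digraph.awalk_def pre_digraph.cas.simps)

lemma (in group) paths_append [simp]: "(u, p @ q) \<in> paths (hopf_quiver G R) \<longleftrightarrow>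
    (u, p) \<in> paths (hopf_quiver G R) \<and> (target G u p, q) \<in> paths (hopf_quiver G R)"
proof (induction p arbitrary: u)
  case Nil
  have "(u, q) \<in> paths (hopf_quiver G R) \<Longrightarrow> u \<in> carrier G"
    by (cases q) (auto dest: arc_carrier(1))
  then show ?case by auto
qed auto

lemma (in group) path_start: "(u, p) \<in> paths (hopf_quiver G R) \<Longrightarrow> u \<in> carrier G"
  by (cases p) (auto dest: arc_carrier(1))

lemma (in group) path_target: "(u, p) \<in> paths (hopf_quiver G R) \<Longrightarrow> target G u p \<in> carrier G"
  by (induction p arbitrary: u) auto

lemma (in group) path_cut:
  assumes "(u, p) \<in> paths (hopf_quiver G R)"
  shows "(u, take i p) \<in> paths (hopf_quiver G R)"
    "(target G u (take i p), drop i p) \<in> paths (hopf_quiver G R)"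
  using assms paths_append[of u "take i p" "drop i p" R] by auto

lemma target_cut: "target G (target G u (take i p)) (drop i p) = target G u p"
  using target_append[of G u "take i p" "drop i p"] by simp

lemma linear_path_comul:
  "lin fscale fscale (path_comul Q :: ('g path \<Rightarrow>\<^sub>0 'k::field) \<Rightarrow> _)"
proof -
  have "(path_comul Q :: ('g path \<Rightarrow>\<^sub>0 'k) \<Rightarrow> _) = lext fscale (\<lambda>(u, p). \<Sum>i\<le>length p.
      tens (bas (pre_digraph.awlast Q u (take i p), drop i p)) (bas (u, take i p)))"
    by (rule ext, unfold path_comul_def lext_def) (auto intro!: sum.cong)
  thus ?thesis by (simp add: linear_lext free.vector_space_axioms)
qed

lemma path_comul_bas: "path_comul (hopf_quiver G R) (bas (u, p) :: 'g path \<Rightarrow>\<^sub>0 'k::field) =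
    (\<Sum>i\<le>length p. tens (bas (target G u (take i p), drop i p)) (bas (u, take i p)))"
  by (simp add: path_comul_def)

text \<open>Dually to concatenation of paths: the coefficient of a coproduct at \<open>q \<otimes> p\<close> is the coefficient
  at the concatenated path.\<close>

lemma lookup_path_comul:
  fixes G :: "('g, 'x) monoid_scheme" and a :: "'g path \<Rightarrow>\<^sub>0 'k::field"
  shows "coeff (path_comul (hopf_quiver G R) a) ((w, q), (u, p)) =
    (if w = target G u p then coeff a (u, p @ q) else 0)"
proof -
  let ?f = "\<lambda>a :: 'g path \<Rightarrow>\<^sub>0 'k. coeff (path_comul (hopf_quiver G R) a) ((w, q), (u, p))"
  let ?g = "\<lambda>a :: 'g path \<Rightarrow>\<^sub>0 'k. (if w = target G u p then 1 else 0) * coeff a (u, p @ q)"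
  have "?f a = ?g a"
  proof (rule linear_eq_on_bas)
    show "lin fscale (*) ?f"
      by (rule linear_comp[OF linear_lookup linear_path_comul])
    show "lin fscale (*) ?g" by (intro lin_intros)
    fix x :: "'g path"
    obtain v r where x: "x = (v, r)" by fastforce
    have "?f (bas x) = (\<Sum>i\<le>length r. if i = length p then
         (if w = target G u p \<and> v = u \<and> r = p @ q then 1 else 0) else 0)"
      unfolding x path_comul_bas lookup_sum
    proof (intro sum.cong refl)
      fix i assume "i \<in> {..length r}"
      then have iff: "(take i r = p \<and> drop i r = q) \<longleftrightarrow> (i = length p \<and> r = p @ q)"
        by (auto simp: min_def)
      show "coeff (tens (bas (target G v (take i r), drop i r)) (bas (v, take i r))) ((w, q), (u, p)) =
        (if i = length p then if w = target G u p \<and> v = u \<and> r = p @ q then 1 else 0 else (0 :: 'k))"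
      proof (cases "take i r = p \<and> drop i r = q")
        case True
        with iff show ?thesis by (auto simp: lookup_bas)
      next
        case False
        then have "coeff (tens (bas (target G v (take i r), drop i r)) (bas (v, take i r)))
            ((w, q), (u, p)) = (0 :: 'k)"
          by (auto simp: lookup_bas)
        thus ?thesis using False iff by auto
      qed
    qed
    also have "\<dots> = ?g (bas x)" by (auto simp: x lookup_bas)
    finally show "?f (bas x) = ?g (bas x)" .
  qed
  thus ?thesis by auto
qed

lemma path_degree_iff: "a \<in> path_degree Q n \<longleftrightarrow>
    (\<forall>x. coeff a x \<noteq> 0 \<longrightarrow> x \<in> paths Q \<and> length (snd x) = n)"
  by (auto simp: path_degree_def in_keys_iff subset_iff)

lemma path_degree_subspace: "free.subspace (path_degree Q n)"
proof (rule free.subspaceI, goal_cases)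
  case (2 a b)
  show ?case unfolding path_degree_iff
  proof (intro allI impI)
    fix x assume "coeff (a + b) x \<noteq> 0"
    then have "coeff a x \<noteq> 0 \<or> coeff b x \<noteq> 0" by (auto simp: lookup_add)
    thus "x \<in> paths Q \<and> length (snd x) = n" using 2 unfolding path_degree_iff by blast
  qed
qed (auto simp: path_degree_iff)

definition restr :: "('b \<Rightarrow> bool) \<Rightarrow> ('b \<Rightarrow>\<^sub>0 'k::field) \<Rightarrow> ('b \<Rightarrow>\<^sub>0 'k)" where
  "restr P = lext fscale (\<lambda>x. if P x then bas x else 0)"

lemma linear_restr [lin_intros]: "lin fscale fscale (restr P)"
  unfolding restr_def by (intro lin_intros free.vector_space_axioms)

lemma restr_bas [simp]: "restr P (bas x) = (if P x then bas x else 0)"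
  by (simp add: restr_def free.vector_space_axioms)

lemma lookup_restr [simp]: "coeff (restr P a) x = (if P x then coeff a x else 0)"
proof -
  have "coeff (restr P a) x = (if P x then 1 else 0) * coeff a x"
    by (rule linear_eq_on_bas[where s = "(*)"], rule linear_comp[OF linear_lookup linear_restr],
        intro lin_intros) (auto simp: lookup_bas)
  thus ?thesis by auto
qed

section \<open>Majid algebras on path coalgebras\<close>

lemma sum_single:
  assumes "finite A" "i \<in> A" "\<And>j. j \<in> A \<Longrightarrow> j \<noteq> i \<Longrightarrow> f j = 0"
  shows "sum f A = f i"
  using assms by (subst sum.remove[of A i]) auto

text \<open>A graded Majid algebra on the path coalgebra of a Hopf quiver with prescribed structure on the
  vertices.  This is \<open>H(M)\<close> without reference to the bimodule \<open>M\<close>.\<close>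

locale path_majid = group G + graded_majid_algebra H "path_degree (hopf_quiver G R)"
  for G (structure) and R :: "'a set \<Rightarrow> nat" and \<Phi> :: "'a \<Rightarrow> 'a \<Rightarrow> 'a \<Rightarrow> 'k::field"
    and H :: "('a path, 'k) majid" +
  assumes car_path: "car H = {a. keys a \<subseteq> paths (hopf_quiver G R)}"
    and comul_path: "a \<in> car H \<Longrightarrow> comul H a = path_comul (hopf_quiver G R) a"
    and counit_path: "a \<in> car H \<Longrightarrow> counit H a = path_counit a"
    and unt_vertex: "unt H = vertex \<one>"
    and prd_vertex: "g \<in> carrier G \<Longrightarrow> h \<in> carrier G \<Longrightarrow> prd H (vertex g) (vertex h) = vertex (g \<otimes> h)"
    and reass_vertex: "e \<in> carrier G \<Longrightarrow> f \<in> carrier G \<Longrightarrow> g \<in> carrier G \<Longrightarrow>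
      reass H (vertex e) (vertex f) (vertex g) = \<Phi> e f g"
    and antip_vertex: "g \<in> carrier G \<Longrightarrow> antip H (vertex g) = vertex (inv g)"
    and alph_vertex: "g \<in> carrier G \<Longrightarrow> alph H (vertex g) = 1"
begin

abbreviation "Q \<equiv> hopf_quiver G R"

lemma in_car_iff: "a \<in> car H \<longleftrightarrow> (\<forall>x. coeff a x \<noteq> 0 \<longrightarrow> x \<in> paths Q)"
  by (auto simp: car_path subset_iff in_keys_iff)

lemma bas_car: "x \<in> paths Q \<Longrightarrow> bas x \<in> car H"
  by (auto simp: car_path)

lemma vertex_car: "g \<in> carrier G \<Longrightarrow> vertex g \<in> car H"
  by (simp add: vertex_def bas_car)

lemma degree_car: "a \<in> path_degree Q n \<Longrightarrow> a \<in> car H"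
  using gr_subset by blast

lemma bas_degree: "(u, p) \<in> paths Q \<Longrightarrow> bas (u, p) \<in> path_degree Q (length p)"
  by (auto simp: path_degree_def)

lemma vertex_degree: "g \<in> carrier G \<Longrightarrow> vertex g \<in> path_degree Q 0"
  using bas_degree[of g "[]"] by (simp add: vertex_def)

lemmas linear_prd1 = bilinD(2)[OF prd_bilin]
  and linear_prd2 = bilinD(1)[OF prd_bilin]

lemma sw2_bas:
  assumes s: "vector_space s" and "(u, p) \<in> paths Q"
  shows "sw2 s H (bas (u, p)) f =
    (\<Sum>i\<le>length p. f (bas (target G u (take i p), drop i p)) (bas (u, take i p)))"
  using assms
  by (simp add: sw2_lext comul_path[OF bas_car] path_comul_bas tens_bas lin_sum[OF linear_lext])

subsection \<open>Sweedler sums that vanish on arrows\<close>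

text \<open>In every summand of an iterated coproduct of a path of positive length some tensor factor has
  positive length.  Hence expressions built from forms of degree 0 see vertices only.\<close>

lemma sw2_only_vertices:
  assumes s: "vector_space s" and up: "(u, p) \<in> paths Q"
    and f: "\<And>x y. x \<in> paths Q \<Longrightarrow> y \<in> paths Q \<Longrightarrow> snd x \<noteq> [] \<or> snd y \<noteq> [] \<Longrightarrow> f (bas x) (bas y) = 0"
  shows "sw2 s H (bas (u, p)) f = (if p = [] then f (vertex u) (vertex u) else 0)"
proof (cases "p = []")
  case True
  then show ?thesis using sw2_bas[OF s up] by (simp add: vertex_def)
next
  case False
  have "f (bas (target G u (take i p), drop i p)) (bas (u, take i p)) = 0" for i
  proof (rule f)
    show "snd (target G u (take i p), drop i p) \<noteq> [] \<or> snd (u, take i p) \<noteq> []"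
      using False by (cases p; cases i) auto
  qed (use path_cut[OF up, of i] in auto)
  then show ?thesis using False by (simp add: sw2_bas[OF s up])
qed

lemma sw3_only_vertices:
  assumes s: "vector_space s" and up: "(u, p) \<in> paths Q"
    and f: "\<And>x y z. x \<in> paths Q \<Longrightarrow> y \<in> paths Q \<Longrightarrow> z \<in> paths Q \<Longrightarrow>
      snd x \<noteq> [] \<or> snd y \<noteq> [] \<or> snd z \<noteq> [] \<Longrightarrow> f (bas x) (bas y) (bas z) = 0"
  shows "sw3 s H (bas (u, p)) f = (if p = [] then f (vertex u) (vertex u) (vertex u) else 0)"
proof -
  have in2: "sw2 s H (bas y) (f (bas x)) = (if snd y = [] then f (bas x) (vertex (fst y)) (vertex (fst y)) else 0)"
    if "x \<in> paths Q" "y \<in> paths Q" for x y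
    using sw2_only_vertices[OF s, of "fst y" "snd y" "f (bas x)"] f that by auto
  have "sw3 s H (bas (u, p)) f =
      (if p = [] then sw2 s H (vertex u) (f (vertex u)) else 0)"
    unfolding sw3_def
  proof (rule sw2_only_vertices[OF s up])
    fix x y assume *: "x \<in> paths Q" "y \<in> paths Q" "snd x \<noteq> [] \<or> snd y \<noteq> []"
    then have "snd y = [] \<Longrightarrow> (fst y, []) \<in> paths Q" by (cases y) auto
    with * show "sw2 s H (bas y) (f (bas x)) = 0"
      by (simp add: in2) (auto simp: vertex_def intro!: f)
  qed
  thus ?thesis using in2[of "(u, [])" "(u, [])"] up path_start[OF up] by (auto simp: vertex_def)
qed

lemma sw4_only_vertices:
  assumes s: "vector_space s" and up: "(u, p) \<in> paths Q"
    and f: "\<And>x y z w. x \<in> paths Q \<Longrightarrow> y \<in> paths Q \<Longrightarrow> z \<in> paths Q \<Longrightarrow> w \<in> paths Q \<Longrightarrow>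
      snd x \<noteq> [] \<or> snd y \<noteq> [] \<or> snd z \<noteq> [] \<or> snd w \<noteq> [] \<Longrightarrow> f (bas x) (bas y) (bas z) (bas w) = 0"
  shows "sw4 s H (bas (u, p)) f =
    (if p = [] then f (vertex u) (vertex u) (vertex u) (vertex u) else 0)"
proof -
  have in3: "sw3 s H (bas y) (f (bas x)) = (if snd y = [] then f (bas x) (vertex (fst y)) (vertex (fst y)) (vertex (fst y)) else 0)"
    if "x \<in> paths Q" "y \<in> paths Q" for x y
    using sw3_only_vertices[OF s, of "fst y" "snd y" "f (bas x)"] f that by auto
  have "sw4 s H (bas (u, p)) f =
      (if p = [] then sw3 s H (vertex u) (f (vertex u)) else 0)"
    unfolding sw4_def
  proof (rule sw2_only_vertices[OF s up])
    fix x y assume *: "x \<in> paths Q" "y \<in> paths Q" "snd x \<noteq> [] \<or> snd y \<noteq> []"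
    then have "snd y = [] \<Longrightarrow> (fst y, []) \<in> paths Q" by (cases y) auto
    with * show "sw3 s H (bas y) (f (bas x)) = 0"
      by (simp add: in3) (auto simp: vertex_def intro!: f)
  qed
  thus ?thesis using in3[of "(u, [])" "(u, [])"] up path_start[OF up] by (auto simp: vertex_def)
qed

lemma sw5_only_vertices:
  assumes s: "vector_space s" and up: "(u, p) \<in> paths Q"
    and f: "\<And>x y z w v. x \<in> paths Q \<Longrightarrow> y \<in> paths Q \<Longrightarrow> z \<in> paths Q \<Longrightarrow> w \<in> paths Q \<Longrightarrow> v \<in> paths Q \<Longrightarrow>
      snd x \<noteq> [] \<or> snd y \<noteq> [] \<or> snd z \<noteq> [] \<or> snd w \<noteq> [] \<or> snd v \<noteq> [] \<Longrightarrow>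
      f (bas x) (bas y) (bas z) (bas w) (bas v) = 0"
  shows "sw5 s H (bas (u, p)) f =
    (if p = [] then f (vertex u) (vertex u) (vertex u) (vertex u) (vertex u) else 0)"
proof -
  have in4: "sw4 s H (bas y) (f (bas x)) =
     (if snd y = [] then f (bas x) (vertex (fst y)) (vertex (fst y)) (vertex (fst y)) (vertex (fst y)) else 0)"
    if "x \<in> paths Q" "y \<in> paths Q" for x y
    using sw4_only_vertices[OF s, of "fst y" "snd y" "f (bas x)"] f that by auto
  have "sw5 s H (bas (u, p)) f =
      (if p = [] then sw4 s H (vertex u) (f (vertex u)) else 0)"
    unfolding sw5_def
  proof (rule sw2_only_vertices[OF s up])
    fix x y assume *: "x \<in> paths Q" "y \<in> paths Q" "snd x \<noteq> [] \<or> snd y \<noteq> []"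
    then have "snd y = [] \<Longrightarrow> (fst y, []) \<in> paths Q" by (cases y) auto
    with * show "sw4 s H (bas y) (f (bas x)) = 0"
      by (simp add: in4) (auto simp: vertex_def intro!: f)
  qed
  thus ?thesis using in4[of "(u, [])" "(u, [])"] up path_start[OF up] by (auto simp: vertex_def)
qed

lemma sw2_vertex:
  assumes "vector_space s" "g \<in> carrier G"
  shows "sw2 s H (vertex g) f = f (vertex g) (vertex g)"
  using sw2_bas[of s g "[]" f] assms by (simp add: vertex_def)

lemma
  assumes "vector_space s" "g \<in> carrier G"
  shows sw3_vertex: "sw3 s H (vertex g) f3 = f3 (vertex g) (vertex g) (vertex g)"
    and sw4_vertex: "sw4 s H (vertex g) f4 = f4 (vertex g) (vertex g) (vertex g) (vertex g)"
    and sw5_vertex: "sw5 s H (vertex g) f5 = f5 (vertex g) (vertex g) (vertex g) (vertex g) (vertex g)"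
  by (simp_all add: sw3_def sw4_def sw5_def sw2_vertex[OF assms])

text \<open>If the outer two factors have to be vertices, then of the coproduct of a path from \<open>s\<close> to \<open>t\<close> only
  the summand with outer factors \<open>t\<close> and \<open>s\<close> remains.  This evaluates products twisted by a gauge form
  of degree 0.\<close>

lemma sw3_outer_vertices:
  assumes s: "vector_space s" and up: "(u, p) \<in> paths Q"
    and f1: "\<And>w q y z. (w, q) \<in> paths Q \<Longrightarrow> q \<noteq> [] \<Longrightarrow> f (bas (w, q)) y z = 0"
    and f3: "\<And>w q y z. (w, q) \<in> paths Q \<Longrightarrow> q \<noteq> [] \<Longrightarrow> f y z (bas (w, q)) = 0"
  shows "sw3 s H (bas (u, p)) f = f (vertex (target G u p)) (bas (u, p)) (vertex u)"
proof -
  have "sw3 s H (bas (u, p)) f = (\<Sum>i\<le>length p. sw2 s H (bas (u, take i p)) (f (bas (target G u (take i p), drop i p))))"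
    by (simp add: sw3_def sw2_bas[OF s up])
  also have "\<dots> = sw2 s H (bas (u, p)) (f (vertex (target G u p)))"
  proof (subst sum_single[where i = "length p"])
    fix i assume "i \<in> {..length p}" "i \<noteq> length p"
    then show "sw2 s H (bas (u, take i p)) (f (bas (target G u (take i p), drop i p))) = 0"
      using path_cut[OF up, of i] by (simp add: sw2_bas[OF s] f1)
  qed (auto simp: vertex_def)
  also have "\<dots> = f (vertex (target G u p)) (bas (u, p)) (vertex u)"
    unfolding sw2_bas[OF s up]
  proof (subst sum_single[where i = 0])
    fix i assume "i \<in> {..length p}" "i \<noteq> 0"
    then show "f (vertex (target G u p)) (bas (target G u (take i p), drop i p)) (bas (u, take i p)) = 0"
      using path_cut[OF up, of i] by (intro f3) auto
  qed (auto simp: vertex_def)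
  finally show ?thesis .
qed

subsection \<open>Skew-primitive elements\<close>

definition arrows_between :: "'a \<Rightarrow> 'a \<Rightarrow> ('a path \<Rightarrow>\<^sub>0 'k) set" where
  "arrows_between h g = {v. \<forall>x. coeff v x \<noteq> 0 \<longrightarrow> x \<in> paths Q \<and> (\<exists>a. x = (h, [a]) \<and> head Q a = g)}"

lemma arrows_between_degree: "v \<in> arrows_between h g \<Longrightarrow> v \<in> path_degree Q 1"
  unfolding arrows_between_def path_degree_iff by fastforce

lemma lookup_vertex: "coeff (vertex g) x = (if x = (g, []) then 1 else 0)"
  by (auto simp: vertex_def lookup_bas)

lemma path_comul_arrows_between:
  assumes v: "v \<in> arrows_between h g"
  shows "path_comul Q v = tens v (vertex h) + tens (vertex g) v"
proof (rule poly_mapping_eqI)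
  have "coeff v (x, r) \<noteq> 0 \<Longrightarrow> length r = 1" for x r
    using v unfolding arrows_between_def by fastforce
  then have supp0: "length r \<noteq> 1 \<Longrightarrow> coeff v (x, r) = 0" for x r by blast
  have supp1: "coeff v (x, [a]) \<noteq> 0 \<Longrightarrow> x = h \<and> fst (snd a) \<otimes> fst a = g" for x a
    using v unfolding arrows_between_def by fastforce
  fix z :: "'a path \<times> 'a path"
  obtain w q u p where z: "z = ((w, q), (u, p))" by (metis surj_pair)
  have lhs: "coeff (path_comul Q v) z = (if w = target G u p then coeff v (u, p @ q) else 0)"
    by (simp add: z lookup_path_comul)
  have rhs: "coeff (tens v (vertex h) + tens (vertex g) v) z =
      (if u = h \<and> p = [] then coeff v (w, q) else 0) + (if w = g \<and> q = [] then coeff v (u, p) else 0)"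
    by (auto simp: z lookup_add lookup_vertex)
  have "(if w = target G u p then coeff v (u, p @ q) else 0) =
    (if u = h \<and> p = [] then coeff v (w, q) else 0) + (if w = g \<and> q = [] then coeff v (u, p) else 0)"
  proof (cases "length (p @ q) = 1")
    case True
    then consider a where "p = []" "q = [a]" | a where "p = [a]" "q = []"
      by (cases p) (auto simp: length_Suc_conv)
    then show ?thesis using supp1
      by cases (auto simp: supp0)
  qed (auto simp: supp0)
  thus "coeff (path_comul Q v) z = coeff (tens v (vertex h) + tens (vertex g) v) z"
    using lhs rhs by simp
qed

text \<open>The coefficient of the coproduct at \<open>q \<otimes> p\<close> is the coefficient at a concatenated path, whereas
  \<open>tens v (vertex h) + tens (vertex g) v\<close> has no terms with both factors of positive length.  This
  excludes components of degree at least 2.  The degree 0 part need not vanish, as \<open>vertex g - vertex h\<close>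
  shows.\<close>

lemma skew_primitive_support:
  assumes v: "v \<in> car H" and skew: "path_comul Q v = tens v (vertex h) + tens (vertex g) v"
  shows "restr (\<lambda>x. length (snd x) = 1) v \<in> arrows_between h g"
    and "coeff v (u, p) \<noteq> 0 \<Longrightarrow> length p \<le> 1"
proof -
  have eq: "(if w = target G u p then coeff v (u, p @ q) else 0) =
      (if u = h \<and> p = [] then coeff v (w, q) else 0) + (if w = g \<and> q = [] then coeff v (u, p) else 0)" for w q u p
    using arg_cong[OF skew, of "\<lambda>t. coeff t ((w, q), (u, p))"]
    by (auto simp: lookup_path_comul lookup_add lookup_vertex)
  show "length p \<le> 1" if "coeff v (u, p) \<noteq> 0"
  proof (rule ccontr)
    assume "\<not> length p \<le> 1"
    then obtain a b r where "p = [a] @ (b # r)"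
      by (metis One_nat_def append_Cons append_Nil le_numeral_extra(4) length_0_conv length_Cons list.exhaust not_less_eq_eq zero_le)
    with eq[of "target G u [a]" u "[a]" "b # r"] that show False by simp
  qed
  have "u = h \<and> fst (snd a) \<otimes> fst a = g" if "coeff v (u, [a]) \<noteq> 0" for u a
    using eq[of "target G u [a]" u "[a]" "[]"] eq[of u u "[]" "[a]"] that by (auto split: if_splits)
  moreover have "x \<in> paths Q" if "coeff v x \<noteq> 0" for x using v that unfolding in_car_iff by blast
  ultimately show "restr (\<lambda>x. length (snd x) = 1) v \<in> arrows_between h g"
    by (fastforce simp: arrows_between_def length_Suc_conv)
qed

text \<open>A gauge transformation of a Majid algebra may be nonzero on arrows, so in a product twisted by it all
  three summands of the iterated coproduct contribute.\<close>

lemma sw3_arrows_between: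
  assumes v: "v \<in> arrows_between h g" and f: "trilin s f" and gh: "g \<in> carrier G" "h \<in> carrier G"
  shows "sw3 s H v f = f v (vertex h) (vertex h) + f (vertex g) v (vertex h) + f (vertex g) (vertex g) v"
proof -
  have bil: "bilin s (f u)" and l1: "lin fscale s (\<lambda>u. f u v w)" for u v w
    using f by (auto simp: trilin_def)
  then have s: "vector_space s" using linear_vs2 by blast
  have "comul H v = path_comul Q v"
    using comul_path degree_car arrows_between_degree v by blast
  also have "\<dots> = tens v (vertex h) + tens (vertex g) v"
    using path_comul_arrows_between v by blast
  finally have comul: "comul H v = (\<Sum>i\<in>UNIV. tens (if i then v else vertex g) (if i then vertex h else v))"
    by (simp add: UNIV_bool add.commute)
  have sw2v: "sw2 s H v f' = f' v (vertex h) + f' (vertex g) v" if "bilin s f'" for f'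
    using sw2_sum_tens[OF that comul] by (simp add: UNIV_bool add.commute)
  have "bilin s (\<lambda>a1 b. sw2 s H b (f a1))"
    by (intro bilinI linear_sw2 linear_sw2_arg l1 s comul_linear free.vector_space_axioms)
  from sw2v[OF this] show ?thesis
    by (simp add: sw3_def sw2_vertex[OF s gh(2)] sw2v[OF bil])
qed

end

section \<open>Bicomodules and their homogeneous components\<close>

lemma lin_on_linear: "lin s t f \<Longrightarrow> lin_on s t V f"
  by (simp add: lin_on_def Vector_Spaces.linear_iff)

lemma lin_on_zero:
  assumes "lin_on s t V f" "0 \<in> V" "vector_space s" "vector_space t"
  shows "f 0 = 0"
proof -
  interpret s: vector_space s by fact
  interpret t: vector_space t by fact
  have "f (s 0 0) = t 0 (f 0)" using assms(1,2) unfolding lin_on_def by blast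
  thus ?thesis by simp
qed

text \<open>The map that is given by \<open>t g h\<close> on the component of bidegree \<open>(g, h)\<close>.  The actions of a twisted
  bimodule are of this form, and so is the isomorphism built from an isomorphism of collections.\<close>

definition glue :: "('k, 'g, 'm::ab_group_add) bimod \<Rightarrow> ('g \<Rightarrow> 'g \<Rightarrow> 'm \<Rightarrow> 'n::ab_group_add) \<Rightarrow> 'm \<Rightarrow> 'n" where
  "glue M t m = (\<Sum>g\<in>keys (lco M m). \<Sum>h\<in>keys (rco M m). t g h (homog_comp M m g h))"

context bicomodule
begin

interpretation m: vector_space "scl M" by (rule vector_space)

lemma homog_iff: "m \<in> homog M g h \<longleftrightarrow> coeff (lco M m) g = m \<and> coeff (rco M m) h = m"
proof
  assume *: "coeff (lco M m) g = m \<and> coeff (rco M m) h = m"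
  have "lco M m = Poly_Mapping.single g m" using lco_coassoc[of m g] * by simp
  moreover have "rco M m = Poly_Mapping.single h m" using rco_coassoc[of m h] * by simp
  ultimately show "m \<in> homog M g h" by (simp add: homog_def)
qed (simp add: homog_def)

lemma homog_zero [simp]: "0 \<in> homog M g h"
  by (simp add: homog_iff lin_zero[OF lco_linear] lin_zero[OF rco_linear])

lemma homog_subspace: "m.subspace (homog M g h)"
  by (rule m.subspaceI)
    (auto simp: homog_iff lin_zero[OF lco_linear] lin_zero[OF rco_linear] lin_add[OF lco_linear]
      lin_add[OF rco_linear] lin_scale[OF lco_linear] lin_scale[OF rco_linear])

lemmas homog_scale = m.subspace_scale[OF homog_subspace]
  and homog_add = m.subspace_add[OF homog_subspace]

lemma lco_homog: "m \<in> homog M g h \<Longrightarrow> coeff (lco M m) g' = (if g' = g then m else 0)"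
  and rco_homog: "m \<in> homog M g h \<Longrightarrow> coeff (rco M m) h' = (if h' = h then m else 0)"
  by (auto simp: homog_def lookup_bas)

lemma homog_comp_in [simp]: "homog_comp M m g h \<in> homog M g h"
proof -
  have "coeff (lco M (homog_comp M m g h)) g = homog_comp M m g h"
    by (simp add: homog_comp_def lco_rco lco_coassoc)
  moreover have "coeff (rco M (homog_comp M m g h)) h = homog_comp M m g h"
    by (simp add: homog_comp_def rco_coassoc)
  ultimately show ?thesis by (simp add: homog_iff)
qed

lemma homog_comp_homog: "m \<in> homog M g h \<Longrightarrow> homog_comp M m g' h' = (if g' = g \<and> h' = h then m else 0)"
  by (auto simp: homog_comp_def lco_homog rco_homog lin_zero[OF rco_linear])

lemma linear_homog_comp: "lin (scl M) (scl M) (\<lambda>m. homog_comp M m g h)"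
  unfolding homog_comp_def by (rule linear_comp[OF rco_linear lco_linear])

lemma homog_comp_support:
  assumes "homog_comp M m g h \<noteq> 0"
  shows "g \<in> keys (lco M m)" "h \<in> keys (rco M m)"
proof -
  show "g \<in> keys (lco M m)"
  proof (rule ccontr)
    assume "g \<notin> keys (lco M m)"
    then have "coeff (lco M m) g = 0" by (simp add: in_keys_iff)
    then show False using assms by (simp add: homog_comp_def lin_zero[OF rco_linear])
  qed
  show "h \<in> keys (rco M m)"
  proof (rule ccontr)
    assume "h \<notin> keys (rco M m)"
    then have "coeff (rco M m) h = 0" by (simp add: in_keys_iff)
    then show False using assms by (simp add: homog_comp_def lco_rco lin_zero[OF lco_linear])
  qed
qed

lemma homog_decomp:
  "m = (\<Sum>g\<in>keys (lco M m). \<Sum>h\<in>keys (rco M m). homog_comp M m g h)"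
proof -
  have "coeff (lco M m) g = (\<Sum>h\<in>keys (rco M m). homog_comp M m g h)" for g
  proof -
    have "coeff (lco M m) g = (\<Sum>h\<in>keys (rco M (coeff (lco M m) g)). homog_comp M m g h)"
      unfolding homog_comp_def by (rule rco_counit[symmetric])
    also have "\<dots> = (\<Sum>h\<in>keys (rco M m). homog_comp M m g h)"
    proof (rule sum.mono_neutral_left)
      show "keys (rco M (coeff (lco M m) g)) \<subseteq> keys (rco M m)"
        using homog_comp_support(2)[of m g] by (auto simp: in_keys_iff homog_comp_def)
    qed (auto simp: in_keys_iff homog_comp_def)
    finally show ?thesis .
  qed
  then have "(\<Sum>g\<in>keys (lco M m). \<Sum>h\<in>keys (rco M m). homog_comp M m g h) =
      (\<Sum>g\<in>keys (lco M m). coeff (lco M m) g)"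
    by (rule sum.cong[OF refl sym])
  also have "\<dots> = m" by (rule lco_counit)
  finally show ?thesis by (rule sym)
qed

lemma linear_eq_on_homog:
  assumes "lin (scl M) t f" "lin (scl M) t f'"
    "\<And>g h m. g \<in> carrier G \<Longrightarrow> h \<in> carrier G \<Longrightarrow> m \<in> homog M g h \<Longrightarrow> f m = f' m"
  shows "f m = f' m"
proof -
  have decomp: "u m = (\<Sum>g\<in>keys (lco M m). \<Sum>h\<in>keys (rco M m). u (homog_comp M m g h))"
    if "lin (scl M) t u" for u
    using arg_cong[OF homog_decomp[of m], of u] unfolding lin_sum[OF that] .
  have "f m = (\<Sum>g\<in>keys (lco M m). \<Sum>h\<in>keys (rco M m). f (homog_comp M m g h))"
    by (rule decomp[OF assms(1)])
  also have "\<dots> = (\<Sum>g\<in>keys (lco M m). \<Sum>h\<in>keys (rco M m). f' (homog_comp M m g h))"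
  proof (intro sum.cong refl)
    fix g h assume "g \<in> keys (lco M m)" "h \<in> keys (rco M m)"
    then show "f (homog_comp M m g h) = f' (homog_comp M m g h)"
      using lco_carrier[of m] rco_carrier[of m] by (intro assms(3)[of g h]) auto
  qed
  also have "\<dots> = f' m"
    by (rule decomp[OF assms(2), symmetric])
  finally show ?thesis .
qed

lemma glue_superset:
  assumes t: "\<And>g h. t g h 0 = 0"
    and A: "finite A" "keys (lco M m) \<subseteq> A"
    and B: "finite B" "keys (rco M m) \<subseteq> B"
  shows "glue M t m = (\<Sum>g\<in>A. \<Sum>h\<in>B. t g h (homog_comp M m g h))"
proof -
  have "glue M t m = (\<Sum>g\<in>keys (lco M m). \<Sum>h\<in>B. t g h (homog_comp M m g h))"
    unfolding glue_def
  proof (rule sum.cong[OF refl], rule sum.mono_neutral_left[OF B], rule ballI)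
    fix g h assume "h \<in> B - keys (rco M m)"
    then have "homog_comp M m g h = 0" using homog_comp_support(2) by blast
    thus "t g h (homog_comp M m g h) = 0" by (simp add: t)
  qed
  also have "\<dots> = (\<Sum>g\<in>A. \<Sum>h\<in>B. t g h (homog_comp M m g h))"
  proof (rule sum.mono_neutral_left[OF A], intro ballI sum.neutral)
    fix g h assume "g \<in> A - keys (lco M m)"
    then have "homog_comp M m g h = 0" using homog_comp_support(1) by blast
    thus "t g h (homog_comp M m g h) = 0" by (simp add: t)
  qed
  finally show ?thesis .
qed

lemma
  assumes t: "\<And>g h. lin_on (scl M) s (homog M g h) (t g h)" and s: "vector_space s"
  shows linear_glue: "lin (scl M) s (glue M t)"
    and glue_homog: "m \<in> homog M g h \<Longrightarrow> glue M t m = t g h m"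
proof -
  interpret s: vector_space s by fact
  have t0: "t g h 0 = 0" for g h
    using lin_on_zero[OF t homog_zero vector_space s] .
  have tadd: "t g h (x + y) = t g h x + t g h y" if "x \<in> homog M g h" "y \<in> homog M g h" for g h x y
    using t that by (auto simp: lin_on_def)
  have tscl: "t g h (scl M c x) = s c (t g h x)" if "x \<in> homog M g h" for g h c x
    using t that by (auto simp: lin_on_def)
  show "lin (scl M) s (glue M t)"
  proof (rule linearI'[OF vector_space s])
    fix x y
    let ?A = "keys (lco M x) \<union> keys (lco M y)"
    let ?B = "keys (rco M x) \<union> keys (rco M y)"
    have k: "keys (lco M (x + y)) \<subseteq> ?A" "keys (rco M (x + y)) \<subseteq> ?B"
      by (auto simp: in_keys_iff lin_add[OF lco_linear] lin_add[OF rco_linear])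
    have "glue M t z = (\<Sum>g\<in>?A. \<Sum>h\<in>?B. t g h (homog_comp M z g h))" if "z \<in> {x, y, x + y}" for z
      using k that by (intro glue_superset t0) auto
    thus "glue M t (x + y) = glue M t x + glue M t y"
      by (simp add: lin_add[OF linear_homog_comp] tadd sum.distrib)
  next
    fix c x
    let ?A = "keys (lco M x)"
    let ?B = "keys (rco M x)"
    have k: "keys (lco M (scl M c x)) \<subseteq> ?A" "keys (rco M (scl M c x)) \<subseteq> ?B"
      by (auto simp: in_keys_iff lin_scale[OF lco_linear] lin_scale[OF rco_linear])
    have "glue M t z = (\<Sum>g\<in>?A. \<Sum>h\<in>?B. t g h (homog_comp M z g h))" if "z \<in> {x, scl M c x}" for z
      using k that by (intro glue_superset t0) auto
    thus "glue M t (scl M c x) = s c (glue M t x)"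
      by (simp add: lin_scale[OF linear_homog_comp] tscl s.scale_sum_right)
  qed
  show "glue M t m = t g h m" if m: "m \<in> homog M g h"
  proof -
    have k: "keys (lco M m) \<subseteq> {g}" "keys (rco M m) \<subseteq> {h}"
      using m by (auto simp: homog_def split: if_splits)
    have "glue M t m = (\<Sum>g\<in>{g}. \<Sum>h\<in>{h}. t g h (homog_comp M m g h))"
      using k by (intro glue_superset t0) auto
    thus ?thesis by (simp add: homog_comp_homog[OF m])
  qed
qed

end

text \<open>The conditions on an isomorphism of bimodules are equations between linear maps, so they need only
  hold on homogeneous elements.\<close>

lemma bimod_isoI:
  assumes M: "bicomodule G M" and N: "bicomodule G N"
    and \<phi>: "lin (scl M) (scl N) \<phi>"
    and bij: "\<And>g h. g \<in> carrier G \<Longrightarrow> h \<in> carrier G \<Longrightarrow> bij_betw \<phi> (homog M g h) (homog N g h)"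
    and lact: "\<And>f. f \<in> carrier G \<Longrightarrow> lin (scl M) (scl M) (lact M f)"
      "\<And>f. f \<in> carrier G \<Longrightarrow> lin (scl N) (scl N) (lact N f)"
      "\<And>f g h m. f \<in> carrier G \<Longrightarrow> g \<in> carrier G \<Longrightarrow> h \<in> carrier G \<Longrightarrow> m \<in> homog M g h \<Longrightarrow>
        \<phi> (lact M f m) = lact N f (\<phi> m)"
    and ract: "\<And>f. f \<in> carrier G \<Longrightarrow> lin (scl M) (scl M) (\<lambda>m. ract M m f)"
      "\<And>f. f \<in> carrier G \<Longrightarrow> lin (scl N) (scl N) (\<lambda>m. ract N m f)"
      "\<And>f g h m. f \<in> carrier G \<Longrightarrow> g \<in> carrier G \<Longrightarrow> h \<in> carrier G \<Longrightarrow> m \<in> homog M g h \<Longrightarrow>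
        \<phi> (ract M m f) = ract N (\<phi> m) f"
  shows "bimod_iso G \<phi> M N"
proof -
  interpret M: bicomodule G M by fact
  interpret N: bicomodule G N by fact
  have homog: "\<phi> m \<in> homog N g h" if "g \<in> carrier G" "h \<in> carrier G" "m \<in> homog M g h" for g h m
    using bij that bij_betwE by blast
  have lco: "coeff (lco N (\<phi> m)) g = \<phi> (coeff (lco M m) g)" for m g
    by (rule M.linear_eq_on_homog[where f = "\<lambda>m. coeff (lco N (\<phi> m)) g",
          OF linear_comp[OF N.lco_linear \<phi>] linear_comp[OF \<phi> M.lco_linear]])
      (simp add: M.lco_homog N.lco_homog[OF homog] lin_zero[OF \<phi>])
  have rco: "coeff (rco N (\<phi> m)) g = \<phi> (coeff (rco M m) g)" for m g
    by (rule M.linear_eq_on_homog[where f = "\<lambda>m. coeff (rco N (\<phi> m)) g",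
          OF linear_comp[OF N.rco_linear \<phi>] linear_comp[OF \<phi> M.rco_linear]])
      (simp add: M.rco_homog N.rco_homog[OF homog] lin_zero[OF \<phi>])
  have comp: "homog_comp N (\<phi> m) g h = \<phi> (homog_comp M m g h)" for m g h
    by (simp add: homog_comp_def lco rco)
  have "inj \<phi>"
  proof (rule injI)
    fix x y assume "\<phi> x = \<phi> y"
    then have 0: "\<phi> (homog_comp M (x - y) g h) = 0" for g h
      using comp[of "x - y" g h] by (simp add: lin_diff[OF \<phi>] lin_zero[OF N.linear_homog_comp])
    have "homog_comp M (x - y) g h = 0" if "g \<in> carrier G" "h \<in> carrier G" for g h
      using inj_onD[OF bij_betw_imp_inj_on[OF bij[OF that]] _ M.homog_comp_in M.homog_zero, of "x - y"]
        0[of g h] lin_zero[OF \<phi>] by simp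
    then have "(\<Sum>g\<in>keys (lco M (x - y)). \<Sum>h\<in>keys (rco M (x - y)).
        homog_comp M (x - y) g h) = 0"
      using M.lco_carrier[of "x - y"] M.rco_carrier[of "x - y"] by (intro sum.neutral ballI) auto
    with M.homog_decomp[of "x - y"] have "x - y = 0" by (rule trans)
    then show "x = y" by simp
  qed
  moreover have "n \<in> range \<phi>" for n
  proof -
    define m where "m = (\<Sum>g\<in>keys (lco N n). \<Sum>h\<in>keys (rco N n).
        inv_into (homog M g h) \<phi> (homog_comp N n g h))"
    have "\<phi> m = (\<Sum>g\<in>keys (lco N n). \<Sum>h\<in>keys (rco N n). homog_comp N n g h)"
      unfolding m_def lin_sum[OF \<phi>]
    proof (intro sum.cong refl)
      fix g h assume "g \<in> keys (lco N n)" "h \<in> keys (rco N n)"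
      then have "g \<in> carrier G" "h \<in> carrier G" using N.lco_carrier N.rco_carrier by blast+
      from bij[OF this] show "\<phi> (inv_into (homog M g h) \<phi> (homog_comp N n g h)) = homog_comp N n g h"
        by (intro f_inv_into_f) (simp add: bij_betw_imp_surj_on)
    qed
    also have "\<dots> = n" by (rule N.homog_decomp[symmetric])
    finally show ?thesis by (rule range_eqI[OF sym])
  qed
  ultimately have "bij \<phi>" by (auto simp: bij_def)
  moreover have "\<phi> (lact M f m) = lact N f (\<phi> m)" if "f \<in> carrier G" for f m
    by (rule M.linear_eq_on_homog[where f = "\<lambda>m. \<phi> (lact M f m)",
          OF linear_comp[OF \<phi> lact(1)[OF that]] linear_comp[OF lact(2)[OF that] \<phi>]])
      (blast intro: lact(3)[OF that])
  moreover have "\<phi> (ract M m f) = ract N (\<phi> m) f" if "f \<in> carrier G" for f m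
    by (rule M.linear_eq_on_homog[where f = "\<lambda>m. \<phi> (ract M m f)",
          OF linear_comp[OF \<phi> ract(1)[OF that]] linear_comp[OF ract(2)[OF that] \<phi>]])
      (blast intro: ract(3)[OF that])
  ultimately show ?thesis using \<phi> lco rco by (simp add: bimod_iso_def)
qed

subsection \<open>Gauge twists of bimodules\<close>

lemma bimod_twist_sel [simp]:
  "scl (bimod_twist F M) = scl M" "lco (bimod_twist F M) = lco M" "rco (bimod_twist F M) = rco M"
  "homog (bimod_twist F M) = homog M"
  by (auto simp: bimod_twist_def homog_def fun_eq_iff)

lemma lact_twist_glue: "lact (bimod_twist F M) f = glue M (\<lambda>g h m. scl M (F f h / F f g) (lact M f m))"
  and ract_twist_glue: "(\<lambda>m. ract (bimod_twist F M) m f) = glue M (\<lambda>g h m. scl M (F h f / F g f) (ract M m f))"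
  by (auto simp: bimod_twist_def glue_def fun_eq_iff)

lemma bicomodule_twist:
  assumes "bicomodule G M" shows "bicomodule G (bimod_twist F M)"
proof -
  interpret bicomodule G M by fact
  show ?thesis
  proof (rule bicomodule.intro)
    show "group G" by unfold_locales
    show "bicomodule_axioms G (bimod_twist F M)"
      by (rule bicomodule_axioms.intro; unfold bimod_twist_sel)
        (rule vector_space lco_linear rco_linear lco_carrier rco_carrier lco_coassoc rco_coassoc
          lco_counit rco_counit lco_rco)+
  qed
qed

context majid_bimodule
begin

interpretation m: vector_space "scl M" by (rule vector_space)

lemma
  assumes f: "f \<in> carrier G"
  shows linear_lact_twist: "lin (scl M) (scl M) (lact (bimod_twist F M) f)"
    and linear_ract_twist: "lin (scl M) (scl M) (\<lambda>m. ract (bimod_twist F M) m f)"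
    and lact_twist: "m \<in> homog M g h \<Longrightarrow> lact (bimod_twist F M) f m = scl M (F f h / F f g) (lact M f m)"
    and ract_twist: "m \<in> homog M g h \<Longrightarrow> ract (bimod_twist F M) m f = scl M (F h f / F g f) (ract M m f)"
proof -
  have l: "lin_on (scl M) (scl M) (homog M g h) (\<lambda>m. scl M (F f h / F f g) (lact M f m))" for g h
    using lact_linear[OF f] by (auto simp: lin_on_def Vector_Spaces.linear_iff m.scale_right_distrib mult.commute)
  show "lin (scl M) (scl M) (lact (bimod_twist F M) f)"
    unfolding lact_twist_glue by (rule linear_glue[OF l vector_space])
  show "lact (bimod_twist F M) f m = scl M (F f h / F f g) (lact M f m)" if "m \<in> homog M g h"
    unfolding lact_twist_glue by (rule glue_homog[OF l vector_space that])
  have r: "lin_on (scl M) (scl M) (homog M g h) (\<lambda>m. scl M (F h f / F g f) (ract M m f))" for g h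
    using ract_linear[OF f] by (auto simp: lin_on_def Vector_Spaces.linear_iff m.scale_right_distrib mult.commute)
  show "lin (scl M) (scl M) (\<lambda>m. ract (bimod_twist F M) m f)"
    unfolding ract_twist_glue by (rule linear_glue[OF r vector_space])
  show "ract (bimod_twist F M) m f = scl M (F h f / F g f) (ract M m f)" if "m \<in> homog M g h"
    using glue_homog[OF r vector_space that] by (simp flip: ract_twist_glue)
qed

lemma cocycle3_twist:
  assumes F: "gauge G F"
  shows "cocycle3 G (cocycle_twist G F \<Phi>)"
proof
  have nz: "F g h \<noteq> 0" if "g \<in> carrier G" "h \<in> carrier G" for g h using F that by (auto simp: gauge_def)
  show "cocycle_twist G F \<Phi> e f g \<noteq> 0" if "e \<in> carrier G" "f \<in> carrier G" "g \<in> carrier G" for e f g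
    using that by (simp add: cocycle_twist_def nz nonzero)
  show "cocycle_twist G F \<Phi> \<one> e f = 1 \<and> cocycle_twist G F \<Phi> e \<one> f = 1 \<and> cocycle_twist G F \<Phi> e f \<one> = 1"
    if "e \<in> carrier G" "f \<in> carrier G" for e f
    using that F by (simp add: cocycle_twist_def nz normalized gauge_def)
  show "cocycle_twist G F \<Phi> e f g * cocycle_twist G F \<Phi> e (f \<otimes> g) h * cocycle_twist G F \<Phi> f g h =
      cocycle_twist G F \<Phi> (e \<otimes> f) g h * cocycle_twist G F \<Phi> e f (g \<otimes> h)"
    if "e \<in> carrier G" "f \<in> carrier G" "g \<in> carrier G" "h \<in> carrier G" for e f g h
  proof -
    (* The coboundary of F satisfies the cocycle identity by itself. *)
    have "(F e f * F (e \<otimes> f) g / (F e (f \<otimes> g) * F f g)) *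
        (F e (f \<otimes> g) * F (e \<otimes> (f \<otimes> g)) h / (F e (f \<otimes> g \<otimes> h) * F (f \<otimes> g) h)) *
        (F f g * F (f \<otimes> g) h / (F f (g \<otimes> h) * F g h)) =
      (F (e \<otimes> f) g * F (e \<otimes> f \<otimes> g) h / (F (e \<otimes> f) (g \<otimes> h) * F g h)) *
      (F e f * F (e \<otimes> f) (g \<otimes> h) / (F e (f \<otimes> (g \<otimes> h)) * F f (g \<otimes> h)))" (is "?l = ?r")
      using that by (simp add: m_assoc nz mult_ac)
    have "cocycle_twist G F \<Phi> e f g * cocycle_twist G F \<Phi> e (f \<otimes> g) h * cocycle_twist G F \<Phi> f g h =
        ?l * (\<Phi> e f g * \<Phi> e (f \<otimes> g) h * \<Phi> f g h)"
      by (simp add: cocycle_twist_def)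
    also have "\<dots> = ?r * (\<Phi> (e \<otimes> f) g h * \<Phi> e f (g \<otimes> h))"
      using \<open>?l = ?r\<close> cocycle that by simp
    also have "\<dots> = cocycle_twist G F \<Phi> (e \<otimes> f) g h * cocycle_twist G F \<Phi> e f (g \<otimes> h)"
      by (simp add: cocycle_twist_def)
    finally show ?thesis .
  qed
qed

lemma majid_bimodule_twist:
  assumes F: "gauge G F"
  shows "majid_bimodule G (cocycle_twist G F \<Phi>) (bimod_twist F M)"
proof -
  interpret T: cocycle3 G "cocycle_twist G F \<Phi>" by (rule cocycle3_twist[OF F])
  interpret B: bicomodule G "bimod_twist F M" by (rule bicomodule_twist) unfold_locales
  have nz: "F g h \<noteq> 0" if "g \<in> carrier G" "h \<in> carrier G" for g h using F that by (auto simp: gauge_def)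
  have F1: "F g \<one> = 1" "F \<one> g = 1" if "g \<in> carrier G" for g using F that by (auto simp: gauge_def)
  note tw = lact_twist ract_twist
  show ?thesis
  proof (rule majid_bimodule.intro[OF T.cocycle3_axioms B.bicomodule_axioms],
      rule majid_bimodule_axioms.intro, unfold bimod_twist_sel, goal_cases)
    case (1 f) then show ?case by (rule linear_lact_twist)
  next
    case (2 f) then show ?case by (rule linear_ract_twist)
  next
    case (3 f g h m) then show ?case by (simp add: lact_twist lact_homog homog_scale)
  next
    case (4 f g h m) then show ?case by (simp add: ract_twist ract_homog homog_scale)
  next
    case (5 m)
    show ?case
      by (rule linear_eq_on_homog[OF linear_lact_twist lin_id[OF vector_space]])
        (simp_all add: lact_twist F1 lact_one)
  next
    case (6 m)
    show ?case
      by (rule linear_eq_on_homog[OF linear_ract_twist lin_id[OF vector_space]])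
        (simp_all add: ract_twist F1 ract_one)
  next
    case (7 e f g h m)
    then have "lact (bimod_twist F M) e (lact (bimod_twist F M) f m) =
      scl M (F f h / F f g * (F e (f \<otimes> h) / F e (f \<otimes> g) * (\<Phi> e f g / \<Phi> e f h))) (lact M (e \<otimes> f) m)"
      using lact_homog[of f g h m]
      by (simp add: lact_twist[of f m g h] lin_scale[OF linear_lact_twist] lact_twist[of e _ "f \<otimes> g" "f \<otimes> h"] lact_lact[of e f g h])
    also have "\<dots> = scl M (cocycle_twist G F \<Phi> e f g / cocycle_twist G F \<Phi> e f h * (F (e \<otimes> f) h / F (e \<otimes> f) g)) (lact M (e \<otimes> f) m)"
      using 7 by (simp add: cocycle_twist_def nz nonzero field_simps)
    also have "\<dots> = scl M (cocycle_twist G F \<Phi> e f g / cocycle_twist G F \<Phi> e f h) (lact (bimod_twist F M) (e \<otimes> f) m)"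
      using 7 by (simp add: lact_twist[of _ m g h])
    finally show ?case .
  next
    case (8 e f g h m)
    then have "ract (bimod_twist F M) (ract (bimod_twist F M) m e) f =
      scl M (F h e / F g e * (F (h \<otimes> e) f / F (g \<otimes> e) f * (\<Phi> h e f / \<Phi> g e f))) (ract M m (e \<otimes> f))"
      using ract_homog[of e g h m]
      by (simp add: ract_twist[of e m g h] lin_scale[OF linear_ract_twist] ract_twist[of f _ "g \<otimes> e" "h \<otimes> e"] ract_ract[of e f g h])
    also have "\<dots> = scl M (cocycle_twist G F \<Phi> h e f / cocycle_twist G F \<Phi> g e f * (F h (e \<otimes> f) / F g (e \<otimes> f))) (ract M m (e \<otimes> f))"
      using 8 by (simp add: cocycle_twist_def nz nonzero field_simps)
    also have "\<dots> = scl M (cocycle_twist G F \<Phi> h e f / cocycle_twist G F \<Phi> g e f) (ract (bimod_twist F M) m (e \<otimes> f))"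
      using 8 by (simp add: ract_twist[of _ m g h])
    finally show ?case .
  next
    case (9 e f g h m)
    then have "ract (bimod_twist F M) (lact (bimod_twist F M) e m) f =
      scl M (F e h / F e g * (F (e \<otimes> h) f / F (e \<otimes> g) f * (\<Phi> e h f / \<Phi> e g f))) (lact M e (ract M m f))"
      using lact_homog[of e g h m]
      by (simp add: lact_twist[of e m g h] lin_scale[OF linear_ract_twist] ract_twist[of f _ "e \<otimes> g" "e \<otimes> h"] lact_ract[of e f g h])
    also have "\<dots> = scl M (cocycle_twist G F \<Phi> e h f / cocycle_twist G F \<Phi> e g f * (F h f / F g f * (F e (h \<otimes> f) / F e (g \<otimes> f)))) (lact M e (ract M m f))"
      using 9 by (simp add: cocycle_twist_def nz nonzero field_simps)
    also have "\<dots> = scl M (cocycle_twist G F \<Phi> e h f / cocycle_twist G F \<Phi> e g f) (lact (bimod_twist F M) e (ract (bimod_twist F M) m f))"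
      using 9 ract_homog[of f g h m]
      by (simp add: ract_twist[of f m g h] lin_scale[OF linear_lact_twist] lact_twist[of e _ "g \<otimes> f" "h \<otimes> f"])
    finally show ?case .
  qed
qed

lemma majid_bimodule_cong:
  assumes "cocycle_eq G \<Phi>' \<Phi>"
  shows "majid_bimodule G \<Phi>' M"
proof -
  have eq: "\<Phi>' e f g = \<Phi> e f g" if "e \<in> carrier G" "f \<in> carrier G" "g \<in> carrier G" for e f g
    using assms that by (auto simp: cocycle_eq_def)
  show ?thesis
  proof (intro majid_bimodule.intro majid_bimodule_axioms.intro)
    show "cocycle3 G \<Phi>'"
      by unfold_locales (simp_all add: eq nonzero cocycle normalized)
    show "bicomodule G M" by unfold_locales
  qed (simp_all add: eq lact_linear ract_linear lact_homog ract_homog lact_one ract_one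
         lact_lact ract_ract lact_ract)
qed

end

section \<open>From gauge equivalences of Majid algebras to gauge equivalences of bimodules\<close>

definition deg_part :: "nat \<Rightarrow> ('g path \<Rightarrow>\<^sub>0 'k::field) \<Rightarrow> ('g path \<Rightarrow>\<^sub>0 'k)" where
  "deg_part n = restr (\<lambda>x. length (snd x) = n)"

lemma linear_deg_part [lin_intros]: "lin fscale fscale (deg_part n)"
  by (simp add: deg_part_def linear_restr)

lemma lookup_deg_part [simp]: "coeff (deg_part n a) x = (if length (snd x) = n then coeff a x else 0)"
  by (simp add: deg_part_def)

lemma deg_part_degree:
  assumes "a \<in> path_degree Q m" shows "deg_part n a = (if n = m then a else 0)"
proof (rule poly_mapping_eqI)
  fix x
  have "coeff a x \<noteq> 0 \<Longrightarrow> length (snd x) = m" using assms unfolding path_degree_iff by blast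
  thus "coeff (deg_part n a) x = coeff (if n = m then a else 0) x" by auto
qed

lemma deg_part_0_1:
  assumes "\<And>u p. coeff v (u, p) \<noteq> 0 \<Longrightarrow> length p \<le> 1"
  shows "v = deg_part 1 v + deg_part 0 v"
proof (rule poly_mapping_eqI)
  fix x
  have "coeff v x \<noteq> 0 \<Longrightarrow> length (snd x) \<le> 1"
    using assms[of "fst x" "snd x"] by simp
  then have "coeff v x \<noteq> 0 \<Longrightarrow> length (snd x) = 0 \<or> length (snd x) = 1" by linarith
  thus "coeff v x = coeff (deg_part 1 v + deg_part 0 v) x" by (auto simp: lookup_add)
qed

lemma majid_twist_sel [simp]:
  "car (majid_twist H F Fi) = car H" "comul (majid_twist H F Fi) = comul H"
  "counit (majid_twist H F Fi) = counit H" "unt (majid_twist H F Fi) = unt H"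
  by (simp_all add: majid_twist_def)

context path_majid
begin

lemma deg_part_car:
  assumes "a \<in> car H" shows "deg_part n a \<in> path_degree Q n"
  unfolding path_degree_iff
proof (intro allI impI)
  fix x assume "coeff (deg_part n a) x \<noteq> 0"
  then have "coeff a x \<noteq> 0 \<and> length (snd x) = n" by (simp split: if_splits)
  then show "x \<in> paths Q \<and> length (snd x) = n"
    using assms unfolding in_car_iff by blast
qed

definition ends :: "'a \<Rightarrow> 'a \<Rightarrow> 'a path \<Rightarrow> bool" where
  "ends h g x \<longleftrightarrow> fst x = h \<and> target G (fst x) (snd x) = g"

lemma restr_ends_arrows_between:
  assumes "v \<in> arrows_between h g"
  shows "restr (ends h' g') v = (if h' = h \<and> g' = g then v else 0)"
proof (rule poly_mapping_eqI)
  fix x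
  have "ends h g x" if "coeff v x \<noteq> 0"
  proof -
    have "\<exists>a. x = (h, [a]) \<and> head Q a = g" using assms that unfolding arrows_between_def by blast
    thus ?thesis by (auto simp: ends_def)
  qed
  thus "coeff (restr (ends h' g') v) x = coeff (if h' = h \<and> g' = g then v else 0) x"
    by (auto simp: ends_def)
qed

lemma counit_bas: "(u, p) \<in> paths Q \<Longrightarrow> counit H (bas (u, p)) = (if p = [] then 1 else 0)"
  by (simp add: counit_path[OF bas_car] path_counit_def)

lemma counit_vertex: "g \<in> carrier G \<Longrightarrow> counit H (vertex g) = 1"
  using counit_bas[of g "[]"] by (simp add: vertex_def)

lemma degree0_vertices:
  assumes "v \<in> path_degree Q 0"
  shows "v = (\<Sum>x\<in>keys v. fscale (coeff v x) (vertex (fst x)))"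
    and "x \<in> keys v \<Longrightarrow> fst x \<in> carrier G"
proof -
  have x: "x = (fst x, []) \<and> fst x \<in> carrier G" if "x \<in> keys v" for x
    using assms that path_start[of "fst x" "[]" R] by (auto simp: path_degree_def)
  have "v = (\<Sum>x\<in>keys v. fscale (coeff v x) (bas x))" by (rule expand_bas)
  also have "\<dots> = (\<Sum>x\<in>keys v. fscale (coeff v x) (vertex (fst x)))"
    unfolding vertex_def by (rule sum.cong[OF refl]) (metis x)
  finally show "v = \<dots>" .
  show "x \<in> keys v \<Longrightarrow> fst x \<in> carrier G" using x by blast
qed

end

text \<open>The algebra \<open>H(M)\<close> together with an identification of \<open>M\<close> with the span of the arrows.\<close>

locale HM_algebra = path_majid G R \<Phi> H + majid_bimodule G \<Phi> M
  for G (structure) and R :: "'a set \<Rightarrow> nat" and \<Phi> :: "'a \<Rightarrow> 'a \<Rightarrow> 'a \<Rightarrow> 'k::field"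
    and H :: "('a path, 'k) majid" and M :: "('k, 'a, 'm::ab_group_add) bimod" +
  fixes \<theta> :: "'m \<Rightarrow> ('a path \<Rightarrow>\<^sub>0 'k)"
  assumes ident: "arrow_identification G (hopf_quiver G R) M \<theta>"
    and prd_lact: "f \<in> carrier G \<Longrightarrow> prd H (vertex f) (\<theta> m) = \<theta> (lact M f m)"
    and prd_ract: "f \<in> carrier G \<Longrightarrow> prd H (\<theta> m) (vertex f) = \<theta> (ract M m f)"
begin

lemma \<theta>_linear: "lin (scl M) fscale \<theta>"
  and \<theta>_bij: "bij_betw \<theta> UNIV (path_degree Q 1)"
  using ident by (auto simp: arrow_identification_def)

lemma \<theta>_degree: "\<theta> m \<in> path_degree Q 1"
  using \<theta>_bij by (auto simp: bij_betw_def)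

lemma \<theta>_inj: "\<theta> m = \<theta> m' \<longleftrightarrow> m = m'"
  using \<theta>_bij by (auto simp: bij_betw_def inj_eq)

lemma \<theta>_between:
  assumes "g \<in> carrier G" "h \<in> carrier G" "m \<in> homog M g h"
  shows "\<theta> m \<in> arrows_between h g"
proof -
  have "keys (\<theta> m) \<subseteq> {(h, [a]) |a. a \<in> arcs Q \<and> tail Q a = h \<and> head Q a = g}"
    using ident assms by (auto simp: arrow_identification_def)
  then have "x \<in> paths Q \<and> (\<exists>a. x = (h, [a]) \<and> head Q a = g)" if "coeff (\<theta> m) x \<noteq> 0" for x
  proof -
    have "x \<in> keys (\<theta> m)" using that by (simp add: in_keys_iff)
    then obtain a where "x = (h, [a])" "a \<in> arcs Q" "tail Q a = h" "head Q a = g"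
      using \<open>keys (\<theta> m) \<subseteq> _\<close> by blast
    thus ?thesis using arc_carrier[of a R] by auto
  qed
  thus ?thesis unfolding arrows_between_def by blast
qed

lemma \<theta>_homog_comp:
  assumes "g \<in> carrier G" "h \<in> carrier G"
  shows "\<theta> (homog_comp M m g h) = restr (ends h g) (\<theta> m)"
  by (rule linear_eq_on_homog[OF linear_comp[OF \<theta>_linear linear_homog_comp] linear_comp[OF linear_restr \<theta>_linear]])
    (auto simp: homog_comp_homog lin_zero[OF \<theta>_linear] restr_ends_arrows_between[OF \<theta>_between])

lemma \<theta>_homog_iff:
  assumes "g \<in> carrier G" "h \<in> carrier G"
  shows "m \<in> homog M g h \<longleftrightarrow> \<theta> m \<in> arrows_between h g"
proof
  assume "\<theta> m \<in> arrows_between h g"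
  then have "\<theta> (homog_comp M m g h) = \<theta> m"
    by (simp add: \<theta>_homog_comp[OF assms] restr_ends_arrows_between)
  thus "m \<in> homog M g h" using homog_comp_in[of m g h] by (simp add: \<theta>_inj)
qed (rule \<theta>_between[OF assms])

end

lemma
  shows sw2_car_update [simp]: "sw2 s (H\<lparr>car := W\<rparr>) a f2 = sw2 s H a f2"
    and sw3_car_update [simp]: "sw3 s (H\<lparr>car := W\<rparr>) a f3 = sw3 s H a f3"
    and sw4_car_update [simp]: "sw4 s (H\<lparr>car := W\<rparr>) a f4 = sw4 s H a f4"
    and sw5_car_update [simp]: "sw5 s (H\<lparr>car := W\<rparr>) a f5 = sw5 s H a f5"
  by (simp_all add: sw2_def sw3_def sw4_def sw5_def)

lemma sw2_majid_twist [simp]: "sw2 s (majid_twist H F Fi) a f2 = sw2 s H a f2"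
  by (simp add: sw2_def)

lemma majid_twist_car_update [simp]:
  "prd (majid_twist (H\<lparr>car := W\<rparr>) F Fi) = prd (majid_twist H F Fi)"
  "reass (majid_twist (H\<lparr>car := W\<rparr>) F Fi) = reass (majid_twist H F Fi)"
  by (simp_all add: majid_twist_def)

text \<open>A linear left inverse of \<open>f\<close> on \<open>W\<close> shows that \<open>f \<otimes> f\<close> is injective on \<open>W \<otimes> W\<close>.  So an element of \<open>W\<close>
  whose image is skew-primitive is skew-primitive.\<close>

lemma tensor_left_inverse:
  assumes f: "lin fscale fscale f" and f': "lin fscale fscale f'"
    and inv: "\<And>w. w \<in> W \<Longrightarrow> f' (f w) = w" and t: "t \<in> tensor W W"
  shows "lext fscale (\<lambda>(x, y). tens (f' (bas x)) (f' (bas y)))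
    (lext fscale (\<lambda>(x, y). tens (f (bas x)) (f (bas y))) t) = t"
proof -
  have bf: "bilin fscale (\<lambda>u v. tens (f u) (f v))" "bilin fscale (\<lambda>u v. tens (f' u) (f' v))"
    by (intro bilinI lin_intros f f')+
  have l: "lin fscale fscale (lext fscale (\<lambda>(x, y). tens (f (bas x)) (f (bas y))))"
    "lin fscale fscale (lext fscale (\<lambda>(x, y). tens (f' (bas x)) (f' (bas y))))"
    by (intro linear_lext free.vector_space_axioms)+
  show ?thesis using t unfolding tensor_def
  proof (induction rule: free.span_induct_alt)
    case base
    show ?case by (simp add: lin_zero[OF l(1)] lin_zero[OF l(2)])
  next
    case (step c x y)
    then show ?case
      by (auto simp: lin_add[OF l(1)] lin_add[OF l(2)] lin_scale[OF l(1)] lin_scale[OF l(2)]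
          lext_tens[OF bf(1)] lext_tens[OF bf(2)] inv)
  qed
qed

text \<open>The subspaces \<open>W\<close> and \<open>W'\<close> stand for \<open>H(M)\<close> and \<open>H(N)\<close>, or for \<open>B(M)\<close> and \<open>B(N)\<close>.  The map \<open>\<phi>\<close> from
  \<open>M\<close> to \<open>N\<close> is the degree 1 part of \<open>f\<close> on arrows.  It is injective, since an element that \<open>f\<close> sends
  to degree 0 is itself a combination of vertices, and surjective, since preimages of arrows under
  \<open>f\<close> are skew-primitive.  A product of a vertex \<open>e\<close> with an arrow from \<open>h\<close> to \<open>g\<close> in the twisted algebra
  is \<open>F(e, h) / F(e, g)\<close> times the original one, up to a combination of vertices, which
  has no degree 1 part.\<close>

theorem majid_gauge_imp_bimod_gauge:
  fixes G :: "('g, 'x) monoid_scheme" (structure) and H H' :: "('g path, 'k::field) majid"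
    and M :: "('k, 'g, 'm::ab_group_add) bimod" and N :: "('k, 'g, 'n::ab_group_add) bimod"
  assumes "HM_algebra G R \<Phi> H M \<theta>" "HM_algebra G R' \<Phi>' H' N \<theta>'"
    and W: "W \<subseteq> car H" "free.subspace W" "vertex ` carrier G \<subseteq> W" "path_degree (hopf_quiver G R) 1 \<subseteq> W"
      "\<And>a. a \<in> W \<Longrightarrow> comul H a \<in> tensor W W"
    and W': "W' \<subseteq> car H'" "vertex ` carrier G \<subseteq> W'" "path_degree (hopf_quiver G R') 1 \<subseteq> W'"
    and F: "majid_gauge (H\<lparr>car := W\<rparr>) F Fi"
    and f: "majid_iso f (majid_twist (H\<lparr>car := W\<rparr>) F Fi) (H'\<lparr>car := W'\<rparr>)"
    and fv: "\<And>g. g \<in> carrier G \<Longrightarrow> f (vertex g) = vertex g"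
  shows "bimod_gauge_equiv G \<Phi> M \<Phi>' N"
proof -
  interpret H: HM_algebra G R \<Phi> H M \<theta> by fact
  interpret H': HM_algebra G R' \<Phi>' H' N \<theta>' by fact
  note vs = free.vector_space_axioms vector_space_mult
  define F0 where "F0 = (\<lambda>g h. F (vertex g) (vertex h))"
  have vW: "vertex g \<in> W" if "g \<in> carrier G" for g using W(3) that by blast
  have Fb: "bilin (*) F" "bilin (*) Fi" using F by (auto simp: majid_gauge_def conv_inverse2_def)
  have FFi: "F0 g h * Fi (vertex g) (vertex h) = 1" if "g \<in> carrier G" "h \<in> carrier G" for g h
  proof -
    have "sw2 (*) H (vertex g) (\<lambda>a1 a2. sw2 (*) H (vertex h) (\<lambda>b1 b2. F a1 b1 * Fi a2 b2)) =
        counit H (vertex g) * counit H (vertex h)"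
      using F vW that by (simp add: majid_gauge_def conv_inverse2_def)
    thus ?thesis using that by (simp add: H.sw2_vertex[OF vs(2)] H.counit_vertex F0_def)
  qed
  have F0nz: "F0 g h \<noteq> 0" if "g \<in> carrier G" "h \<in> carrier G" for g h
    using FFi[OF that] by auto
  have Fi: "Fi (vertex g) (vertex h) = 1 / F0 g h" if "g \<in> carrier G" "h \<in> carrier G" for g h
    using FFi[OF that] F0nz[OF that] by (simp add: nonzero_eq_divide_eq mult.commute)
  have gauge: "gauge G F0"
    using F vW F0nz
    by (auto simp: gauge_def majid_gauge_def H.counit_vertex F0_def H.unt_vertex)
  have lf: "lin fscale fscale f" and bij: "bij_betw f W W'"
    and comul_f: "\<And>a. a \<in> W \<Longrightarrow> comul H' (f a) = sw2 fscale H a (\<lambda>a1 a2. tens (f a1) (f a2))"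
    and prd_f: "\<And>a b. a \<in> W \<Longrightarrow> b \<in> W \<Longrightarrow> f (prd (majid_twist H F Fi) a b) = prd H' (f a) (f b)"
    and reass_f: "\<And>a b c. a \<in> W \<Longrightarrow> b \<in> W \<Longrightarrow> c \<in> W \<Longrightarrow>
      reass H' (f a) (f b) (f c) = reass (majid_twist H F Fi) a b c"
    using f by (simp_all add: majid_iso_def)
  have fW: "f a \<in> W'" if "a \<in> W" for a using bij that by (auto simp: bij_betw_def)
  have degW: "a \<in> W" if "a \<in> path_degree H.Q 1" for a using W(4) that by blast
  have deg0W: "a \<in> W" and fdeg0: "f a = a" if "a \<in> path_degree H.Q 0" for a
  proof -
    note a = H.degree0_vertices[OF that]
    have "(\<Sum>x\<in>keys a. fscale (coeff a x) (vertex (fst x))) \<in> W"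
      using a(2) vW by (intro free.subspace_sum W(2) free.subspace_scale) auto
    thus "a \<in> W" using a(1) by simp
    have "f (\<Sum>x\<in>keys a. fscale (coeff a x) (vertex (fst x))) =
        (\<Sum>x\<in>keys a. fscale (coeff a x) (vertex (fst x)))"
      using a(2) by (simp add: lin_sum[OF lf] lin_scale[OF lf] fv)
    thus "f a = a" using a(1) by simp
  qed
  have f0: "path_degree H'.Q 0 = path_degree H.Q 0"
    by (auto simp: path_degree_def)

  \<comment> \<open>The reassociators agree up to the twist, as seen on the vertices.\<close>
  have cocyc: "cocycle_eq G \<Phi>' (cocycle_twist G F0 \<Phi>)"
    unfolding cocycle_eq_def
  proof (intro ballI)
    fix e g h assume *: "e \<in> carrier G" "g \<in> carrier G" "h \<in> carrier G"
    have "\<Phi>' e g h = reass (majid_twist H F Fi) (vertex e) (vertex g) (vertex h)"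
      using reass_f[of "vertex e" "vertex g" "vertex h"] * vW by (simp add: fv H'.reass_vertex)
    also have "\<dots> = Fi (vertex g) (vertex h) * Fi (vertex e) (vertex (g \<otimes> h)) * \<Phi> e g h *
        F (vertex (e \<otimes> g)) (vertex h) * F (vertex e) (vertex g)"
      using * by (simp add: majid_twist_def H.sw4_vertex[OF vs(2)] H.sw5_vertex[OF vs(2)] H.prd_vertex H.reass_vertex)
    also have "\<dots> = cocycle_twist G F0 \<Phi> e g h"
      using * by (simp add: cocycle_twist_def Fi F0nz F0_def[symmetric] field_simps)
        (simp add: F0_def)
    finally show "\<Phi>' e g h = cocycle_twist G F0 \<Phi> e g h" .
  qed

  \<comment> \<open>The degree 1 part of \<open>f\<close> on \<open>M\<close>.\<close>
  let ?d = "deg_part 1"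
  define \<phi> where "\<phi> = (\<lambda>m. inv_into UNIV \<theta>' (?d (f (\<theta> m))))"
  have \<theta>\<phi>: "\<theta>' (\<phi> m) = ?d (f (\<theta> m))" for m
  proof -
    have "f (\<theta> m) \<in> car H'" using fW[OF degW[OF H.\<theta>_degree]] W'(1) by blast
    then have "?d (f (\<theta> m)) \<in> path_degree H'.Q 1" by (rule H'.deg_part_car)
    thus ?thesis using H'.\<theta>_bij unfolding \<phi>_def by (intro f_inv_into_f) (auto simp: bij_betw_def)
  qed
  have l\<phi>: "lin (scl M) (scl N) \<phi>"
  proof (rule linearI'[OF H.vector_space H'.vector_space])
    have l: "lin (scl M) fscale (\<lambda>m. ?d (f (\<theta> m)))"
      by (rule linear_comp[OF linear_deg_part linear_comp[OF lf H.\<theta>_linear]])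
    show "\<phi> (x + y) = \<phi> x + \<phi> y" for x y
      by (subst H'.\<theta>_inj[symmetric]) (simp add: \<theta>\<phi> lin_add[OF l] lin_add[OF H'.\<theta>_linear] del: One_nat_def)
    show "\<phi> (scl M c x) = scl N c (\<phi> x)" for c x
      by (subst H'.\<theta>_inj[symmetric]) (simp add: \<theta>\<phi> lin_scale[OF l] lin_scale[OF H'.\<theta>_linear] del: One_nat_def)
  qed
  have skew: "comul H' (f v) = tens (f v) (vertex h) + tens (vertex g) (f v)"
    if "v \<in> H.arrows_between h g" "g \<in> carrier G" "h \<in> carrier G" for v g h
  proof -
    have v: "v \<in> W" using degW H.arrows_between_degree that by blast
    have "comul H v = (\<Sum>i\<in>UNIV. tens (if i then v else vertex g) (if i then vertex h else v))"
      using v W(1) H.comul_path H.path_comul_arrows_between[OF that(1)] by (auto simp: UNIV_bool add.commute)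
    from sw2_sum_tens[OF _ this, of fscale "\<lambda>a1 a2. tens (f a1) (f a2)"] show ?thesis
      using that(2,3) by (simp add: comul_f[OF v] bilinI lin_intros lf UNIV_bool fv add.commute)
  qed
  have skew': "f v = \<theta>' (\<phi> m) + deg_part 0 (f v) \<and>
      deg_part 0 (f v) \<in> path_degree H.Q 0 \<and> \<theta>' (\<phi> m) \<in> H'.arrows_between h g"
    if "v = \<theta> m" "m \<in> homog M g h" "g \<in> carrier G" "h \<in> carrier G" for v m g h
  proof -
    have v: "v \<in> H.arrows_between h g" using that H.\<theta>_between by blast
    have fv': "f v \<in> car H'" using fW degW H.arrows_between_degree[OF v] W'(1) by blast
    have "path_comul H'.Q (f v) = tens (f v) (vertex h) + tens (vertex g) (f v)"
      using skew[OF v that(3,4)] H'.comul_path[OF fv'] by simp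
    note s = H'.skew_primitive_support[OF fv' this, folded deg_part_def]
    have "f v = ?d (f v) + deg_part 0 (f v)" by (rule deg_part_0_1) (rule s(2))
    thus ?thesis using H'.deg_part_car[OF fv', of 0] s f0 \<theta>\<phi>[of m] that(1) by auto
  qed
  have \<phi>_homog: "\<phi> m \<in> homog N g h" if "g \<in> carrier G" "h \<in> carrier G" "m \<in> homog M g h" for g h m
    using skew'[OF refl that(3,1,2)] H'.\<theta>_homog_iff[OF that(1,2)] by blast
  have bij_homog: "bij_betw \<phi> (homog M g h) (homog N g h)" if gh: "g \<in> carrier G" "h \<in> carrier G" for g h
    unfolding bij_betw_def
  proof
    show "inj_on \<phi> (homog M g h)"
    proof (rule inj_onI)
      fix x y assume xy: "x \<in> homog M g h" "y \<in> homog M g h" "\<phi> x = \<phi> y"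
      then have m: "x - y \<in> homog M g h" 
        using H.homog_add[OF xy(1) H.homog_scale[OF xy(2), of "-1"]] H.vector_space
        by (metis diff_conv_add_uminus module.scale_minus_left module.scale_one module_iff_vector_space)
      have 0: "\<phi> (x - y) = 0" using xy by (simp add: lin_diff[OF l\<phi>])
      let ?z = "deg_part 0 (f (\<theta> (x - y)))"
      have z: "f (\<theta> (x - y)) = ?z" "?z \<in> path_degree H.Q 0"
        using skew'[OF refl m gh] 0 by (auto simp: lin_zero[OF H'.\<theta>_linear])
      then have "f (\<theta> (x - y)) = f ?z" using fdeg0[OF z(2)] by simp
      then have "\<theta> (x - y) = ?z"
        using bij_betw_imp_inj_on[OF bij] degW[OF H.\<theta>_degree] deg0W[OF z(2)] by (meson inj_onD)
      then have d0: "\<theta> (x - y) \<in> path_degree H.Q 0" using z(2) by simp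
      have "\<theta> (x - y) = \<theta> 0"
      proof (rule poly_mapping_eqI)
        fix p show "coeff (\<theta> (x - y)) p = coeff (\<theta> 0) p"
          using d0 H.\<theta>_degree[of "x - y"] unfolding path_degree_iff
          by (metis lin_zero[OF H.\<theta>_linear] lookup_zero zero_neq_one)
      qed
      thus "x = y" by (simp add: H.\<theta>_inj)
    qed
    show "\<phi> ` homog M g h = homog N g h"
    proof (intro equalityI subsetI)
      fix n assume n: "n \<in> homog N g h"
      let ?b = "\<theta>' n"
      have b: "?b \<in> H'.arrows_between h g" using H'.\<theta>_between n gh by blast
      then have bW: "?b \<in> W'" using W'(3) H'.arrows_between_degree by blast
      then obtain z where z: "z \<in> W" "f z = ?b" using bij by (auto simp: bij_betw_def)
      obtain f' where f': "lin fscale fscale f'" "\<And>w. w \<in> W \<Longrightarrow> f' (f w) = w"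
      proof -
        interpret vector_space_pair "fscale :: 'k \<Rightarrow> ('g path \<Rightarrow>\<^sub>0 'k) \<Rightarrow> _" "fscale :: 'k \<Rightarrow> ('g path \<Rightarrow>\<^sub>0 'k) \<Rightarrow> _"
          by unfold_locales
        show ?thesis
          using linear_exists_left_inverse_on[OF lf W(2) bij_betw_imp_inj_on[OF bij]] that by blast
      qed
      let ?ff = "lext fscale (\<lambda>(x, y). tens (f (bas x)) (f (bas y)))"
      let ?ff' = "lext fscale (\<lambda>(x, y). tens (f' (bas x)) (f' (bas y)))"
      have bf: "bilin fscale (\<lambda>u v. tens (f' u) (f' v))"
        by (intro bilinI lin_intros f'(1))
      have "comul H z = ?ff' (?ff (comul H z))"
        using tensor_left_inverse[OF lf f' W(5)[OF z(1)]] by simp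
      also have "?ff (comul H z) = comul H' (f z)"
        using comul_f[OF z(1)] by (simp add: sw2_lext)
      also have "\<dots> = tens ?b (vertex h) + tens (vertex g) ?b"
        using H'.path_comul_arrows_between[OF b] H'.comul_path bW W'(1) z(2) by auto
      also have "?ff' \<dots> = tens (f' ?b) (f' (vertex h)) + tens (f' (vertex g)) (f' ?b)"
        by (simp add: lin_add[OF linear_lext] vs lext_tens[OF bf])
      also have "\<dots> = tens z (vertex h) + tens (vertex g) z"
        using f'(2)[OF vW] f'(2)[OF z(1)] z(2) fv gh by metis
      finally have skz: "path_comul H.Q z = tens z (vertex h) + tens (vertex g) z"
        using H.comul_path z(1) W(1) by auto
      have zc: "z \<in> car H" using z(1) W(1) by blast
      note s = H.skew_primitive_support[OF zc skz, folded deg_part_def]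
      obtain m where m: "\<theta> m = ?d z"
        using H.\<theta>_bij H.arrows_between_degree[OF s(1)] unfolding bij_betw_def by (metis imageE)
      have mh: "m \<in> homog M g h" using s(1) m H.\<theta>_homog_iff[OF gh] by simp
      let ?z0 = "deg_part 0 z"
      have z0: "?z0 \<in> path_degree H.Q 0" by (rule H.deg_part_car[OF zc])
      have "z = ?d z + ?z0" by (rule deg_part_0_1) (rule s(2))
      then have "f (\<theta> m) = f (z - ?z0)" using m by (metis add_diff_cancel)
      also have "\<dots> = ?b - ?z0" by (simp add: lin_diff[OF lf] z(2) fdeg0[OF z0])
      finally have "\<theta>' (\<phi> m) = ?d ?b - ?d ?z0" by (simp add: \<theta>\<phi> lin_diff[OF linear_deg_part])
      moreover have "?d ?z0 = 0" using deg_part_degree[OF z0, of 1] by simp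
      moreover have "?d ?b = ?b" using deg_part_degree[OF H'.\<theta>_degree, of 1 n] by simp
      ultimately have "\<phi> m = n" by (simp add: H'.\<theta>_inj)
      thus "n \<in> \<phi> ` homog M g h" using mh by blast
    qed (use \<phi>_homog gh in blast)
  qed

  \<comment> \<open>The products with vertices, read off in degree 1.\<close>
  have d_deg0: "?d v = 0" if "v \<in> path_degree H.Q 0" for v
    using deg_part_degree[OF that, of 1] by simp
  have d_deg1: "?d (\<theta>' n) = \<theta>' n" for n
    using deg_part_degree[OF H'.\<theta>_degree, of 1 n] by simp
  have d_vertex: "?d (f (vertex g)) = 0" if "g \<in> carrier G" for g
    using d_deg0[OF H.vertex_degree[OF that]] fv[OF that] by simp
  have tri: "trilin fscale (\<lambda>h1 h2 h3. fscale (Fi u h1 * F u' h3) (L h2))"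
    "trilin fscale (\<lambda>h1 h2 h3. fscale (Fi h1 u * F h3 u') (L h2))"
    if "lin fscale fscale L" for u u' and L :: "('g path \<Rightarrow>\<^sub>0 'k) \<Rightarrow> ('g path \<Rightarrow>\<^sub>0 'k)"
    unfolding trilin_def
    by (intro conjI allI bilinI lin_intros bilinD[OF Fb(1)] bilinD[OF Fb(2)] that)+
  have lact: "\<phi> (lact (bimod_twist F0 M) e m) = lact N e (\<phi> m)"
    if e: "e \<in> carrier G" and gh: "g \<in> carrier G" "h \<in> carrier G" and m: "m \<in> homog M g h" for e g h m
  proof -
    have v: "\<theta> m \<in> H.arrows_between h g" using H.\<theta>_between m gh by blast
    have "prd (majid_twist H F Fi) (vertex e) (\<theta> m) =
        fscale (Fi (vertex e) (\<theta> m) * F0 e h) (vertex (e \<otimes> h)) +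
        fscale (Fi (vertex e) (vertex g) * F0 e h) (\<theta> (lact M e m)) +
        fscale (Fi (vertex e) (vertex g) * F (vertex e) (\<theta> m)) (vertex (e \<otimes> g))"
      using e gh
      by (simp add: majid_twist_def H.sw3_vertex[OF vs(1)] H.prd_vertex H.prd_lact F0_def
          H.sw3_arrows_between[OF v tri(1)[OF H.linear_prd2] gh])
    then have "?d (f (prd (majid_twist H F Fi) (vertex e) (\<theta> m))) =
        fscale (F0 e h / F0 e g) (\<theta>' (\<phi> (lact M e m)))"
      using e gh d_vertex by (simp add: lin_add[OF lf] lin_scale[OF lf] lin_add[OF linear_deg_part] lin_scale[OF linear_deg_part] \<theta>\<phi> Fi del: One_nat_def)
    also have "\<dots> = \<theta>' (\<phi> (lact (bimod_twist F0 M) e m))"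
      by (simp add: H.lact_twist[OF e m] lin_scale[OF l\<phi>] lin_scale[OF H'.\<theta>_linear])
    finally have l: "?d (f (prd (majid_twist H F Fi) (vertex e) (\<theta> m))) = \<theta>' (\<phi> (lact (bimod_twist F0 M) e m))" .
    have "f (prd (majid_twist H F Fi) (vertex e) (\<theta> m)) = prd H' (vertex e) (f (\<theta> m))"
      using prd_f[OF vW[OF e] degW[OF H.\<theta>_degree]] fv[OF e] by simp
    also have "\<dots> = prd H' (vertex e) (\<theta>' (\<phi> m)) + prd H' (vertex e) (deg_part 0 (f (\<theta> m)))"
      using skew'[OF refl m gh] lin_add[OF H'.linear_prd2] by metis
    finally have "?d (f (prd (majid_twist H F Fi) (vertex e) (\<theta> m))) =
        ?d (\<theta>' (lact N e (\<phi> m))) + ?d (prd H' (vertex e) (deg_part 0 (f (\<theta> m))))"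
      using e by (simp add: lin_add[OF linear_deg_part] H'.prd_lact)
    also have "\<dots> = \<theta>' (lact N e (\<phi> m))"
      using d_deg0[of "prd H' (vertex e) (deg_part 0 (f (\<theta> m)))"]
        H'.gr_prd[OF H'.vertex_degree[OF e], of "deg_part 0 (f (\<theta> m))" 0] skew'[OF refl m gh]
      by (simp add: d_deg1 f0 del: One_nat_def)
    finally show ?thesis using l by (simp add: H'.\<theta>_inj)
  qed
  have ract: "\<phi> (ract (bimod_twist F0 M) m e) = ract N (\<phi> m) e"
    if e: "e \<in> carrier G" and gh: "g \<in> carrier G" "h \<in> carrier G" and m: "m \<in> homog M g h" for e g h m
  proof -
    have v: "\<theta> m \<in> H.arrows_between h g" using H.\<theta>_between m gh by blast
    have "prd (majid_twist H F Fi) (\<theta> m) (vertex e) =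
        fscale (Fi (\<theta> m) (vertex e) * F0 h e) (vertex (h \<otimes> e)) +
        fscale (Fi (vertex g) (vertex e) * F0 h e) (\<theta> (ract M m e)) +
        fscale (Fi (vertex g) (vertex e) * F (\<theta> m) (vertex e)) (vertex (g \<otimes> e))"
      using e gh
      by (simp add: majid_twist_def H.sw3_vertex[OF vs(1)] H.prd_vertex H.prd_ract F0_def
          H.sw3_arrows_between[OF v tri(2)[OF H.linear_prd1] gh])
    then have "?d (f (prd (majid_twist H F Fi) (\<theta> m) (vertex e))) =
        fscale (F0 h e / F0 g e) (\<theta>' (\<phi> (ract M m e)))"
      using e gh d_vertex by (simp add: lin_add[OF lf] lin_scale[OF lf] lin_add[OF linear_deg_part] lin_scale[OF linear_deg_part] \<theta>\<phi> Fi del: One_nat_def)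
    also have "\<dots> = \<theta>' (\<phi> (ract (bimod_twist F0 M) m e))"
      by (simp add: H.ract_twist[OF e m] lin_scale[OF l\<phi>] lin_scale[OF H'.\<theta>_linear])
    finally have l: "?d (f (prd (majid_twist H F Fi) (\<theta> m) (vertex e))) = \<theta>' (\<phi> (ract (bimod_twist F0 M) m e))" .
    have "f (prd (majid_twist H F Fi) (\<theta> m) (vertex e)) = prd H' (f (\<theta> m)) (vertex e)"
      using prd_f[OF degW[OF H.\<theta>_degree] vW[OF e]] fv[OF e] by simp
    also have "\<dots> = prd H' (\<theta>' (\<phi> m)) (vertex e) + prd H' (deg_part 0 (f (\<theta> m))) (vertex e)"
      using skew'[OF refl m gh] lin_add[OF H'.linear_prd1] by metis
    finally have "?d (f (prd (majid_twist H F Fi) (\<theta> m) (vertex e))) =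
        ?d (\<theta>' (ract N (\<phi> m) e)) + ?d (prd H' (deg_part 0 (f (\<theta> m))) (vertex e))"
      using e by (simp add: lin_add[OF linear_deg_part] H'.prd_ract)
    also have "\<dots> = \<theta>' (ract N (\<phi> m) e)"
      using d_deg0[of "prd H' (deg_part 0 (f (\<theta> m))) (vertex e)"]
        H'.gr_prd[OF _ H'.vertex_degree[OF e], of "deg_part 0 (f (\<theta> m))" 0] skew'[OF refl m gh]
      by (simp add: d_deg1 f0 del: One_nat_def)
    finally show ?thesis using l by (simp add: H'.\<theta>_inj)
  qed
  have "bimod_iso G \<phi> (bimod_twist F0 M) N"
    by (rule bimod_isoI)
      (simp_all add: bicomodule_twist H.bicomodule_axioms H'.bicomodule_axioms l\<phi> bij_homog
        H.linear_lact_twist H'.lact_linear lact H.linear_ract_twist H'.ract_linear ract)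
  thus ?thesis unfolding bimod_gauge_equiv_def using gauge cocyc by blast
qed

section \<open>The Majid subalgebra generated by vertices and arrows\<close>

lemma split_restr: "y = (\<Sum>e\<in>f ` keys y. restr (\<lambda>x. f x = e) y)"
proof (rule poly_mapping_eqI)
  fix x
  have "coeff (\<Sum>e\<in>f ` keys y. restr (\<lambda>x. f x = e) y) x =
      (\<Sum>e\<in>f ` keys y. if f x = e then coeff y x else 0)"
    by (simp add: lookup_sum)
  also have "\<dots> = coeff y x"
    by (auto simp: sum.delta in_keys_iff image_iff)
  finally show "coeff y x = coeff (\<Sum>e\<in>f ` keys y. restr (\<lambda>x. f x = e) y) x" by simp
qed

lemma deg_part_bas: "deg_part n (bas x) = (if length (snd x) = n then bas x else 0)"
  by (simp add: deg_part_def)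

context path_majid
begin

text \<open>This is \<open>B(M)\<close>: closure under the antipode follows from the other rules.\<close>

inductive_set gen :: "('a path \<Rightarrow>\<^sub>0 'k) set" where
  bas: "x \<in> paths Q \<Longrightarrow> length (snd x) \<le> 1 \<Longrightarrow> bas x \<in> gen"
| zero: "0 \<in> gen"
| add: "a \<in> gen \<Longrightarrow> b \<in> gen \<Longrightarrow> a + b \<in> gen"
| scale: "a \<in> gen \<Longrightarrow> fscale c a \<in> gen"
| prd: "a \<in> gen \<Longrightarrow> b \<in> gen \<Longrightarrow> prd H a b \<in> gen"

lemma gen_subspace: "free.subspace gen"
  by (auto intro: free.subspaceI gen.intros)

lemma gen_car: "a \<in> gen \<Longrightarrow> a \<in> car H"
  by (induction rule: gen.induct)
    (auto simp: bas_car prd_closed free.subspace_0[OF subspace] free.subspace_add[OF subspace]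
      free.subspace_scale[OF subspace])

lemma vertex_gen: "g \<in> carrier G \<Longrightarrow> vertex g \<in> gen"
  by (auto simp: vertex_def intro: gen.bas)

lemma degree1_gen:
  assumes "v \<in> path_degree Q 1" shows "v \<in> gen"
proof (rule in_subspace_bas[OF gen_subspace])
  fix x assume "x \<in> keys v"
  then have "x \<in> paths Q \<and> length (snd x) = 1"
    using assms unfolding path_degree_iff in_keys_iff by blast
  thus "bas x \<in> gen" by (intro gen.bas) auto
qed

lemma gen_comul: "a \<in> gen \<Longrightarrow> comul H a \<in> tensor gen gen"
proof (induction rule: gen.induct)
  case (bas x)
  obtain u p where x: "x = (u, p)" by fastforce
  have "comul H (bas x) = (\<Sum>i\<le>length p. tens (bas (target G u (take i p), drop i p)) (bas (u, take i p)))"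
    using bas by (simp add: x comul_path[OF bas_car] path_comul_bas)
  also have "\<dots> \<in> tensor gen gen"
  proof (intro free.subspace_sum[OF tensor_subspace] tens_in_tensor)
    fix i
    show "bas (target G u (take i p), drop i p) \<in> gen" "bas (u, take i p) \<in> gen"
      using bas path_cut[of u p R i] by (auto simp: x intro!: gen.bas)
  qed
  finally show ?case .
next
  case (prd a b)
  have l: "lin fscale fscale (\<lambda>a1. tens (prd H a1 b1) c)"
    "lin fscale fscale (\<lambda>b1. tens (prd H a1' b1) c)"
    "lin fscale fscale (\<lambda>a1. tens c (prd H a1 b1))"
    "lin fscale fscale (\<lambda>b1. tens c (prd H a1' b1))" for b1 c a1'
    by (intro lin_intros linear_prd1 linear_prd2)+
  have "comul H (prd H a b) = sw2 fscale H a (\<lambda>a1 a2. sw2 fscale H b (\<lambda>b1 b2. tens (prd H a1 b1) (prd H a2 b2)))"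
    using prd by (simp add: comul_prd gen_car)
  also have "\<dots> \<in> tensor gen gen"
  proof (rule sw2_closed[OF _ prd(3) tensor_subspace])
    show "bilin fscale (\<lambda>a1 a2. sw2 fscale H b (\<lambda>b1 b2. tens (prd H a1 b1) (prd H a2 b2)))"
      by (intro bilinI linear_sw2_arg l free.vector_space_axioms)
    fix a1 a2 assume a: "a1 \<in> gen" "a2 \<in> gen"
    show "sw2 fscale H b (\<lambda>b1 b2. tens (prd H a1 b1) (prd H a2 b2)) \<in> tensor gen gen"
    proof (rule sw2_closed[OF _ prd(4) tensor_subspace])
      show "bilin fscale (\<lambda>b1 b2. tens (prd H a1 b1) (prd H a2 b2))"
        by (intro bilinI l)
    qed (simp add: tens_in_tensor gen.prd a)
  qed
  finally show ?case .
qed (auto simp: lin_zero[OF comul_linear] lin_add[OF comul_linear] lin_scale[OF comul_linear]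
    intro: free.subspace_0[OF tensor_subspace] free.subspace_add[OF tensor_subspace] free.subspace_scale[OF tensor_subspace])

lemma deg_part_prd:
  assumes a: "a \<in> car H" and b: "b \<in> car H"
  shows "deg_part n (prd H a b) = (\<Sum>i\<le>n. prd H (deg_part i a) (deg_part (n - i) b))"
proof (rule bilin_eq_on_bas[where s = fscale and f = "\<lambda>a b. deg_part n (prd H a b)" and
    g = "\<lambda>a b. \<Sum>i\<le>n. prd H (deg_part i a) (deg_part (n - i) b)"])
  show "bilin fscale (\<lambda>a b. deg_part n (prd H a b))"
    by (intro bilinI linear_comp[OF linear_deg_part] linear_prd1 linear_prd2)
  show "bilin fscale (\<lambda>a b. \<Sum>i\<le>n. prd H (deg_part i a) (deg_part (n - i) b))"
    by (intro bilinI linear_setsum linear_comp[OF linear_prd1 linear_deg_part]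
        linear_comp[OF linear_prd2 linear_deg_part] free.vector_space_axioms)
  fix x y assume "x \<in> keys a" "y \<in> keys b"
  then have x: "x \<in> paths Q" and y: "y \<in> paths Q" using a b by (auto simp: car_path)
  show "deg_part n (prd H (bas x) (bas y)) = (\<Sum>i\<le>n. prd H (deg_part i (bas x)) (deg_part (n - i) (bas y)))"
  proof -
    let ?m = "length (snd x)" and ?k = "length (snd y)"
    have "prd H (bas x) (bas y) \<in> path_degree Q (?m + ?k)"
      using gr_prd bas_degree[of "fst x" "snd x"] bas_degree[of "fst y" "snd y"] x y by simp
    then have "deg_part n (prd H (bas x) (bas y)) = (if n = ?m + ?k then prd H (bas x) (bas y) else 0)"
      by (rule deg_part_degree)
    also have "\<dots> = (\<Sum>i\<le>n. if i = ?m then (if n = ?m + ?k then prd H (bas x) (bas y) else 0) else 0)"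
      by simp
    also have "\<dots> = (\<Sum>i\<le>n. prd H (deg_part i (bas x)) (deg_part (n - i) (bas y)))"
      by (rule sum.cong) (auto simp: deg_part_bas lin_zero[OF linear_prd1] lin_zero[OF linear_prd2])
    finally show ?thesis .
  qed
qed

lemma gen_deg_part: "a \<in> gen \<Longrightarrow> deg_part n a \<in> gen"
proof (induction arbitrary: n rule: gen.induct)
  case (prd a b)
  then show ?case
    by (simp add: deg_part_prd gen_car free.subspace_sum[OF gen_subspace] gen.prd)
qed (auto simp: deg_part_bas lin_zero[OF linear_deg_part] lin_add[OF linear_deg_part] lin_scale[OF linear_deg_part]
    intro: gen.intros)

text \<open>A subcoalgebra is stable under splitting by start and end points of paths, since these
  components are obtained from the coproduct by evaluating one factor at a vertex.\<close>

lemma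
  assumes W: "W \<subseteq> car H" "free.subspace W" and comul: "comul H a \<in> tensor W W" and a: "a \<in> W"
  shows restr_source: "restr (\<lambda>x. fst x = h) a \<in> W"
    and restr_target: "restr (\<lambda>x. target G (fst x) (snd x) = g) a \<in> W"
proof -
  note vs = free.vector_space_axioms
  have k: "x \<in> paths Q" if "x \<in> keys a" for x using that a W(1) car_path by blast
  have bil: "bilin fscale (\<lambda>a1 a2. fscale (coeff a2 z) a1)" "bilin fscale (\<lambda>a1 a2. fscale (coeff a1 z) a2)" for z
    by (intro bilinI lin_intros vs)+
  have "restr (\<lambda>x. fst x = h) a = sw2 fscale H a (\<lambda>a1 a2. fscale (coeff a2 (h, [])) a1)"
  proof (rule linear_eq_on_bas[OF linear_restr linear_sw2[OF vs comul_linear]])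
    fix x assume x: "x \<in> keys a"
    obtain u p where up: "x = (u, p)" by fastforce
    have "sw2 fscale H (bas (u, p)) (\<lambda>a1 a2. fscale (coeff a2 (h, [])) a1) =
      fscale (coeff (bas (u, take 0 p)) (h, [])) (bas (target G u (take 0 p), drop 0 p))"
      unfolding sw2_bas[OF vs k[OF x, unfolded up]]
      by (rule sum_single) (auto simp: lookup_bas)
    thus "restr (\<lambda>x. fst x = h) (bas x) = sw2 fscale H (bas x) (\<lambda>a1 a2. fscale (coeff a2 (h, [])) a1)"
      by (simp add: up lookup_bas)
  qed
  also have "\<dots> \<in> W"
    by (rule sw2_closed[OF bil(1) comul W(2)]) (simp add: free.subspace_scale[OF W(2)])
  finally show "restr (\<lambda>x. fst x = h) a \<in> W" .
  have "restr (\<lambda>x. target G (fst x) (snd x) = g) a = sw2 fscale H a (\<lambda>a1 a2. fscale (coeff a1 (g, [])) a2)"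
  proof (rule linear_eq_on_bas[OF linear_restr linear_sw2[OF vs comul_linear]])
    fix x assume x: "x \<in> keys a"
    obtain u p where up: "x = (u, p)" by fastforce
    have "sw2 fscale H (bas (u, p)) (\<lambda>a1 a2. fscale (coeff a1 (g, [])) a2) =
      fscale (coeff (bas (target G u (take (length p) p), drop (length p) p)) (g, [])) (bas (u, take (length p) p))"
      unfolding sw2_bas[OF vs k[OF x, unfolded up]]
      by (rule sum_single) (auto simp: lookup_bas)
    thus "restr (\<lambda>x. target G (fst x) (snd x) = g) (bas x) = sw2 fscale H (bas x) (\<lambda>a1 a2. fscale (coeff a1 (g, [])) a2)"
      by (simp add: up lookup_bas)
  qed
  also have "\<dots> \<in> W"
    by (rule sw2_closed[OF bil(2) comul W(2)]) (simp add: free.subspace_scale[OF W(2)])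
  finally show "restr (\<lambda>x. target G (fst x) (snd x) = g) a \<in> W" .
qed

lemma restr_ends:
  assumes W: "W \<subseteq> car H" "free.subspace W" "\<And>a. a \<in> W \<Longrightarrow> comul H a \<in> tensor W W" and a: "a \<in> W"
  shows "restr (ends h g) a \<in> W"
proof -
  have "restr (ends h g) a = restr (\<lambda>x. target G (fst x) (snd x) = g) (restr (\<lambda>x. fst x = h) a)"
    by (rule poly_mapping_eqI) (auto simp: ends_def)
  thus ?thesis using restr_target[OF W(1,2) W(3)] restr_source[OF W(1,2) W(3) a] a by simp
qed

text \<open>The reassociator sees only the end points of a path if its other arguments are vertices.  So
  multiplication by a vertex can be undone, up to a scalar that depends on the end points.\<close>

lemma prd_vertex_vertex_inv:
  assumes up: "(u, p) \<in> paths Q" and h: "h \<in> carrier G" and nz: "\<Phi> (target G u p) h (inv h) \<noteq> 0"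
  shows "prd H (prd H (bas (u, p)) (vertex h)) (vertex (inv h)) =
    fscale (\<Phi> u h (inv h) / \<Phi> (target G u p) h (inv h)) (bas (u, p))"
proof -
  note vs = free.vector_space_axioms
  have c: "bas (u, p) \<in> car H" "vertex h \<in> car H" "vertex (inv h) \<in> car H"
    using assms by (simp_all add: bas_car vertex_car)
  have r0: "reass H (bas (w, q)) (vertex h) (vertex (inv h)) = 0" if "(w, q) \<in> paths Q" "q \<noteq> []" for w q
    using gr_reass[OF bas_degree[OF that(1)] vertex_degree[OF h] vertex_degree, of "inv h"] that h by simp
  have "sw2 fscale H (bas (u, p)) (\<lambda>a1 a2. fscale (reass H a2 (vertex h) (vertex (inv h))) (prd H a1 (vertex \<one>))) =
      sw2 fscale H (bas (u, p)) (\<lambda>a1 a2. fscale (reass H a1 (vertex h) (vertex (inv h))) (prd H (prd H a2 (vertex h)) (vertex (inv h))))"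
    using quasi_assoc[OF c] h by (simp add: sw2_vertex[OF vs] prd_vertex)
  also have "sw2 fscale H (bas (u, p)) (\<lambda>a1 a2. fscale (reass H a2 (vertex h) (vertex (inv h))) (prd H a1 (vertex \<one>))) =
     fscale (reass H (bas (u, take 0 p)) (vertex h) (vertex (inv h))) (prd H (bas (target G u (take 0 p), drop 0 p)) (vertex \<one>))"
    unfolding sw2_bas[OF vs up]
  proof (rule sum_single)
    fix i assume "i \<in> {..length p}" "i \<noteq> 0"
    then have "take i p \<noteq> []" by auto
    thus "fscale (reass H (bas (u, take i p)) (vertex h) (vertex (inv h)))
        (prd H (bas (target G u (take i p), drop i p)) (vertex \<one>)) = 0"
      by (simp add: r0[OF path_cut(1)[OF up]])
  qed auto
  also have "\<dots> = fscale (\<Phi> u h (inv h)) (bas (u, p))"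
    using path_start[OF up] h unt_right[OF c(1)] by (simp add: reass_vertex unt_vertex flip: vertex_def)
  also have "sw2 fscale H (bas (u, p)) (\<lambda>a1 a2. fscale (reass H a1 (vertex h) (vertex (inv h))) (prd H (prd H a2 (vertex h)) (vertex (inv h)))) =
     fscale (reass H (bas (target G u (take (length p) p), drop (length p) p)) (vertex h) (vertex (inv h)))
       (prd H (prd H (bas (u, take (length p) p)) (vertex h)) (vertex (inv h)))"
    unfolding sw2_bas[OF vs up]
    by (rule sum_single) (auto simp: r0[OF path_cut(2)[OF up]])
  also have "\<dots> = fscale (\<Phi> (target G u p) h (inv h)) (prd H (prd H (bas (u, p)) (vertex h)) (vertex (inv h)))"
    using path_target[OF up] h by (simp add: reass_vertex flip: vertex_def)
  finally have "fscale (1 / \<Phi> (target G u p) h (inv h)) (fscale (\<Phi> u h (inv h)) (bas (u, p))) =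
      fscale (1 / \<Phi> (target G u p) h (inv h)) (fscale (\<Phi> (target G u p) h (inv h)) (prd H (prd H (bas (u, p)) (vertex h)) (vertex (inv h))))"
    by simp
  thus ?thesis using nz by simp
qed

text \<open>On \<open>H(M)\<close> the form \<open>\<alpha>\<close> coincides with the counit, so the antipode axiom reads
  \<open>S(a\<^sub>1) a\<^sub>2 = \<epsilon>(a) 1\<close>.\<close>

lemma antip_prd_sum:
  assumes a: "a \<in> car H" and a0: "alph H a = 0"
  shows "sw2 fscale H a (\<lambda>a1 b. prd H (antip H a1) b) = 0"
proof -
  note vs = free.vector_space_axioms
  have inner: "sw2 fscale H (bas (u, p)) (\<lambda>a2 a3. fscale (alph H a2) (prd H c a3)) = prd H c (bas (u, p))"
    if up: "(u, p) \<in> paths Q" for u p c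
  proof -
    have "sw2 fscale H (bas (u, p)) (\<lambda>a2 a3. fscale (alph H a2) (prd H c a3)) =
      fscale (alph H (bas (target G u (take (length p) p), drop (length p) p))) (prd H c (bas (u, take (length p) p)))"
      unfolding sw2_bas[OF vs up]
    proof (rule sum_single)
      fix i assume "i \<in> {..length p}" "i \<noteq> length p"
      then have "alph H (bas (target G u (take i p), drop i p)) = 0"
        using gr_alph[OF bas_degree[OF path_cut(2)[OF up, of i]]] by simp
      thus "fscale (alph H (bas (target G u (take i p), drop i p))) (prd H c (bas (u, take i p))) = 0" by simp
    qed auto
    thus ?thesis using alph_vertex[OF path_target[OF up]] by (simp add: vertex_def)
  qed
  have "sw2 fscale H a (\<lambda>a1 b. prd H (antip H a1) b) =
      sw3 fscale H a (\<lambda>a1 a2 a3. fscale (alph H a2) (prd H (antip H a1) a3))"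
    unfolding sw3_def
  proof (rule linear_eq_on_bas[OF linear_sw2[OF vs comul_linear] linear_sw2[OF vs comul_linear]])
    fix x assume "x \<in> keys a"
    then have "x \<in> paths Q" using a by (auto simp: car_path)
    moreover obtain u p where up: "x = (u, p)" by fastforce
    ultimately have up': "(u, p) \<in> paths Q" by simp
    show "sw2 fscale H (bas x) (\<lambda>a1 b. prd H (antip H a1) b) =
        sw2 fscale H (bas x) (\<lambda>a1 b. sw2 fscale H b (\<lambda>a2 a3. fscale (alph H a2) (prd H (antip H a1) a3)))"
      unfolding up sw2_bas[OF vs up'] using path_cut(1)[OF up'] by (simp add: inner)
  qed
  thus ?thesis using antip_alph[OF a] a0 by simp
qed

text \<open>The antipode axiom expresses \<open>S(a) h\<close>, for \<open>a\<close> of degree \<open>n > 0\<close> starting at \<open>h\<close>, through products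
  \<open>S(a\<^sub>1) a\<^sub>2\<close> with \<open>a\<^sub>1\<close> of degree less than \<open>n\<close>.  By induction on \<open>n\<close>,
  the subalgebra generated by vertices and arrows is stable under the antipode.\<close>

lemma gen_antip_degree:
  assumes nz: "\<And>e f g. e \<in> carrier G \<Longrightarrow> f \<in> carrier G \<Longrightarrow> g \<in> carrier G \<Longrightarrow> \<Phi> e f g \<noteq> 0"
  shows "a \<in> gen \<Longrightarrow> a \<in> path_degree Q n \<Longrightarrow> antip H a \<in> gen"
proof (induction n arbitrary: a rule: less_induct)
  case (less n)
  note vs = free.vector_space_axioms
  have gen_sub: "gen \<subseteq> car H" using gen_car by blast
  show ?case
  proof (cases "n = 0")
    case True
    then have a: "a \<in> path_degree Q 0" using less.prems by simp
    have "antip H (\<Sum>x\<in>keys a. fscale (coeff a x) (vertex (fst x))) =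
        (\<Sum>x\<in>keys a. fscale (coeff a x) (vertex (inv (fst x))))"
      using degree0_vertices(2)[OF a]
      by (simp add: lin_sum[OF antip_linear] lin_scale[OF antip_linear] antip_vertex)
    also have "\<dots> \<in> gen"
      using degree0_vertices(2)[OF a]
      by (intro free.subspace_sum[OF gen_subspace] gen.scale vertex_gen) auto
    finally show ?thesis using degree0_vertices(1)[OF a] by simp
  next
    case False
    have one: "antip H b \<in> gen"
      if b: "b \<in> gen" "b \<in> path_degree Q n" and bh: "\<And>x. x \<in> keys b \<Longrightarrow> fst x = h"
        and h: "h \<in> carrier G" for b h
    proof -
      have bc: "b \<in> car H" using gen_car b(1) .
      let ?lo = "\<lambda>u. \<Sum>j<n. deg_part j u"
      (* Split off the summand of the coproduct in which the left factor has full degree n. *)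
      have "sw2 fscale H b (\<lambda>a1 c. prd H (antip H a1) c) =
          prd H (antip H b) (vertex h) + sw2 fscale H b (\<lambda>a1 c. prd H (antip H (?lo a1)) c)"
      proof (rule linear_eq_on_bas[where s = fscale and
            f = "\<lambda>b. sw2 fscale H b (\<lambda>a1 c. prd H (antip H a1) c)" and
            g = "\<lambda>b. prd H (antip H b) (vertex h) + sw2 fscale H b (\<lambda>a1 c. prd H (antip H (?lo a1)) c)"])
        show "lin fscale fscale (\<lambda>b. sw2 fscale H b (\<lambda>a1 c. prd H (antip H a1) c))"
          by (rule linear_sw2[OF vs comul_linear])
        show "lin fscale fscale (\<lambda>b. prd H (antip H b) (vertex h) +
            sw2 fscale H b (\<lambda>a1 c. prd H (antip H (?lo a1)) c))"
          by (intro lin_plus linear_comp[OF linear_prd1 antip_linear] linear_sw2[OF vs comul_linear])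
        fix x assume x: "x \<in> keys b"
        obtain p where up: "x = (h, p)" using bh[OF x] by (cases x) auto
        have xp: "(h, p) \<in> paths Q" and n: "length p = n"
          using b(2) x unfolding path_degree_iff up by (auto simp: in_keys_iff)
        have lo: "?lo (bas (w, q)) = (if length q < n then bas (w, q) else 0)" for w q
          by (simp add: deg_part_bas)
        have "(\<Sum>i\<le>length p. prd H (antip H (bas (target G h (take i p), drop i p))) (bas (h, take i p))) =
          (\<Sum>i\<le>length p. (if i = 0 then prd H (antip H (bas (h, p))) (vertex h) else 0) +
             prd H (antip H (?lo (bas (target G h (take i p), drop i p)))) (bas (h, take i p)))"
          using False n by (intro sum.cong refl)
            (auto simp: lo vertex_def lin_zero[OF antip_linear] lin_zero[OF linear_prd1])
        also have "\<dots> = prd H (antip H (bas (h, p))) (vertex h) +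
            (\<Sum>i\<le>length p. prd H (antip H (?lo (bas (target G h (take i p), drop i p)))) (bas (h, take i p)))"
          by (simp add: sum.distrib)
        finally show "sw2 fscale H (bas x) (\<lambda>a1 c. prd H (antip H a1) c) =
            prd H (antip H (bas x)) (vertex h) + sw2 fscale H (bas x) (\<lambda>a1 c. prd H (antip H (?lo a1)) c)"
          unfolding up sw2_bas[OF vs xp] .
      qed
      then have "prd H (antip H b) (vertex h) = - sw2 fscale H b (\<lambda>a1 c. prd H (antip H (?lo a1)) c)"
        using antip_prd_sum[OF bc] gr_alph[OF b(2)] False by (simp add: eq_neg_iff_add_eq_0)
      also have "\<dots> \<in> gen"
      proof (rule free.subspace_neg[OF gen_subspace], rule sw2_closed[OF _ gen_comul[OF b(1)] gen_subspace])
        show "bilin fscale (\<lambda>a1 c. prd H (antip H (?lo a1)) c)"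
          by (intro bilinI linear_prd2 linear_comp[OF linear_prd1] linear_comp[OF antip_linear] linear_setsum linear_deg_part vs)
        fix u v assume uv: "u \<in> gen" "v \<in> gen"
        have "antip H (deg_part j u) \<in> gen" if "j < n" for j
          using less.IH[OF that gen_deg_part[OF uv(1)] deg_part_car[OF gen_car[OF uv(1)]]] .
        then have "antip H (?lo u) \<in> gen"
          unfolding lin_sum[OF antip_linear] by (intro free.subspace_sum[OF gen_subspace]) simp
        thus "prd H (antip H (?lo u)) v \<in> gen" using uv(2) by (rule gen.prd)
      qed
      finally have y: "prd H (antip H b) (vertex h) \<in> gen" .
      have yh: "prd H (prd H (antip H b) (vertex h)) (vertex (inv h)) \<in> gen" (is "?z \<in> gen")
        using h by (intro gen.prd[OF y] vertex_gen) simp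
      have yc: "antip H b \<in> car H" using antip_closed[OF bc] .
      (* The scalar that undoes the multiplication by h varies with the end points. *)
      define e where "e x = (fst x, target G (fst x) (snd x))" for x :: "'a path"
      have part: "restr (\<lambda>x. e x = (s, t)) (antip H b) \<in> gen"
        if st: "s \<in> carrier G" "t \<in> carrier G" for s t
      proof -
        let ?d = "\<Phi> s h (inv h) / \<Phi> t h (inv h)"
        have "restr (ends s t) ?z = fscale ?d (restr (ends s t) (antip H b))"
        proof (rule linear_eq_on_bas[where s = fscale and f = "\<lambda>y. restr (ends s t) (prd H (prd H y (vertex h)) (vertex (inv h)))"])
          show "lin fscale fscale (\<lambda>y. restr (ends s t) (prd H (prd H y (vertex h)) (vertex (inv h))))"
            by (rule linear_comp[OF linear_restr linear_comp[OF linear_prd1 linear_prd1]])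
          show "lin fscale fscale (\<lambda>y. fscale ?d (restr (ends s t) y))"
            by (intro lin_intros)
          fix x assume "x \<in> keys (antip H b)"
          then have x: "(fst x, snd x) \<in> paths Q" using yc by (auto simp: car_path)
          have "\<Phi> (target G (fst x) (snd x)) h (inv h) \<noteq> 0" using nz path_target[OF x] h by simp
          from prd_vertex_vertex_inv[OF x h this]
          show "restr (ends s t) (prd H (prd H (bas x) (vertex h)) (vertex (inv h))) = fscale ?d (restr (ends s t) (bas x))"
            by (auto simp: lin_scale[OF linear_restr] ends_def)
        qed
        moreover have "restr (ends s t) ?z \<in> gen"
          by (rule restr_ends[OF gen_sub gen_subspace gen_comul yh])
        ultimately have "fscale (1 / ?d) (fscale ?d (restr (ends s t) (antip H b))) \<in> gen"
          using gen.scale by metis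
        moreover have "(1 / ?d) * ?d = 1" using nz st h by simp
        ultimately have "restr (ends s t) (antip H b) \<in> gen" by simp
        moreover have "ends s t = (\<lambda>x. e x = (s, t))" by (auto simp: fun_eq_iff ends_def e_def)
        ultimately show ?thesis by simp
      qed
      have "(\<Sum>st\<in>e ` keys (antip H b). restr (\<lambda>x. e x = st) (antip H b)) \<in> gen"
      proof (rule free.subspace_sum[OF gen_subspace])
        fix st assume "st \<in> e ` keys (antip H b)"
        then obtain x where x: "st = e x" "x \<in> keys (antip H b)" by blast
        then have "(fst x, snd x) \<in> paths Q" using yc by (auto simp: car_path)
        from path_start[OF this] path_target[OF this] part
        show "restr (\<lambda>x. e x = st) (antip H b) \<in> gen" unfolding x(1) e_def by blast
      qed
      thus ?thesis unfolding split_restr[of "antip H b" e, symmetric] .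
    qed
    have ac: "a \<in> car H" using less.prems gen_car by blast
    have "(\<Sum>h\<in>fst ` keys a. antip H (restr (\<lambda>x. fst x = h) a)) \<in> gen"
    proof (rule free.subspace_sum[OF gen_subspace])
      fix h assume "h \<in> fst ` keys a"
      then obtain x where "x \<in> keys a" "h = fst x" by blast
      then have h: "h \<in> carrier G" using ac path_start[of "fst x" "snd x" R] by (auto simp: car_path)
      show "antip H (restr (\<lambda>x. fst x = h) a) \<in> gen"
      proof (rule one[OF _ _ _ h])
        show "restr (\<lambda>x. fst x = h) a \<in> gen"
          using restr_source[OF gen_sub gen_subspace gen_comul] less.prems(1) by blast
        show "restr (\<lambda>x. fst x = h) a \<in> path_degree Q n"
          using less.prems(2) unfolding path_degree_iff by (metis lookup_restr)
      qed (simp add: in_keys_iff split: if_splits)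
    qed
    also have "(\<Sum>h\<in>fst ` keys a. antip H (restr (\<lambda>x. fst x = h) a)) = antip H a"
      unfolding lin_sum[OF antip_linear, symmetric] by (rule arg_cong[OF split_restr[symmetric]])
    finally show ?thesis .
  qed
qed

lemma sub_majid_gen:
  assumes nz: "\<And>e f g. e \<in> carrier G \<Longrightarrow> f \<in> carrier G \<Longrightarrow> g \<in> carrier G \<Longrightarrow> \<Phi> e f g \<noteq> 0"
  shows "sub_majid H gen"
proof -
  have "antip H a \<in> gen" if a: "a \<in> gen" for a
  proof -
    have eq: "restr (\<lambda>x. length (snd x) = n) a = deg_part n a" for n by (simp add: deg_part_def)
    have "a = (\<Sum>n\<in>(\<lambda>x. length (snd x)) ` keys a. deg_part n a)"
      using split_restr[of a "\<lambda>x. length (snd x)"] unfolding eq .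
    from arg_cong[OF this, of "antip H"]
    have "antip H a = (\<Sum>n\<in>(\<lambda>x. length (snd x)) ` keys a. antip H (deg_part n a))"
      unfolding lin_sum[OF antip_linear] .
    also have "\<dots> \<in> gen"
      using gen_antip_degree[OF nz gen_deg_part[OF a] deg_part_car[OF gen_car[OF a]]]
      by (intro free.subspace_sum[OF gen_subspace]) blast
    finally show ?thesis .
  qed
  thus ?thesis
    unfolding sub_majid_def using gen_car gen_subspace gen_comul gen.prd vertex_gen[OF one_closed]
    by (auto simp: unt_vertex)
qed

lemma gen_eq_Inter:
  assumes nz: "\<And>e f g. e \<in> carrier G \<Longrightarrow> f \<in> carrier G \<Longrightarrow> g \<in> carrier G \<Longrightarrow> \<Phi> e f g \<noteq> 0"
  shows "\<Inter>{W. sub_majid H W \<and> vertex ` carrier G \<subseteq> W \<and> path_degree Q 1 \<subseteq> W} = gen"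
proof (intro equalityI subsetI)
  fix a assume "a \<in> \<Inter>{W. sub_majid H W \<and> vertex ` carrier G \<subseteq> W \<and> path_degree Q 1 \<subseteq> W}"
  moreover have "vertex ` carrier G \<subseteq> gen" "path_degree Q 1 \<subseteq> gen"
    using vertex_gen degree1_gen by blast+
  ultimately show "a \<in> gen" using sub_majid_gen[OF nz] by blast
next
  fix a assume a: "a \<in> gen"
  have "a \<in> W" if W: "sub_majid H W" "vertex ` carrier G \<subseteq> W" "path_degree Q 1 \<subseteq> W" for W
    using a
  proof (induction rule: gen.induct)
    case (bas x)
    obtain u p where x: "x = (u, p)" by fastforce
    show ?case
    proof (cases p)
      case Nil
      then have "u \<in> carrier G" using bas x by simp
      then have "vertex u \<in> W" using W(2) by blast
      then show ?thesis by (simp add: x Nil vertex_def)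
    next
      case (Cons a q)
      then have "bas x \<in> path_degree Q 1" using bas bas_degree[of u p] by (simp add: x)
      then show ?thesis using W(3) by blast
    qed
  qed (use W(1) in \<open>auto simp: sub_majid_def free.subspace_0 free.subspace_add free.subspace_scale\<close>)
  thus "a \<in> \<Inter>{W. sub_majid H W \<and> vertex ` carrier G \<subseteq> W \<and> path_degree Q 1 \<subseteq> W}" by blast
qed

end

section \<open>Extending maps of arrows to paths\<close>

text \<open>The entries of the tensor powers of the matrix \<open>c\<close>.\<close>

fun path_coeff :: "('a \<Rightarrow> 'a \<Rightarrow> 'k::field) \<Rightarrow> 'a list \<Rightarrow> 'a list \<Rightarrow> 'k" where
  "path_coeff c [] [] = 1"
| "path_coeff c (a # p) (b # q) = c a b * path_coeff c p q"
| "path_coeff c _ _ = 0"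

lemma path_coeff_Nil_iff [simp]: "path_coeff c [] q = (if q = [] then 1 else 0)" "path_coeff c p [] = (if p = [] then 1 else 0)"
  by (cases q; simp) (cases p; simp)

lemma path_coeff_length: "path_coeff c p q \<noteq> 0 \<Longrightarrow> length q = length p"
  by (induction c p q rule: path_coeff.induct) auto

lemma path_coeff_append: "path_coeff c p (q @ q') = path_coeff c (take (length q) p) q * path_coeff c (drop (length q) p) q'"
proof (induction q arbitrary: p)
  case (Cons b q)
  then show ?case by (cases p) auto
qed simp

lemma path_coeff_finite:
  assumes "\<And>a. finite {b. c a b \<noteq> 0}"
  shows "finite {q. path_coeff c p q \<noteq> 0}"
proof (induction p)
  case Nil
  have "{q. path_coeff c [] q \<noteq> 0} \<subseteq> {[]}" by auto
  then show ?case using finite_subset by blast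
next
  case (Cons a p)
  have "{q. path_coeff c (a # p) q \<noteq> 0} \<subseteq> (\<lambda>(b, q). b # q) ` ({b. c a b \<noteq> 0} \<times> {q. path_coeff c p q \<noteq> 0})"
  proof
    fix q assume "q \<in> {q. path_coeff c (a # p) q \<noteq> 0}"
    then show "q \<in> (\<lambda>(b, q). b # q) ` ({b. c a b \<noteq> 0} \<times> {q. path_coeff c p q \<noteq> 0})"
      by (cases q) (auto simp: image_iff)
  qed
  then show ?case by (rule finite_subset) (intro finite_imageI finite_cartesian_product Cons assms)
qed

definition path_map :: "('g arrow \<Rightarrow> 'g arrow \<Rightarrow> 'k::field) \<Rightarrow> ('g path \<Rightarrow>\<^sub>0 'k) \<Rightarrow> ('g path \<Rightarrow>\<^sub>0 'k)" where
  "path_map c = lext fscale (\<lambda>(u, p). Abs_poly_mapping (\<lambda>(v, q). if v = u then path_coeff c p q else 0))"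

lemma linear_path_map: "lin fscale fscale (path_map c)"
  unfolding path_map_def by (intro lin_intros free.vector_space_axioms)

lemma lookup_path_map_bas:
  assumes "\<And>a. finite {b. c a b \<noteq> 0}"
  shows "coeff (path_map c (bas (u, p))) (v, q) = (if v = u then path_coeff c p q else 0)"
proof -
  have "{x. (\<lambda>(v, q). if v = u then path_coeff c p q else 0) x \<noteq> 0} \<subseteq> Pair u ` {q. path_coeff c p q \<noteq> 0}"
    by (auto split: if_splits)
  then have "finite {x. (\<lambda>(v, q). if v = u then path_coeff c p q else 0) x \<noteq> 0}"
    by (rule finite_subset) (intro finite_imageI path_coeff_finite assms)
  thus ?thesis
    by (simp add: path_map_def free.vector_space_axioms lookup_Abs_poly_mapping)
qed

locale arrow_map = group G for G (structure) +
  fixes R R' :: "'a set \<Rightarrow> nat" and c :: "'a arrow \<Rightarrow> 'a arrow \<Rightarrow> 'k::field"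
  assumes fin: "finite {b. c a b \<noteq> 0}"
    and arcs: "a \<in> arcs (hopf_quiver G R) \<Longrightarrow> c a b \<noteq> 0 \<Longrightarrow>
      b \<in> arcs (hopf_quiver G R') \<and> fst b = fst a \<and> fst (snd b) \<otimes> fst b = fst (snd a) \<otimes> fst a"
begin

lemmas lookup_pm = lookup_path_map_bas[of c, OF fin]

lemma path_coeff_paths:
  "(u, p) \<in> paths (hopf_quiver G R) \<Longrightarrow> path_coeff c p q \<noteq> 0 \<Longrightarrow>
    (u, q) \<in> paths (hopf_quiver G R') \<and> target G u q = target G u p"
proof (induction p arbitrary: u q)
  case (Cons a p)
  then obtain b q' where q: "q = b # q'" "c a b \<noteq> 0" "path_coeff c p q' \<noteq> 0" by (cases q) auto
  then show ?case using Cons arcs[of a b] by auto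
qed (auto split: if_splits)

lemma path_map_degree:
  assumes "(u, p) \<in> paths (hopf_quiver G R)"
  shows "path_map c (bas (u, p)) \<in> path_degree (hopf_quiver G R') (length p)"
  unfolding path_degree_iff
proof (intro allI impI)
  fix x assume *: "coeff (path_map c (bas (u, p))) x \<noteq> 0"
  obtain v q where x: "x = (v, q)" by fastforce
  from * have "v = u" "path_coeff c p q \<noteq> 0" by (auto simp: x lookup_pm split: if_splits)
  thus "x \<in> paths (hopf_quiver G R') \<and> length (snd x) = length p"
    using path_coeff_paths[OF assms] path_coeff_length x by auto
qed

lemma path_map_vertex: "path_map c (vertex u) = vertex u"
  by (rule poly_mapping_eqI) (auto simp: vertex_def lookup_pm lookup_bas split: if_splits)

text \<open>Matrix entries of tensor powers are multiplicative under concatenation, and at a given pair of paths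
  only the cut at the length of the second path contributes.\<close>

lemma path_map_comul_bas:
  assumes up: "(u, p) \<in> paths (hopf_quiver G R)"
  shows "path_comul (hopf_quiver G R') (path_map c (bas (u, p))) =
    (\<Sum>i\<le>length p. tens (path_map c (bas (target G u (take i p), drop i p))) (path_map c (bas (u, take i p))))"
proof (rule lookup_eqI)
  fix y x :: "'a path"
  obtain w q v q' where xy: "y = (w, q)" "x = (v, q')" by fastforce
  let ?f = "\<lambda>i. coeff (tens (path_map c (bas (target G u (take i p), drop i p))) (path_map c (bas (u, take i p)))) (y, x)"
  have f: "?f i = (if w = target G u (take i p) then path_coeff c (drop i p) q else 0) * (if v = u then path_coeff c (take i p) q' else 0)" for i
    by (simp add: xy lookup_pm)
  have lhs: "coeff (path_comul (hopf_quiver G R') (path_map c (bas (u, p)))) (y, x) =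
      (if w = target G v q' \<and> v = u then path_coeff c p (q' @ q) else 0)"
    by (simp add: xy lookup_path_comul lookup_pm)
  have "(\<Sum>i\<le>length p. ?f i) = (if w = target G v q' \<and> v = u then path_coeff c p (q' @ q) else 0)"
  proof (cases "length q' \<le> length p")
    case True
    have "(\<Sum>i\<le>length p. ?f i) = ?f (length q')"
    proof (rule sum_single)
      fix i assume i: "i \<in> {..length p}" "i \<noteq> length q'"
      have "path_coeff c (take i p) q' = 0"
        using path_coeff_length[of c "take i p" q'] i by auto
      thus "?f i = 0" unfolding f by simp
    qed (use True in auto)
    also have "\<dots> = (if w = target G v q' \<and> v = u then path_coeff c p (q' @ q) else 0)"
    proof (cases "v = u \<and> path_coeff c (take (length q') p) q' \<noteq> 0")
      case True
      then have "target G u q' = target G u (take (length q') p)"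
        using path_coeff_paths[OF path_cut(1)[OF up]] by blast
      then show ?thesis using True unfolding f path_coeff_append by auto
    next
      case False
      then show ?thesis unfolding f path_coeff_append by auto
    qed
    finally show ?thesis .
  next
    case False
    have "path_coeff c (take i p) q' = 0" if "i \<le> length p" for i
      using path_coeff_length[of c "take i p" q'] False that by auto
    then have "?f i = 0" if "i \<in> {..length p}" for i using that unfolding f by simp
    then have "(\<Sum>i\<le>length p. ?f i) = 0" by (intro sum.neutral ballI) blast
    moreover have "path_coeff c p (q' @ q) = 0" using path_coeff_length[of c p "q' @ q"] False by auto
    ultimately show ?thesis by (simp only: if_cancel)
  qed
  thus "coeff (path_comul (hopf_quiver G R') (path_map c (bas (u, p)))) (y, x) =
      coeff (\<Sum>i\<le>length p. tens (path_map c (bas (target G u (take i p), drop i p))) (path_map c (bas (u, take i p)))) (y, x)"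
    by (simp only: lhs lookup_sum)
qed

lemma bilin_tens_path_map: "bilin fscale (\<lambda>a b. tens (path_map c a) (path_map c b))"
  by (intro bilinI lin_intros linear_path_map)

lemma path_comul_path_map:
  assumes a: "keys a \<subseteq> paths (hopf_quiver G R)"
  shows "path_comul (hopf_quiver G R') (path_map c a) =
    lext fscale (\<lambda>(x, y). tens (path_map c (bas x)) (path_map c (bas y))) (path_comul (hopf_quiver G R) a)"
proof (rule linear_eq_on_bas[where f = "\<lambda>a. path_comul (hopf_quiver G R') (path_map c a)"])
  note vs = free.vector_space_axioms
  show "lin fscale fscale (\<lambda>a. path_comul (hopf_quiver G R') (path_map c a))"
    by (rule linear_comp[OF linear_path_comul linear_path_map])
  show "lin fscale fscale (\<lambda>a. lext fscale (\<lambda>(x, y). tens (path_map c (bas x)) (path_map c (bas y)))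
      (path_comul (hopf_quiver G R) a))"
    by (rule linear_comp[OF linear_lext[OF vs] linear_path_comul])
  fix x assume "x \<in> keys a"
  moreover obtain u p where x: "x = (u, p)" by fastforce
  ultimately have "(u, p) \<in> paths (hopf_quiver G R)" using a by blast
  from path_map_comul_bas[OF this]
  show "path_comul (hopf_quiver G R') (path_map c (bas x)) =
    lext fscale (\<lambda>(x, y). tens (path_map c (bas x)) (path_map c (bas y))) (path_comul (hopf_quiver G R) (bas x))"
    by (simp add: x path_comul_bas lin_sum[OF linear_lext[OF vs]] lext_tens[OF bilin_tens_path_map])
qed

lemma path_comul_path_map_sum:
  assumes "keys a \<subseteq> paths (hopf_quiver G R)"
    and "path_comul (hopf_quiver G R) a = (\<Sum>i\<in>I. tens (s i) (t i))"
  shows "path_comul (hopf_quiver G R') (path_map c a) = (\<Sum>i\<in>I. tens (path_map c (s i)) (path_map c (t i)))"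
  unfolding path_comul_path_map[OF assms(1)] assms(2)
  by (simp add: lin_sum[OF linear_lext[OF free.vector_space_axioms]] lext_tens[OF bilin_tens_path_map])

lemma path_map_keys:
  assumes "keys a \<subseteq> paths (hopf_quiver G R)"
  shows "keys (path_map c a) \<subseteq> paths (hopf_quiver G R')"
proof -
  have "path_map c a \<in> {a. \<forall>x. x \<notin> paths (hopf_quiver G R') \<longrightarrow> coeff a x = 0}"
  proof (rule linear_in_subspace[OF linear_path_map])
    show "free.subspace {a :: 'a path \<Rightarrow>\<^sub>0 'k. \<forall>x. x \<notin> paths (hopf_quiver G R') \<longrightarrow> coeff a x = 0}"
      by (rule free.subspaceI) (auto simp: lookup_add)
    fix x assume "x \<in> keys a"
    then have "(fst x, snd x) \<in> paths (hopf_quiver G R)" using assms by auto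
    from path_map_degree[OF this]
    show "path_map c (bas x) \<in> {a. \<forall>x. x \<notin> paths (hopf_quiver G R') \<longrightarrow> coeff a x = 0}"
      unfolding path_degree_iff by auto
  qed
  thus ?thesis by (auto simp: in_keys_iff)
qed

end

text \<open>A graded map into the path coalgebra that is compatible with coproducts is determined by its
  components of degree 0 and 1: the coefficient at a path of length \<open>n \<ge> 2\<close> is a coefficient of the
  coproduct in bidegree \<open>(n - 1, 1)\<close>.\<close>

lemma cofree_unique:
  fixes D1 D2 :: "'i \<Rightarrow> ('g path \<Rightarrow>\<^sub>0 'k::field)"
  assumes deg: "\<And>x. x \<in> X \<Longrightarrow> D1 x \<in> path_degree (hopf_quiver G R) (d x)"
      "\<And>x. x \<in> X \<Longrightarrow> D2 x \<in> path_degree (hopf_quiver G R) (d x)"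
    and comul: "\<And>x. x \<in> X \<Longrightarrow> path_comul (hopf_quiver G R) (D1 x) = (\<Sum>j\<in>J x. tens (D1 (l x j)) (D1 (r x j)))"
      "\<And>x. x \<in> X \<Longrightarrow> path_comul (hopf_quiver G R) (D2 x) = (\<Sum>j\<in>J x. tens (D2 (l x j)) (D2 (r x j)))"
    and closed: "\<And>x j. x \<in> X \<Longrightarrow> j \<in> J x \<Longrightarrow> l x j \<in> X \<and> r x j \<in> X \<and> d (l x j) + d (r x j) = d x"
    and base: "\<And>x. x \<in> X \<Longrightarrow> d x \<le> 1 \<Longrightarrow> D1 x = D2 x"
    and x: "x \<in> X"
  shows "D1 x = D2 x"
  using x
proof (induction "d x" arbitrary: x rule: less_induct)
  case less
  show ?case
  proof (cases "d x \<le> 1")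
    case False
    show ?thesis
    proof (rule poly_mapping_eqI)
      fix z :: "'g path" obtain v s where z: "z = (v, s)" by fastforce
      show "coeff (D1 x) z = coeff (D2 x) z"
      proof (cases "length s = d x")
        case False
        then have "coeff (D1 x) z = 0" "coeff (D2 x) z = 0"
          using deg[OF less.prems] unfolding path_degree_iff z by auto
        then show ?thesis by simp
      next
        case True
        with \<open>\<not> d x \<le> 1\<close> obtain a q where s: "s = [a] @ q" by (cases s) auto
        let ?z = "((target G v [a], q), (v, [a]))"
        have "coeff (D1 x) z = coeff (path_comul (hopf_quiver G R) (D1 x)) ?z"
          "coeff (D2 x) z = coeff (path_comul (hopf_quiver G R) (D2 x)) ?z"
          by (simp_all add: lookup_path_comul z s)
        moreover have "coeff (path_comul (hopf_quiver G R) (D1 x)) ?z = coeff (path_comul (hopf_quiver G R) (D2 x)) ?z"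
          unfolding comul[OF less.prems] lookup_sum
        proof (rule sum.cong[OF refl])
          fix j assume j: "j \<in> J x"
          note c = closed[OF less.prems j]
          show "coeff (tens (D1 (l x j)) (D1 (r x j))) ?z = coeff (tens (D2 (l x j)) (D2 (r x j))) ?z"
          proof (cases "d (r x j) = 1")
            case True
            then have "D1 (l x j) = D2 (l x j)" "D1 (r x j) = D2 (r x j)"
              using c \<open>\<not> d x \<le> 1\<close> by (auto intro!: less.hyps)
            then show ?thesis by simp
          next
            case False
            then have "coeff (D1 (r x j)) (v, [a]) = 0" "coeff (D2 (r x j)) (v, [a]) = 0"
              using deg[of "r x j"] c unfolding path_degree_iff by fastforce+
            then show ?thesis by simp
          qed
        qed
        ultimately show ?thesis by simp
      qed
    qed
  qed (use base less.prems in blast)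
qed

section \<open>Gauge forms concentrated in degree 0\<close>

text \<open>The extension by zero of a function on \<open>G \<times> G\<close> to positive degrees.\<close>

definition vertex_form :: "('g \<Rightarrow> 'g \<Rightarrow> 'k::field) \<Rightarrow> ('g path \<Rightarrow>\<^sub>0 'k) \<Rightarrow> ('g path \<Rightarrow>\<^sub>0 'k) \<Rightarrow> 'k" where
  "vertex_form F a b = lext (*) (\<lambda>x. lext (*) (\<lambda>y. if snd x = [] \<and> snd y = [] then F (fst x) (fst y) else 0) b) a"

lemma bilin_vertex_form: "bilin (*) (vertex_form F)"
proof (rule bilinI)
  note vs = free.vector_space_axioms vector_space_mult
  show "lin fscale (*) (vertex_form F a)" for a
    unfolding vertex_form_def lext_def[of _ _ a]
    by (intro linear_setsum lin_intros vs)
  show "lin fscale (*) (\<lambda>a. vertex_form F a b)" for b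
    unfolding vertex_form_def by (intro lin_intros vs)
qed

lemmas linear_vertex_form1 = bilinD(2)[OF bilin_vertex_form]
  and linear_vertex_form2 = bilinD(1)[OF bilin_vertex_form]

lemma vertex_form_bas: "vertex_form F (bas x) (bas y) = (if snd x = [] \<and> snd y = [] then F (fst x) (fst y) else 0)"
  by (simp add: vertex_form_def vector_space_mult)

lemma vertex_form_vertex [simp]: "vertex_form F (vertex g) (vertex h) = F g h"
  by (simp add: vertex_def vertex_form_bas)

lemma linear_vanish:
  assumes "lin fscale s f" "\<And>x. x \<in> keys a \<Longrightarrow> f (bas x) = 0"
  shows "f a = 0"
proof -
  interpret s: vector_space s using linear_vs2[OF assms(1)] .
  show ?thesis unfolding linear_expand[OF assms(1), of a] using assms(2) by simp
qed

lemma vertex_form_0: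
  assumes "\<And>x. x \<in> keys a \<Longrightarrow> snd x \<noteq> []"
  shows "vertex_form F a b = 0" "vertex_form F b a = 0"
proof -
  have "vertex_form F (bas x) b = 0 \<and> vertex_form F b (bas x) = 0" if "snd x \<noteq> []" for x
    using linear_vanish[OF linear_vertex_form2, of b F "bas x"] linear_vanish[OF linear_vertex_form1, of b F "bas x"] that
    by (simp add: vertex_form_bas)
  thus "vertex_form F a b = 0" "vertex_form F b a = 0"
    using linear_vanish[OF linear_vertex_form1, of a F b] linear_vanish[OF linear_vertex_form2, of a F b] assms
    by auto
qed

lemma vertex_form_degree:
  assumes "a \<in> path_degree Q n" "n > 0"
  shows "vertex_form F a b = 0" "vertex_form F b a = 0"
proof -
  have "snd x \<noteq> []" if "x \<in> keys a" for x
    using assms that by (auto simp: path_degree_def)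
  from vertex_form_0[OF this] show "vertex_form F a b = 0" "vertex_form F b a = 0" by blast+
qed

lemma vertex_form_arrow:
  assumes "q \<noteq> []"
  shows "vertex_form F (bas (w, q)) b = 0" "vertex_form F b (bas (w, q)) = 0"
  using assms vertex_form_0[of "bas (w, q)" F b] by simp_all

lemma sw2_const_0 [simp]:
  "sw2 (*) H a (\<lambda>_ _. 0 :: 'k::field) = 0" "sw2 fscale H a (\<lambda>_ _. 0 :: 'c \<Rightarrow>\<^sub>0 'k) = 0"
  by (auto simp: sw2_def intro!: sum.neutral)

lemma sw3_const_0 [simp]:
  "sw3 (*) H a (\<lambda>_ _ _. 0 :: 'k::field) = 0" "sw3 fscale H a (\<lambda>_ _ _. 0 :: 'c \<Rightarrow>\<^sub>0 'k) = 0"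
  by (simp_all add: sw3_def)

lemma sw4_const_0 [simp]: "sw4 (*) H a (\<lambda>_ _ _ _. 0 :: 'k::field) = 0"
  by (simp add: sw4_def)

lemma linear_sw3_arg:
  "(\<And>x y z. lin u s (\<lambda>w. f w x y z)) \<Longrightarrow> vector_space u \<Longrightarrow>
    lin u s (\<lambda>w. sw3 s H a (f w))"
  unfolding sw3_def by (intro linear_sw2_arg)

lemma linear_sw4_arg:
  "(\<And>x y z v. lin u s (\<lambda>w. f w x y z v)) \<Longrightarrow> vector_space u \<Longrightarrow>
    lin u s (\<lambda>w. sw4 s H a (f w))"
  unfolding sw4_def by (intro linear_sw2_arg linear_sw3_arg)

lemma linear_sw5_arg:
  "(\<And>x y z v v'. lin u s (\<lambda>w. f w x y z v v')) \<Longrightarrow> vector_space u \<Longrightarrow>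
    lin u s (\<lambda>w. sw5 s H a (f w))"
  unfolding sw5_def by (intro linear_sw2_arg linear_sw4_arg)

lemma if_zero: "(c \<Longrightarrow> x = 0) \<Longrightarrow> (if c then x else 0) = 0"
  by simp

context path_majid
begin

context
  fixes F :: "'a \<Rightarrow> 'a \<Rightarrow> 'k"
  assumes F: "gauge G F"
begin

abbreviation "FF \<equiv> vertex_form F"
abbreviation "FI \<equiv> vertex_form (\<lambda>g h. 1 / F g h)"

lemma F_nonzero: "g \<in> carrier G \<Longrightarrow> h \<in> carrier G \<Longrightarrow> F g h \<noteq> 0"
  using F by (simp add: gauge_def)

lemma convolution_vertex_form:
  assumes F': "\<And>g h. g \<in> carrier G \<Longrightarrow> h \<in> carrier G \<Longrightarrow> F1 g h * F2 g h = 1"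
    and a: "a \<in> car H" and b: "b \<in> car H"
  shows "sw2 (*) H a (\<lambda>a1 a2. sw2 (*) H b (\<lambda>b1 b2. vertex_form F1 a1 b1 * vertex_form F2 a2 b2)) = counit H a * counit H b"
proof -
  note vs = free.vector_space_axioms vector_space_mult
  let ?c = "\<lambda>a b. sw2 (*) H a (\<lambda>a1 a2. sw2 (*) H b (\<lambda>b1 b2. vertex_form F1 a1 b1 * vertex_form F2 a2 b2))"
  show ?thesis
  proof (rule bilin_eq_on_bas[where f = ?c and g = "\<lambda>a b. counit H a * counit H b"])
    show "bilin (*) ?c" by (intro bilinI linear_sw2_arg linear_sw2 vs comul_linear)
    show "bilin (*) (\<lambda>a b. counit H a * counit H b)" by (intro bilinI lin_intros counit_linear)
    fix x y assume "x \<in> keys a" "y \<in> keys b"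
    then have x: "(fst x, snd x) \<in> paths Q" and y: "(fst y, snd y) \<in> paths Q"
      using a b by (auto simp: car_path)
    show "?c (bas x) (bas y) = counit H (bas x) * counit H (bas y)"
    proof -
      have "sw2 (*) H (bas x) (\<lambda>a1 a2. sw2 (*) H (bas y) (\<lambda>b1 b2. vertex_form F1 a1 b1 * vertex_form F2 a2 b2)) =
        (if snd x = [] then sw2 (*) H (bas y) (\<lambda>b1 b2. vertex_form F1 (vertex (fst x)) b1 * vertex_form F2 (vertex (fst x)) b2) else 0)"
      proof (rule sw2_only_vertices[OF vs(2) x, unfolded prod.collapse])
        fix z w :: "'a path" assume "snd z \<noteq> [] \<or> snd w \<noteq> []"
        then have "vertex_form F1 (bas z) b1 * vertex_form F2 (bas w) b2 = 0" for b1 b2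
          using vertex_form_arrow(1)[of "snd z" _ "fst z"] vertex_form_arrow(1)[of "snd w" _ "fst w"] by auto
        then have "(\<lambda>b1 b2. vertex_form F1 (bas z) b1 * vertex_form F2 (bas w) b2) = (\<lambda>_ _. 0)"
          by (intro ext)
        then show "sw2 (*) H (bas y) (\<lambda>b1 b2. vertex_form F1 (bas z) b1 * vertex_form F2 (bas w) b2) = 0"
          by (simp only: sw2_const_0)
      qed
      moreover have "sw2 (*) H (bas y) (\<lambda>b1 b2. vertex_form F1 (vertex (fst x)) b1 * vertex_form F2 (vertex (fst x)) b2) =
        (if snd y = [] then vertex_form F1 (vertex (fst x)) (vertex (fst y)) * vertex_form F2 (vertex (fst x)) (vertex (fst y)) else 0)"
      proof (rule sw2_only_vertices[OF vs(2) y, unfolded prod.collapse])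
        fix z w :: "'a path" assume "snd z \<noteq> [] \<or> snd w \<noteq> []"
        then show "vertex_form F1 (vertex (fst x)) (bas z) * vertex_form F2 (vertex (fst x)) (bas w) = 0"
          using vertex_form_arrow(2)[of "snd z" _ _ "fst z"] vertex_form_arrow(2)[of "snd w" _ _ "fst w"] by auto
      qed
      ultimately show ?thesis
        using counit_bas[OF x] counit_bas[OF y] F' path_start[OF x] path_start[OF y] by simp
    qed
  qed
qed

lemma majid_gauge_vertex_form: "majid_gauge H FF FI"
proof -
  note vs = free.vector_space_axioms vector_space_mult
  have "FF h (vertex \<one>) = counit H h \<and> FF (vertex \<one>) h = counit H h" if h: "h \<in> car H" for h
  proof -
    have *: "FF (bas x) (vertex \<one>) = counit H (bas x) \<and> FF (vertex \<one>) (bas x) = counit H (bas x)"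
      if "x \<in> keys h" for x
    proof -
      have x: "(fst x, snd x) \<in> paths Q" using that h by (auto simp: car_path)
      show ?thesis using counit_bas[OF x] path_start[OF x] F
        by (simp add: vertex_def vertex_form_bas gauge_def)
    qed
    show ?thesis
      using linear_eq_on_bas[OF linear_vertex_form1[of F "vertex \<one>"] counit_linear, of h]
        linear_eq_on_bas[OF linear_vertex_form2[of F "vertex \<one>"] counit_linear, of h] * by blast
  qed
  thus ?thesis
    unfolding majid_gauge_def conv_inverse2_def
    by (auto simp: bilin_vertex_form unt_vertex F_nonzero intro!: convolution_vertex_form)
qed

text \<open>In the coproduct of a path the left outer factor is the target and the right outer factor is the
  source.  Therefore the twisted product of two paths is multiplied by \<open>F\<close> at the sources and by the
  inverse of \<open>F\<close> at the targets.\<close>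

definition twist_factor :: "'a path \<Rightarrow> 'a path \<Rightarrow> 'k" where
  "twist_factor x y = F (fst x) (fst y) / F (target G (fst x) (snd x)) (target G (fst y) (snd y))"

lemma prd_twist_bas:
  assumes x: "x \<in> paths Q" and y: "y \<in> paths Q"
  shows "prd (majid_twist H FF FI) (bas x) (bas y) = fscale (twist_factor x y) (prd H (bas x) (bas y))"
proof -
  note vs = free.vector_space_axioms vector_space_mult
  obtain u p v q where xy: "x = (u, p)" "y = (v, q)" by fastforce
  have "prd (majid_twist H FF FI) (bas x) (bas y) =
      sw3 fscale H (bas (u, p)) (\<lambda>g1 g2 g3. sw3 fscale H (bas (v, q)) (\<lambda>h1 h2 h3. fscale (FI g1 h1 * FF g3 h3) (prd H g2 h2)))"
    by (simp add: majid_twist_def xy)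
  also have "\<dots> = sw3 fscale H (bas (v, q)) (\<lambda>h1 h2 h3. fscale (FI (vertex (target G u p)) h1 * FF (vertex u) h3) (prd H (bas (u, p)) h2))"
    by (rule sw3_outer_vertices[OF vs(1) x[unfolded xy]]) (simp_all add: vertex_form_arrow)
  also have "\<dots> = fscale (FI (vertex (target G u p)) (vertex (target G v q)) * FF (vertex u) (vertex v)) (prd H (bas (u, p)) (bas (v, q)))"
    by (rule sw3_outer_vertices[OF vs(1) y[unfolded xy]]) (simp_all add: vertex_form_arrow)
  finally show ?thesis by (simp add: xy twist_factor_def)
qed

lemma bilin_prd_twist: "bilin fscale (prd (majid_twist H FF FI))"
proof (rule bilinI)
  note vs = free.vector_space_axioms vector_space_mult
  show "lin fscale fscale (prd (majid_twist H FF FI) a)" for a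
  proof -
    have "lin fscale fscale (\<lambda>h. sw3 fscale H a (\<lambda>g1 g2 g3. sw3 fscale H h (\<lambda>h1 h2 h3. fscale (FI g1 h1 * FF g3 h3) (prd H g2 h2))))"
      unfolding sw3_def by (intro linear_sw2_arg linear_sw2 vs comul_linear)
    thus ?thesis by (simp add: majid_twist_def)
  qed
  show "lin fscale fscale (\<lambda>a. prd (majid_twist H FF FI) a b)" for b
  proof -
    have "lin fscale fscale (\<lambda>g. sw3 fscale H g (\<lambda>g1 g2 g3. sw3 fscale H b (\<lambda>h1 h2 h3. fscale (FI g1 h1 * FF g3 h3) (prd H g2 h2))))"
      unfolding sw3_def by (intro linear_sw2 vs comul_linear)
    thus ?thesis by (simp add: majid_twist_def)
  qed
qed

lemma reass_twist_bas:
  assumes x: "x \<in> paths Q" and y: "y \<in> paths Q" and z: "z \<in> paths Q"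
  shows "reass (majid_twist H FF FI) (bas x) (bas y) (bas z) =
    (if snd x = [] \<and> snd y = [] \<and> snd z = [] then cocycle_twist G F \<Phi> (fst x) (fst y) (fst z) else 0)"
proof -
  note vs = free.vector_space_axioms vector_space_mult
  obtain u p v q w r where xyz: "x = (u, p)" "y = (v, q)" "z = (w, r)" by (metis surj_pair)
  note paths = x[unfolded xyz] y[unfolded xyz] z[unfolded xyz]
  (* A term of the twisted reassociator; it vanishes unless all its arguments are vertices. *)
  let ?T = "\<lambda>f1 f2 f3 f4 g1 g2 g3 g4 g5 h1 h2 h3 h4.
     FI g1 h1 * FI f1 (prd H g2 h2) * reass H f2 g3 h3 * FF (prd H f3 g4) h4 * FF f4 g5"
  have deg: "bas x \<in> path_degree Q (length (snd x))" if "x \<in> paths Q" for x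
    using bas_degree[of "fst x" "snd x"] that by simp
  have vf: "vertex_form F' (bas x) b = 0" "vertex_form F' b (bas x) = 0" if "snd x \<noteq> []" for x b F'
    using vertex_form_arrow[OF that, where w = "fst x"] by simp_all
  have van: "?T (bas f1) (bas f2) (bas f3) (bas f4) (bas g1) (bas g2) (bas g3) (bas g4) (bas g5) (bas h1) (bas h2) (bas h3) (bas h4) = 0"
    if P: "f1 \<in> paths Q" "f2 \<in> paths Q" "f3 \<in> paths Q" "f4 \<in> paths Q"
      "g1 \<in> paths Q" "g2 \<in> paths Q" "g3 \<in> paths Q" "g4 \<in> paths Q" "g5 \<in> paths Q"
      "h1 \<in> paths Q" "h2 \<in> paths Q" "h3 \<in> paths Q" "h4 \<in> paths Q"
    and ne: "\<exists>x\<in>{f1, f2, f3, f4, g1, g2, g3, g4, g5, h1, h2, h3, h4}. snd x \<noteq> []"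
    for f1 f2 f3 f4 g1 g2 g3 g4 g5 h1 h2 h3 h4
  proof -
    have "reass H (bas f2) (bas g3) (bas h3) = 0" if "snd f2 \<noteq> [] \<or> snd g3 \<noteq> [] \<or> snd h3 \<noteq> []"
      using gr_reass[OF deg[OF P(2)] deg[OF P(7)] deg[OF P(12)]] that by auto
    moreover have "FI (bas f1) (prd H (bas g2) (bas h2)) = 0" if "snd g2 \<noteq> [] \<or> snd h2 \<noteq> []"
      using vertex_form_degree(2)[OF gr_prd[OF deg[OF P(6)] deg[OF P(11)]]] that by auto
    moreover have "FF (prd H (bas f3) (bas g4)) (bas h4) = 0" if "snd f3 \<noteq> [] \<or> snd g4 \<noteq> []"
      using vertex_form_degree(1)[OF gr_prd[OF deg[OF P(3)] deg[OF P(8)]]] that by auto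
    ultimately show ?thesis using ne by (auto simp: vf)
  qed
  have start: "u \<in> carrier G" "v \<in> carrier G" "w \<in> carrier G" using paths path_start by blast+
  have vp: "(g, []) \<in> paths Q" if "g \<in> carrier G" for g using that by simp
  have inner: "sw4 (*) H (bas (w, r)) (?T (bas f1) (bas f2) (bas f3) (bas f4) (bas g1) (bas g2) (bas g3) (bas g4) (bas g5)) =
      (if r = [] then ?T (bas f1) (bas f2) (bas f3) (bas f4) (bas g1) (bas g2) (bas g3) (bas g4) (bas g5) (vertex w) (vertex w) (vertex w) (vertex w) else 0)"
    if "f1 \<in> paths Q" "f2 \<in> paths Q" "f3 \<in> paths Q" "f4 \<in> paths Q"
      "g1 \<in> paths Q" "g2 \<in> paths Q" "g3 \<in> paths Q" "g4 \<in> paths Q" "g5 \<in> paths Q"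
    for f1 f2 f3 f4 g1 g2 g3 g4 g5
    by (rule sw4_only_vertices[OF vs(2) paths(3)], rule van) (use that in auto)
  have mid: "sw5 (*) H (bas (v, q)) (\<lambda>g1 g2 g3 g4 g5. sw4 (*) H (bas (w, r)) (?T (bas f1) (bas f2) (bas f3) (bas f4) g1 g2 g3 g4 g5)) =
     (if q = [] \<and> r = [] then ?T (bas f1) (bas f2) (bas f3) (bas f4) (vertex v) (vertex v) (vertex v) (vertex v) (vertex v) (vertex w) (vertex w) (vertex w) (vertex w) else 0)"
    if f: "f1 \<in> paths Q" "f2 \<in> paths Q" "f3 \<in> paths Q" "f4 \<in> paths Q" for f1 f2 f3 f4
  proof -
    have "sw5 (*) H (bas (v, q)) (\<lambda>g1 g2 g3 g4 g5. sw4 (*) H (bas (w, r)) (?T (bas f1) (bas f2) (bas f3) (bas f4) g1 g2 g3 g4 g5)) =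
      (if q = [] then sw4 (*) H (bas (w, r)) (?T (bas f1) (bas f2) (bas f3) (bas f4) (vertex v) (vertex v) (vertex v) (vertex v) (vertex v)) else 0)"
    proof (rule sw5_only_vertices[OF vs(2) paths(2)])
      fix g1 g2 g3 g4 g5
      assume g: "g1 \<in> paths Q" "g2 \<in> paths Q" "g3 \<in> paths Q" "g4 \<in> paths Q" "g5 \<in> paths Q"
        "snd g1 \<noteq> [] \<or> snd g2 \<noteq> [] \<or> snd g3 \<noteq> [] \<or> snd g4 \<noteq> [] \<or> snd g5 \<noteq> []"
      have "r = [] \<Longrightarrow> ?T (bas f1) (bas f2) (bas f3) (bas f4) (bas g1) (bas g2) (bas g3) (bas g4) (bas g5) (vertex w) (vertex w) (vertex w) (vertex w) = 0"
        unfolding vertex_def by (rule van) (use f g start vp in auto)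
      then show "sw4 (*) H (bas (w, r)) (?T (bas f1) (bas f2) (bas f3) (bas f4) (bas g1) (bas g2) (bas g3) (bas g4) (bas g5)) = 0"
        by (rule trans[OF inner[OF f g(1-5)] if_zero])
    qed
    note this[unfolded inner[OF f vp vp vp vp vp, OF start(2) start(2) start(2) start(2) start(2), folded vertex_def]]
    thus ?thesis by (cases "q = []"; cases "r = []"; simp only: if_True if_False simp_thms)
  qed
  have "reass (majid_twist H FF FI) (bas x) (bas y) (bas z) =
    sw4 (*) H (bas (u, p)) (\<lambda>f1 f2 f3 f4. sw5 (*) H (bas (v, q)) (\<lambda>g1 g2 g3 g4 g5. sw4 (*) H (bas (w, r)) (?T f1 f2 f3 f4 g1 g2 g3 g4 g5)))"
    by (simp add: majid_twist_def xyz)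
  also have "\<dots> = (if p = [] then sw5 (*) H (bas (v, q)) (\<lambda>g1 g2 g3 g4 g5. sw4 (*) H (bas (w, r)) (?T (vertex u) (vertex u) (vertex u) (vertex u) g1 g2 g3 g4 g5)) else 0)"
  proof (rule sw4_only_vertices[OF vs(2) paths(1)])
    fix f1 f2 f3 f4
    assume f: "f1 \<in> paths Q" "f2 \<in> paths Q" "f3 \<in> paths Q" "f4 \<in> paths Q"
      "snd f1 \<noteq> [] \<or> snd f2 \<noteq> [] \<or> snd f3 \<noteq> [] \<or> snd f4 \<noteq> []"
    have "q = [] \<and> r = [] \<Longrightarrow> ?T (bas f1) (bas f2) (bas f3) (bas f4) (vertex v) (vertex v) (vertex v) (vertex v) (vertex v) (vertex w) (vertex w) (vertex w) (vertex w) = 0"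
      unfolding vertex_def by (rule van) (use f start vp in auto)
    then show "sw5 (*) H (bas (v, q)) (\<lambda>g1 g2 g3 g4 g5. sw4 (*) H (bas (w, r)) (?T (bas f1) (bas f2) (bas f3) (bas f4) g1 g2 g3 g4 g5)) = 0"
      by (rule trans[OF mid[OF f(1-4)] if_zero])
  qed
  also have "sw5 (*) H (bas (v, q)) (\<lambda>g1 g2 g3 g4 g5. sw4 (*) H (bas (w, r)) (?T (vertex u) (vertex u) (vertex u) (vertex u) g1 g2 g3 g4 g5)) =
    (if q = [] \<and> r = [] then cocycle_twist G F \<Phi> u v w else 0)"
  proof -
    have "?T (vertex u) (vertex u) (vertex u) (vertex u) (vertex v) (vertex v) (vertex v) (vertex v) (vertex v)
        (vertex w) (vertex w) (vertex w) (vertex w) = cocycle_twist G F \<Phi> u v w"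
      using start by (simp add: prd_vertex reass_vertex cocycle_twist_def mult_ac)
    with mid[OF vp vp vp vp, OF start(1) start(1) start(1) start(1), folded vertex_def] show ?thesis
      by (simp only:)
  qed
  finally show ?thesis by (simp add: xyz)
qed

lemma trilin_reass_twist:
  "lin fscale (*) (\<lambda>c. reass (majid_twist H FF FI) a b c)"
  "lin fscale (*) (\<lambda>b. reass (majid_twist H FF FI) a b c)"
  "lin fscale (*) (\<lambda>a. reass (majid_twist H FF FI) a b c)"
proof -
  note vs = free.vector_space_axioms vector_space_mult
  note l = linear_sw2[OF vs(2) comul_linear]
  have s: "lin fscale (*) (\<lambda>a. sw4 (*) H a f4)" "lin fscale (*) (\<lambda>a. sw5 (*) H a f5)" for f4 f5
    unfolding sw4_def sw5_def by (rule l)+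
  show "lin fscale (*) (\<lambda>c. reass (majid_twist H FF FI) a b c)"
    "lin fscale (*) (\<lambda>b. reass (majid_twist H FF FI) a b c)"
    "lin fscale (*) (\<lambda>a. reass (majid_twist H FF FI) a b c)"
    by (simp_all add: majid_twist_def) (intro linear_sw4_arg linear_sw5_arg s vs)+
qed

end

end

section \<open>Bimodules and collections\<close>

text \<open>On \<open>homog M (r C) \<one>\<close> and for \<open>f\<close> in the centralizer this is the action on the collection.\<close>

definition adj :: "('g, 'x) monoid_scheme \<Rightarrow> ('k, 'g, 'm::zero) bimod \<Rightarrow> 'g \<Rightarrow> 'm \<Rightarrow> 'm" where
  "adj G M f m = ract M (lact M f m) (inv\<^bsub>G\<^esub> f)"

text \<open>For \<open>n\<close> in \<open>homog M a \<one>\<close> this is an element of bidegree \<open>(x \<otimes> a \<otimes> inv x \<otimes> h, h)\<close>, and all elements of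
  that bidegree arise in this way.\<close>

definition transport :: "('g, 'x) monoid_scheme \<Rightarrow> ('k, 'g, 'm::zero) bimod \<Rightarrow> 'g \<Rightarrow> 'g \<Rightarrow> 'm \<Rightarrow> 'm" where
  "transport G M x h n = ract M (adj G M x n) h"

text \<open>The scalar by which \<open>f.(b.h)\<close> differs from \<open>((f.b).f\<inverse>).(f h)\<close> for \<open>b\<close> in \<open>homog M a \<one>\<close>.\<close>

definition slide :: "('g, 'x) monoid_scheme \<Rightarrow> ('g \<Rightarrow> 'g \<Rightarrow> 'g \<Rightarrow> 'k::field) \<Rightarrow> 'g \<Rightarrow> 'g \<Rightarrow> 'g \<Rightarrow> 'k" where
  "slide G \<Phi> f a h = \<Phi> f a h * \<Phi> (f \<otimes>\<^bsub>G\<^esub> a) (inv\<^bsub>G\<^esub> f) f /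
     (\<Phi> f (inv\<^bsub>G\<^esub> f) f * \<Phi> (f \<otimes>\<^bsub>G\<^esub> a \<otimes>\<^bsub>G\<^esub> inv\<^bsub>G\<^esub> f) f h)"

lemma bij_betw_inverse_upto:
  fixes s :: "'k::field \<Rightarrow> 'v::ab_group_add \<Rightarrow> 'v"
  assumes f: "lin s s f" and A: "module.subspace s A"
    and AB: "\<And>a. a \<in> A \<Longrightarrow> f a \<in> B" "\<And>b. b \<in> B \<Longrightarrow> g b \<in> A"
    and gf: "\<And>a. a \<in> A \<Longrightarrow> g (f a) = s c a" "c \<noteq> 0"
    and fg: "\<And>b. b \<in> B \<Longrightarrow> f (g b) = s d b" "d \<noteq> 0"
  shows "bij_betw f A B"
  unfolding bij_betw_def
proof
  interpret s: vector_space s using f linear_vs1 by blast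
  show "inj_on f A"
  proof (rule inj_onI)
    fix x y assume xy: "x \<in> A" "y \<in> A" "f x = f y"
    have "s c x = s c y" using gf(1)[OF xy(1)] gf(1)[OF xy(2)] xy(3) by metis
    thus "x = y" using gf(2) by simp
  qed
  have "b \<in> f ` A" if b: "b \<in> B" for b
  proof
    show "b = f (s (1 / d) (g b))" using fg b by (simp add: lin_scale[OF f])
    show "s (1 / d) (g b) \<in> A" using A AB(2)[OF b] s.subspace_scale by blast
  qed
  thus "f ` A = B" using AB(1) by blast
qed

context majid_bimodule
begin

interpretation m: vector_space "scl M" by (rule vector_space)

lemma adj_linear: "f \<in> carrier G \<Longrightarrow> lin (scl M) (scl M) (adj G M f)"
  unfolding adj_def by (rule linear_comp[OF ract_linear lact_linear]) simp_all

lemma transport_linear: "f \<in> carrier G \<Longrightarrow> h \<in> carrier G \<Longrightarrow>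
    lin (scl M) (scl M) (transport G M f h)"
  unfolding transport_def by (rule linear_comp[OF ract_linear adj_linear]) simp_all

lemma adj_homog:
  assumes "f \<in> carrier G" "a \<in> carrier G" "m \<in> homog M a \<one>"
  shows "adj G M f m \<in> homog M (f \<otimes> a \<otimes> inv f) \<one>"
  using ract_homog[OF _ _ _ lact_homog[OF assms(1,2) _ assms(3)], of "inv f"] assms by (simp add: adj_def)

lemma adj_one: "adj G M \<one> m = m"
  by (simp add: adj_def lact_one ract_one)

lemma cocycle_tilde_nonzero:
  "e \<in> carrier G \<Longrightarrow> f \<in> carrier G \<Longrightarrow> g \<in> carrier G \<Longrightarrow> cocycle_tilde G \<Phi> e f g \<noteq> 0"
  by (simp add: cocycle_tilde_def nonzero)

text \<open>Moving \<open>e\<close> past the right action of \<open>inv f\<close> and then collecting the left and the right actions yields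
  the five factors of \<open>cocycle_tilde\<close>.\<close>

lemma adj_adj:
  assumes [simp]: "e \<in> carrier G" "f \<in> carrier G" "a \<in> carrier G" and m: "m \<in> homog M a \<one>"
  shows "adj G M e (adj G M f m) = scl M (cocycle_tilde G \<Phi> e f a) (adj G M (e \<otimes> f) m)"
proof -
  let ?x = "lact M f m" and ?y = "lact M (e \<otimes> f) m"
  have x: "?x \<in> homog M (f \<otimes> a) f" using lact_homog[OF _ _ _ m, of f] by simp
  have y: "?y \<in> homog M (e \<otimes> f \<otimes> a) (e \<otimes> f)" using lact_homog[OF _ _ _ m, of "e \<otimes> f"] by simp
  have "lact M e (ract M ?x (inv f)) =
      scl M (\<Phi> e (f \<otimes> a) (inv f) / \<Phi> e f (inv f)) (ract M (lact M e ?x) (inv f))"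
    using lact_ract[OF _ _ _ _ x, of e "inv f"] by (simp add: nonzero)
  also have "lact M e ?x = scl M (\<Phi> e f a) ?y"
    using lact_lact[OF _ _ _ _ m, of e f] by (simp add: normalized)
  finally have "adj G M e (adj G M f m) =
      scl M (\<Phi> e (f \<otimes> a) (inv f) / \<Phi> e f (inv f) * \<Phi> e f a) (ract M (ract M ?y (inv f)) (inv e))"
    by (simp add: adj_def lin_scale[OF ract_linear])
  also have "ract M (ract M ?y (inv f)) (inv e) =
      scl M (\<Phi> (e \<otimes> f) (inv f) (inv e) / \<Phi> (e \<otimes> f \<otimes> a) (inv f) (inv e)) (adj G M (e \<otimes> f) m)"
    using ract_ract[OF _ _ _ _ y, of "inv f" "inv e"] by (simp add: adj_def inv_mult_group)
  finally show ?thesis by (simp add: cocycle_tilde_def mult_ac)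
qed

lemma ract_ract_inv:
  assumes [simp]: "f \<in> carrier G" "g \<in> carrier G" "h \<in> carrier G" and m: "m \<in> homog M g h"
  shows "ract M (ract M m f) (inv f) = scl M (\<Phi> h f (inv f) / \<Phi> g f (inv f)) m"
  using ract_ract[OF _ _ _ _ m, of f "inv f"] by (simp add: ract_one)

lemma ract_inv_ract:
  assumes [simp]: "f \<in> carrier G" "g \<in> carrier G" "h \<in> carrier G" and m: "m \<in> homog M g h"
  shows "ract M (ract M m (inv f)) f = scl M (\<Phi> h (inv f) f / \<Phi> g (inv f) f) m"
  using ract_ract[OF _ _ _ _ m, of "inv f" f] by (simp add: ract_one)

lemma conj_inv: "x \<in> carrier G \<Longrightarrow> a \<in> carrier G \<Longrightarrow> inv x \<otimes> (x \<otimes> a \<otimes> inv x) \<otimes> x = a"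
  by (simp add: m_assoc) (simp flip: m_assoc)

lemma adj_bij:
  assumes [simp]: "x \<in> carrier G" "a \<in> carrier G"
  shows "bij_betw (adj G M x) (homog M a \<one>) (homog M (x \<otimes> a \<otimes> inv x) \<one>)"
proof (rule bij_betw_inverse_upto[OF adj_linear homog_subspace])
  show "adj G M x m \<in> homog M (x \<otimes> a \<otimes> inv x) \<one>" if "m \<in> homog M a \<one>" for m
    using that by (simp add: adj_homog)
  show "adj G M (inv x) m \<in> homog M a \<one>" if "m \<in> homog M (x \<otimes> a \<otimes> inv x) \<one>" for m
    using adj_homog[OF _ _ that, of "inv x"] by (simp add: conj_inv)
  show "adj G M (inv x) (adj G M x m) = scl M (cocycle_tilde G \<Phi> (inv x) x a) m" if "m \<in> homog M a \<one>" for m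
    using adj_adj[OF _ _ _ that, of "inv x" x] by (simp add: adj_one)
  show "adj G M x (adj G M (inv x) m) = scl M (cocycle_tilde G \<Phi> x (inv x) (x \<otimes> a \<otimes> inv x)) m"
    if "m \<in> homog M (x \<otimes> a \<otimes> inv x) \<one>" for m
    using adj_adj[OF _ _ _ that, of x "inv x"] by (simp add: adj_one)
qed (simp_all add: cocycle_tilde_nonzero)

lemma ract_bij:
  assumes [simp]: "f \<in> carrier G" "g \<in> carrier G" "h \<in> carrier G"
  shows "bij_betw (\<lambda>m. ract M m f) (homog M g h) (homog M (g \<otimes> f) (h \<otimes> f))"
proof (rule bij_betw_inverse_upto[OF ract_linear homog_subspace])
  show "ract M m f \<in> homog M (g \<otimes> f) (h \<otimes> f)" if "m \<in> homog M g h" for m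
    using that by (simp add: ract_homog)
  show "ract M m (inv f) \<in> homog M g h" if "m \<in> homog M (g \<otimes> f) (h \<otimes> f)" for m
    using ract_homog[OF _ _ _ that, of "inv f"] by (simp add: m_assoc)
  show "ract M (ract M m f) (inv f) = scl M (\<Phi> h f (inv f) / \<Phi> g f (inv f)) m" if "m \<in> homog M g h" for m
    using that by (simp add: ract_ract_inv)
  show "ract M (ract M m (inv f)) f = scl M (\<Phi> (h \<otimes> f) (inv f) f / \<Phi> (g \<otimes> f) (inv f) f) m"
    if "m \<in> homog M (g \<otimes> f) (h \<otimes> f)" for m
    using that ract_inv_ract[of f "g \<otimes> f" "h \<otimes> f" m] by simp
qed (simp_all add: nonzero)

lemma transport_bij:
  assumes "x \<in> carrier G" "a \<in> carrier G" "h \<in> carrier G"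
  shows "bij_betw (transport G M x h) (homog M a \<one>) (homog M (x \<otimes> a \<otimes> inv x \<otimes> h) h)"
  using bij_betw_trans[OF adj_bij[OF assms(1,2)] ract_bij[of h "x \<otimes> a \<otimes> inv x" \<one>]] assms
  by (simp add: transport_def[abs_def] comp_def)

lemma lact_ract_slide:
  assumes [simp]: "f \<in> carrier G" "a \<in> carrier G" "h \<in> carrier G" and b: "b \<in> homog M a \<one>"
  shows "lact M f (ract M b h) = scl M (slide G \<Phi> f a h) (ract M (adj G M f b) (f \<otimes> h))"
proof -
  have fb: "lact M f b \<in> homog M (f \<otimes> a) f" using lact_homog[OF _ _ _ b, of f] by simp
  have "lact M f (ract M b h) = scl M (\<Phi> f a h) (ract M (lact M f b) h)"
    using lact_ract[OF _ _ _ _ b, of f h] by (simp add: nonzero normalized)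
  also have "lact M f b = scl M (\<Phi> (f \<otimes> a) (inv f) f / \<Phi> f (inv f) f) (ract M (adj G M f b) f)"
    using ract_inv_ract[OF _ _ _ fb] by (simp add: adj_def nonzero)
  also have "ract M (scl M (\<Phi> (f \<otimes> a) (inv f) f / \<Phi> f (inv f) f) (ract M (adj G M f b) f)) h =
     scl M (\<Phi> (f \<otimes> a) (inv f) f / \<Phi> f (inv f) f) (ract M (ract M (adj G M f b) f) h)"
    by (simp add: lin_scale[OF ract_linear])
  also have "ract M (ract M (adj G M f b) f) h =
      scl M (1 / \<Phi> (f \<otimes> a \<otimes> inv f) f h) (ract M (adj G M f b) (f \<otimes> h))"
    using ract_ract[OF _ _ _ _ adj_homog[OF _ _ b], of f h f] by (simp add: normalized)
  finally show ?thesis by (simp add: slide_def)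
qed

lemma lact_transport:
  assumes [simp]: "f \<in> carrier G" "x \<in> carrier G" "a \<in> carrier G" "h \<in> carrier G" and n: "n \<in> homog M a \<one>"
  shows "lact M f (transport G M x h n) =
    scl M (slide G \<Phi> f (x \<otimes> a \<otimes> inv x) h * cocycle_tilde G \<Phi> f x a) (transport G M (f \<otimes> x) (f \<otimes> h) n)"
  using lact_ract_slide[OF _ _ _ adj_homog[OF _ _ n], of f x h]
  by (simp add: transport_def adj_adj[OF _ _ _ n] lin_scale[OF ract_linear])

lemma ract_transport:
  assumes [simp]: "f \<in> carrier G" "x \<in> carrier G" "a \<in> carrier G" "h \<in> carrier G" and n: "n \<in> homog M a \<one>"
  shows "ract M (transport G M x h n) f = scl M (1 / \<Phi> (x \<otimes> a \<otimes> inv x) h f) (transport G M x (h \<otimes> f) n)"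
  using ract_ract[OF _ _ _ _ adj_homog[OF _ _ n], of h f x] by (simp add: transport_def normalized)

lemma transport_mult:
  assumes [simp]: "y \<in> carrier G" "z \<in> carrier G" "a \<in> carrier G" "h \<in> carrier G" and n: "n \<in> homog M a \<one>"
  shows "transport G M (y \<otimes> z) h n = scl M (1 / cocycle_tilde G \<Phi> y z a) (transport G M y h (adj G M z n))"
  by (simp add: transport_def adj_adj[OF _ _ _ n] lin_scale[OF ract_linear] cocycle_tilde_nonzero)

lemma adj_twist:
  assumes F: "gauge G F" and [simp]: "f \<in> carrier G" "a \<in> carrier G" and m: "m \<in> homog M a \<one>"
  shows "adj G (bimod_twist F M) f m =
    scl M (F f (inv f) / (F f a * F (f \<otimes> a) (inv f))) (adj G M f m)"
proof -
  have "lact M f m \<in> homog M (f \<otimes> a) f" using lact_homog[OF _ _ _ m, of f] by simp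
  moreover have "F f \<one> = 1" using F by (simp add: gauge_def)
  ultimately show ?thesis
    by (simp add: adj_def lact_twist[OF _ m] lin_scale[OF linear_ract_twist] ract_twist[of "inv f" _ "f \<otimes> a" f])
qed

end

lemma (in group) centralizer_of_closed:
  assumes "a \<in> carrier G" "e \<in> centralizer_of G a"
  shows "e \<in> carrier G" "e \<otimes> a \<otimes> inv e = a"
  using assms by (auto simp: centralizer_of_def m_assoc)

lemma bimod_collection_sel [simp]:
  "cscl (bimod_collection G r M) = scl M"
  "space (bimod_collection G r M) C = homog M (r C) \<one>\<^bsub>G\<^esub>"
  "act (bimod_collection G r M) C f m = adj G M f m"
  by (simp_all add: bimod_collection_def adj_def)

lemma collection_twist_sel [simp]:
  "cscl (collection_twist G r F X) = cscl X"
  "space (collection_twist G r F X) = space X"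
  "act (collection_twist G r F X) C f m = cscl X (gauge_mu G r F C f) (act X C f m)"
  by (simp_all add: collection_twist_def)

lemma is_collection_bimod_collection:
  assumes M: "majid_bimodule G \<Phi> M" and r: "\<And>C. C \<in> conj_classes G \<Longrightarrow> r C \<in> C"
  shows "is_collection G r \<Phi> (bimod_collection G r M)"
proof -
  interpret majid_bimodule G \<Phi> M by fact
  have rc: "r C \<in> carrier G" if "C \<in> conj_classes G" for C
    using r[OF that] that by (auto simp: conj_classes_def)
  show ?thesis
    unfolding is_collection_def
  proof (intro conjI ballI)
    fix C f assume C: "C \<in> conj_classes G" and f: "f \<in> centralizer_of G (r C)"
    note f' = centralizer_of_closed[OF rc[OF C] f]
    show "lin_on (cscl (bimod_collection G r M)) (cscl (bimod_collection G r M))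
        (space (bimod_collection G r M) C) (act (bimod_collection G r M) C f)"
      using lin_on_linear[OF adj_linear[OF f'(1)]] by (simp add: lin_on_def)
    show "bij_betw (act (bimod_collection G r M) C f) (space (bimod_collection G r M) C)
        (space (bimod_collection G r M) C)"
      using adj_bij[OF f'(1) rc[OF C]] f'(2) by (simp add: bij_betw_def inj_on_def image_def)
  next
    fix C e f v
    assume C: "C \<in> conj_classes G" and e: "e \<in> centralizer_of G (r C)" and f: "f \<in> centralizer_of G (r C)"
      and v: "v \<in> space (bimod_collection G r M) C"
    show "act (bimod_collection G r M) C e (act (bimod_collection G r M) C f v) =
        cscl (bimod_collection G r M) (cocycle_tilde G \<Phi> e f (r C)) (act (bimod_collection G r M) C (e \<otimes>\<^bsub>G\<^esub> f) v)"
      using adj_adj centralizer_of_closed(1)[OF rc[OF C]] e f v rc[OF C] by simp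
  qed (simp_all add: vector_space homog_subspace adj_one)
qed

text \<open>Every homogeneous element is the transport of an element of a chosen \<open>homog M (r C) \<one>\<close>,
  and the actions permute the transports up to scalars that depend only on the cocycle.  So an
  isomorphism of collections extends to the bimodules.\<close>

theorem collection_iso_imp_bimod_iso:
  fixes G :: "('g, 'x) monoid_scheme" (structure) and M :: "('k::field, 'g, 'm::ab_group_add) bimod"
    and N :: "('k, 'g, 'n::ab_group_add) bimod"
  assumes M: "majid_bimodule G \<Phi> M" and N: "majid_bimodule G \<Phi> N"
    and r: "\<And>C. C \<in> conj_classes G \<Longrightarrow> r C \<in> C"
    and iso: "\<And>C. C \<in> conj_classes G \<Longrightarrow> \<exists>\<phi>. rep_iso G r C \<phi> (bimod_collection G r M) (bimod_collection G r N)"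
  shows "\<exists>\<phi>. bimod_iso G \<phi> M N"
proof -
  interpret M: majid_bimodule G \<Phi> M by fact
  interpret N: majid_bimodule G \<Phi> N by fact
  obtain \<phi> where \<phi>: "\<And>C. C \<in> conj_classes G \<Longrightarrow> rep_iso G r C (\<phi> C) (bimod_collection G r M) (bimod_collection G r N)"
    using iso by metis
  define cl where "cl a = {x \<otimes> a \<otimes> inv x |x. x \<in> carrier G}" for a
  have cl: "cl a \<in> conj_classes G" if "a \<in> carrier G" for a
    using that by (auto simp: cl_def conj_classes_def)
  have cl_conj: "cl (f \<otimes> a \<otimes> inv f) = cl a" if "a \<in> carrier G" "f \<in> carrier G" for a f
  proof -
    have *: "x \<otimes> (f \<otimes> a \<otimes> inv f) \<otimes> inv x = (x \<otimes> f) \<otimes> a \<otimes> inv (x \<otimes> f)"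
      if "x \<in> carrier G" for x
      using that \<open>a \<in> carrier G\<close> \<open>f \<in> carrier G\<close> by (simp add: M.inv_mult_group M.m_assoc)
    show ?thesis
    proof (intro equalityI subsetI)
      fix y assume "y \<in> cl (f \<otimes> a \<otimes> inv f)"
      then obtain x where "x \<in> carrier G" "y = x \<otimes> (f \<otimes> a \<otimes> inv f) \<otimes> inv x"
        by (auto simp: cl_def)
      moreover have "x \<otimes> f \<in> carrier G" using \<open>x \<in> carrier G\<close> that by simp
      ultimately show "y \<in> cl a" unfolding cl_def using * by blast
    next
      fix y assume "y \<in> cl a"
      then obtain x where x: "x \<in> carrier G" "y = x \<otimes> a \<otimes> inv x"
        by (auto simp: cl_def)
      then have "y = (x \<otimes> inv f) \<otimes> (f \<otimes> a \<otimes> inv f) \<otimes> inv (x \<otimes> inv f)"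
        using *[of "x \<otimes> inv f"] that by (simp add: M.m_assoc)
      moreover have "x \<otimes> inv f \<in> carrier G" using x that by simp
      ultimately show "y \<in> cl (f \<otimes> a \<otimes> inv f)" unfolding cl_def by blast
    qed
  qed
  define \<rho> where "\<rho> a = r (cl a)" for a
  have \<rho>: "\<rho> a \<in> carrier G" and "\<exists>x\<in>carrier G. x \<otimes> \<rho> a \<otimes> inv x = a" if a: "a \<in> carrier G" for a
  proof -
    obtain x where x: "x \<in> carrier G" "\<rho> a = x \<otimes> a \<otimes> inv x"
      using r[OF cl[OF a]] unfolding \<rho>_def by (auto simp: cl_def)
    thus "\<rho> a \<in> carrier G" using a by simp
    have "inv x \<otimes> \<rho> a \<otimes> inv (inv x) = a" using M.conj_inv[OF x(1) a] x a by simp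
    thus "\<exists>x\<in>carrier G. x \<otimes> \<rho> a \<otimes> inv x = a" using M.inv_closed[OF x(1)] by blast
  qed
  then obtain X where X: "\<And>a. a \<in> carrier G \<Longrightarrow> X a \<in> carrier G"
      "\<And>a. a \<in> carrier G \<Longrightarrow> X a \<otimes> \<rho> a \<otimes> inv (X a) = a"
    by metis
  let ?S = "\<lambda>a. homog M (\<rho> a) \<one>" and ?S' = "\<lambda>a. homog N (\<rho> a) \<one>" and ?p = "\<lambda>a. \<phi> (cl a)"
  have p_lin: "lin_on (scl M) (scl N) (?S a) (?p a)" and p_bij: "bij_betw (?p a) (?S a) (?S' a)"
    and p_adj: "\<And>z n. z \<in> centralizer_of G (\<rho> a) \<Longrightarrow> n \<in> ?S a \<Longrightarrow> ?p a (adj G M z n) = adj G N z (?p a n)"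
    if "a \<in> carrier G" for a
    using \<phi>[OF cl[OF that]] by (auto simp: rep_iso_def \<rho>_def)
  have p_in: "?p a n \<in> ?S' a" if "a \<in> carrier G" "n \<in> ?S a" for a n
    using p_bij[OF that(1)] that(2) by (auto simp: bij_betw_def)
  define \<psi>0 where "\<psi>0 g h m = (let a = g \<otimes> inv h in
     transport G N (X a) h (?p a (inv_into (?S a) (transport G M (X a) h) m)))" for g h m
  define \<psi> where "\<psi> g h = (if g \<in> carrier G \<and> h \<in> carrier G then \<psi>0 g h else (\<lambda>_. 0))" for g h
  have T: "bij_betw (transport G M x h) (?S a) (homog M g h)" "bij_betw (transport G N x h) (?S' a) (homog N g h)"
    if "g \<in> carrier G" "h \<in> carrier G" "x \<in> carrier G" "a = g \<otimes> inv h" "x \<otimes> \<rho> a \<otimes> inv x = a" for g h x a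
  proof -
    have a: "a \<in> carrier G" using that by simp
    have "x \<otimes> \<rho> a \<otimes> inv x \<otimes> h = g" using that(1,2,4,5) by (simp add: M.m_assoc)
    thus "bij_betw (transport G M x h) (?S a) (homog M g h)" "bij_betw (transport G N x h) (?S' a) (homog N g h)"
      using M.transport_bij[OF that(3) \<rho>[OF a] that(2)] N.transport_bij[OF that(3) \<rho>[OF a] that(2)] by simp_all
  qed
  \<comment> \<open>The definition does not depend on the choice of the conjugating element.\<close>
  have key: "\<psi> g h (transport G M x h n) = transport G N x h (?p a n)"
    if gh: "g \<in> carrier G" "h \<in> carrier G" and x: "x \<in> carrier G" and a: "a = g \<otimes> inv h"
      and xa: "x \<otimes> \<rho> a \<otimes> inv x = a" and n: "n \<in> ?S a" for g h x a n
  proof -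
    have ac: "a \<in> carrier G" using gh a by simp
    note \<rho>a = \<rho>[OF ac] and Xa = X[OF ac]
    define z where "z = inv (X a) \<otimes> x"
    have zc: "z \<in> carrier G" and xz: "x = X a \<otimes> z"
      using x Xa(1) by (simp_all add: z_def flip: M.m_assoc)
    have "x \<otimes> \<rho> a = a \<otimes> x"
    proof -
      have "a \<otimes> x = x \<otimes> \<rho> a \<otimes> inv x \<otimes> x" using xa by simp
      thus ?thesis using x \<rho>a by (simp add: M.m_assoc)
    qed
    moreover have "inv (X a) \<otimes> a = \<rho> a \<otimes> inv (X a)"
    proof -
      have "inv (X a) \<otimes> a = inv (X a) \<otimes> (X a \<otimes> \<rho> a \<otimes> inv (X a))" using Xa(2) by simp
      also have "\<dots> = \<rho> a \<otimes> inv (X a)" using Xa(1) \<rho>a by (simp flip: M.m_assoc)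
      finally show ?thesis .
    qed
    ultimately have "z \<otimes> \<rho> a = \<rho> a \<otimes> z"
      using x Xa(1) \<rho>a ac unfolding z_def by (metis M.inv_closed M.m_assoc)
    then have z: "z \<in> centralizer_of G (\<rho> a)" using zc by (simp add: centralizer_of_def)
    have zn: "adj G M z n \<in> ?S a"
      using M.adj_homog[OF zc \<rho>a n] M.centralizer_of_closed(2)[OF \<rho>a z] by simp
    let ?c = "1 / cocycle_tilde G \<Phi> (X a) z (\<rho> a)"
    let ?n' = "scl M ?c (adj G M z n)"
    have n': "?n' \<in> ?S a" using zn by (rule M.homog_scale)
    have "transport G M x h n = transport G M (X a) h ?n'"
      using M.transport_mult[OF Xa(1) zc \<rho>a gh(2) n] lin_scale[OF M.transport_linear[OF Xa(1) gh(2)]] xz by simp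
    then have "\<psi> g h (transport G M x h n) = transport G N (X a) h (?p a ?n')"
      using T(1)[OF gh Xa(1) a Xa(2)] n' gh
      by (simp add: \<psi>_def \<psi>0_def Let_def bij_betw_imp_inj_on flip: a)
    also have "?p a ?n' = scl N ?c (adj G N z (?p a n))"
      using p_lin[OF ac] zn p_adj[OF ac z n] by (simp add: lin_on_def)
    also have "transport G N (X a) h \<dots> = transport G N x h (?p a n)"
      using N.transport_mult[OF Xa(1) zc \<rho>a gh(2) p_in[OF ac n]] lin_scale[OF N.transport_linear[OF Xa(1) gh(2)]] xz by simp
    finally show ?thesis .
  qed
  have surj: "\<exists>n\<in>?S a. m = transport G M (X a) h n"
    if "g \<in> carrier G" "h \<in> carrier G" "a = g \<otimes> inv h" "m \<in> homog M g h" for g h a m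
    using T(1)[OF that(1,2) X(1) that(3) X(2), of ] that by (auto simp: bij_betw_def image_iff)
  have \<psi>_lin: "lin_on (scl M) (scl N) (homog M g h) (\<psi> g h)" for g h
  proof (cases "g \<in> carrier G \<and> h \<in> carrier G")
    case False
    interpret n: vector_space "scl N" by (rule N.vector_space)
    show ?thesis using False by (auto simp: \<psi>_def lin_on_def)
  next
    case True
    then have gh: "g \<in> carrier G" "h \<in> carrier G" by simp_all
    define a where "a = g \<otimes> inv h"
    have ac: "a \<in> carrier G" using gh by (simp add: a_def)
    note k = key[OF gh X(1)[OF ac] a_def X(2)[OF ac]]
    note l = M.transport_linear[OF X(1)[OF ac] gh(2)] and l' = N.transport_linear[OF X(1)[OF ac] gh(2)]
    show ?thesis unfolding lin_on_def
    proof (intro conjI ballI allI)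
      fix u v assume "u \<in> homog M g h" "v \<in> homog M g h"
      then obtain u' v' where u': "u' \<in> ?S a" "u = transport G M (X a) h u'" "v' \<in> ?S a" "v = transport G M (X a) h v'"
        using surj[OF gh a_def] by metis
      then have "u + v = transport G M (X a) h (u' + v')" by (simp add: lin_add[OF l])
      thus "\<psi> g h (u + v) = \<psi> g h u + \<psi> g h v"
        using u' p_lin[OF ac] by (simp add: k M.homog_add lin_on_def lin_add[OF l'])
    next
      fix c u assume "u \<in> homog M g h"
      then obtain u' where u': "u' \<in> ?S a" "u = transport G M (X a) h u'"
        using surj[OF gh a_def] by metis
      then have "scl M c u = transport G M (X a) h (scl M c u')" by (simp add: lin_scale[OF l])
      thus "\<psi> g h (scl M c u) = scl N c (\<psi> g h u)"
        using u' p_lin[OF ac] by (simp add: k M.homog_scale lin_on_def lin_scale[OF l'])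
    qed
  qed
  have \<psi>_bij: "bij_betw (\<psi> g h) (homog M g h) (homog N g h)" if gh: "g \<in> carrier G" "h \<in> carrier G" for g h
  proof -
    define a where "a = g \<otimes> inv h"
    have ac: "a \<in> carrier G" using gh by (simp add: a_def)
    note T = T[OF gh X(1)[OF ac] a_def X(2)[OF ac]]
    have "bij_betw (transport G N (X a) h \<circ> (?p a \<circ> inv_into (?S a) (transport G M (X a) h))) (homog M g h) (homog N g h)"
      by (rule bij_betw_trans[OF bij_betw_trans[OF bij_betw_inv_into[OF T(1)] p_bij[OF ac]] T(2)])
    thus ?thesis using gh by (simp add: \<psi>_def \<psi>0_def[abs_def] comp_def flip: a_def cong: bij_betw_cong)
  qed
  have \<psi>_lact: "\<psi> (f \<otimes> g) (f \<otimes> h) (lact M f m) = lact N f (\<psi> g h m)"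
    if f: "f \<in> carrier G" and gh: "g \<in> carrier G" "h \<in> carrier G" and m: "m \<in> homog M g h" for f g h m
  proof -
    define a where "a = g \<otimes> inv h"
    have ac: "a \<in> carrier G" using gh by (simp add: a_def)
    note Xa = X[OF ac]
    obtain n where n: "n \<in> ?S a" "m = transport G M (X a) h n" using surj[OF gh a_def m] by blast
    let ?a = "f \<otimes> a \<otimes> inv f"
    have a': "?a = f \<otimes> g \<otimes> inv (f \<otimes> h)"
      using f gh by (simp add: a_def M.inv_mult_group M.m_assoc)
    have cla: "cl ?a = cl a" using cl_conj[OF ac f] .
    then have \<rho>a: "\<rho> ?a = \<rho> a" by (simp add: \<rho>_def)
    have "f \<otimes> X a \<otimes> \<rho> ?a \<otimes> inv (f \<otimes> X a) = f \<otimes> (X a \<otimes> \<rho> a \<otimes> inv (X a)) \<otimes> inv f"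
      using f Xa(1) \<rho>[OF ac] unfolding \<rho>a by (simp add: M.inv_mult_group M.m_assoc)
    then have conj: "f \<otimes> X a \<otimes> \<rho> ?a \<otimes> inv (f \<otimes> X a) = ?a" using Xa(2) by simp
    let ?c = "slide G \<Phi> f (X a \<otimes> \<rho> a \<otimes> inv (X a)) h * cocycle_tilde G \<Phi> f (X a) (\<rho> a)"
    have tr: "transport G M (f \<otimes> X a) (f \<otimes> h) n \<in> homog M (f \<otimes> g) (f \<otimes> h)"
      using T(1)[OF _ _ _ a' conj] f gh Xa(1) n(1) \<rho>a by (auto simp: bij_betw_def)
    have "\<psi> (f \<otimes> g) (f \<otimes> h) (lact M f m) =
        scl N ?c (\<psi> (f \<otimes> g) (f \<otimes> h) (transport G M (f \<otimes> X a) (f \<otimes> h) n))"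
      using M.lact_transport[OF f Xa(1) \<rho>[OF ac] gh(2) n(1)] tr \<psi>_lin n(2) unfolding lin_on_def by metis
    also have "\<psi> (f \<otimes> g) (f \<otimes> h) (transport G M (f \<otimes> X a) (f \<otimes> h) n) =
        transport G N (f \<otimes> X a) (f \<otimes> h) (?p a n)"
      using key[OF _ _ _ a' conj] f gh Xa(1) n(1) \<rho>a cla by simp
    also have "scl N ?c \<dots> = lact N f (transport G N (X a) h (?p a n))"
      using N.lact_transport[OF f Xa(1) \<rho>[OF ac] gh(2) p_in[OF ac n(1)]] by simp
    also have "transport G N (X a) h (?p a n) = \<psi> g h m"
      using key[OF gh Xa(1) a_def Xa(2) n(1)] n(2) by simp
    finally show ?thesis .
  qed
  have \<psi>_ract: "\<psi> (g \<otimes> f) (h \<otimes> f) (ract M m f) = ract N (\<psi> g h m) f"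
    if f: "f \<in> carrier G" and gh: "g \<in> carrier G" "h \<in> carrier G" and m: "m \<in> homog M g h" for f g h m
  proof -
    define a where "a = g \<otimes> inv h"
    have ac: "a \<in> carrier G" using gh by (simp add: a_def)
    note Xa = X[OF ac]
    obtain n where n: "n \<in> ?S a" "m = transport G M (X a) h n" using surj[OF gh a_def m] by blast
    have a': "a = g \<otimes> f \<otimes> inv (h \<otimes> f)"
    proof -
      have "f \<otimes> (inv f \<otimes> inv h) = inv h"
        using f gh by (simp flip: M.m_assoc)
      thus ?thesis using f gh by (simp add: a_def M.inv_mult_group M.m_assoc)
    qed
    let ?c = "1 / \<Phi> (X a \<otimes> \<rho> a \<otimes> inv (X a)) h f"
    have tr: "transport G M (X a) (h \<otimes> f) n \<in> homog M (g \<otimes> f) (h \<otimes> f)"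
      using T(1)[OF _ _ Xa(1) a' Xa(2)] f gh n(1) by (auto simp: bij_betw_def)
    have "\<psi> (g \<otimes> f) (h \<otimes> f) (ract M m f) =
        scl N ?c (\<psi> (g \<otimes> f) (h \<otimes> f) (transport G M (X a) (h \<otimes> f) n))"
      using M.ract_transport[OF f Xa(1) \<rho>[OF ac] gh(2) n(1)] tr \<psi>_lin n(2) unfolding lin_on_def by metis
    also have "\<psi> (g \<otimes> f) (h \<otimes> f) (transport G M (X a) (h \<otimes> f) n) =
        transport G N (X a) (h \<otimes> f) (?p a n)"
      using key[OF _ _ Xa(1) a' Xa(2)] f gh n(1) by simp
    also have "scl N ?c \<dots> = ract N (transport G N (X a) h (?p a n)) f"
      using N.ract_transport[OF f Xa(1) \<rho>[OF ac] gh(2) p_in[OF ac n(1)]] by simp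
    also have "transport G N (X a) h (?p a n) = \<psi> g h m"
      using key[OF gh Xa(1) a_def Xa(2) n(1)] n(2) by simp
    finally show ?thesis .
  qed
  note gl = M.glue_homog[OF \<psi>_lin N.vector_space]
  have "bimod_iso G (glue M \<psi>) M N"
  proof (rule bimod_isoI[OF M.bicomodule_axioms N.bicomodule_axioms M.linear_glue[OF \<psi>_lin N.vector_space]])
    show "bij_betw (glue M \<psi>) (homog M g h) (homog N g h)" if "g \<in> carrier G" "h \<in> carrier G" for g h
      using \<psi>_bij[OF that] by (simp add: gl cong: bij_betw_cong)
    show "glue M \<psi> (lact M f m) = lact N f (glue M \<psi> m)"
      if "f \<in> carrier G" "g \<in> carrier G" "h \<in> carrier G" "m \<in> homog M g h" for f g h m
      using gl[OF that(4)] gl[OF M.lact_homog[OF that]] \<psi>_lact[OF that] by simp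
    show "glue M \<psi> (ract M m f) = ract N (glue M \<psi> m) f"
      if "f \<in> carrier G" "g \<in> carrier G" "h \<in> carrier G" "m \<in> homog M g h" for f g h m
      using gl[OF that(4)] gl[OF M.ract_homog[OF that]] \<psi>_ract[OF that] by simp
  qed (simp_all add: M.lact_linear N.lact_linear M.ract_linear N.ract_linear)
  thus ?thesis by blast
qed

lemma bimod_iso_homog:
  assumes "bicomodule G M" "bicomodule G N" "bimod_iso G \<phi> M N"
  shows "bij_betw \<phi> (homog M g h) (homog N g h)"
proof -
  interpret M: bicomodule G M by fact
  interpret N: bicomodule G N by fact
  have b: "bij \<phi>" and lr: "\<And>m g. coeff (lco N (\<phi> m)) g = \<phi> (coeff (lco M m) g)" "\<And>m g. coeff (rco N (\<phi> m)) g = \<phi> (coeff (rco M m) g)"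
    using assms(3) by (auto simp: bimod_iso_def)
  then have iff: "\<phi> m \<in> homog N g h \<longleftrightarrow> m \<in> homog M g h" for m
    by (simp add: M.homog_iff N.homog_iff bij_is_inj[OF b] inj_eq)
  have "\<phi> ` homog M g h = homog N g h"
  proof (intro equalityI subsetI)
    fix n assume n: "n \<in> homog N g h"
    obtain m where "n = \<phi> m" using b by (meson bij_pointE)
    thus "n \<in> \<phi> ` homog M g h" using n iff by blast
  qed (use iff in blast)
  moreover have "inj_on \<phi> (homog M g h)" using inj_on_subset[OF bij_is_inj[OF b]] by blast
  ultimately show ?thesis by (simp add: bij_betw_def)
qed

text \<open>The collection of a twisted bimodule is the twisted collection.  So for a fixed \<open>F\<close> both sides ask
  for an isomorphism between \<open>M\<^sub>F\<close> and \<open>N\<close>, which are bimodules over the same cocycle.\<close>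

theorem bimod_gauge_iff_collection_gauge:
  assumes M: "majid_bimodule G \<Phi> M" and N: "majid_bimodule G \<Phi>' N"
    and r: "\<And>C. C \<in> conj_classes G \<Longrightarrow> r C \<in> C"
  shows "bimod_gauge_equiv G \<Phi> M \<Phi>' N \<longleftrightarrow>
    collection_gauge_equiv G r \<Phi> (bimod_collection G r M) \<Phi>' (bimod_collection G r N)"
proof -
  interpret M: majid_bimodule G \<Phi> M by fact
  interpret N: majid_bimodule G \<Phi>' N by fact
  have rc: "r C \<in> carrier G" if "C \<in> conj_classes G" for C
    using r[OF that] that by (auto simp: conj_classes_def)
  have tw: "rep_iso G r C \<phi> (collection_twist G r F (bimod_collection G r M)) (bimod_collection G r N) \<longleftrightarrow>
      rep_iso G r C \<phi> (bimod_collection G r (bimod_twist F M)) (bimod_collection G r N)"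
    if "C \<in> conj_classes G" "gauge G F" for C F \<phi>
    using M.adj_twist[OF that(2)] rc[OF that(1)] M.centralizer_of_closed(1)[OF rc[OF that(1)]]
    by (auto simp: rep_iso_def gauge_mu_def)
  have "(\<exists>\<phi>. bimod_iso G \<phi> (bimod_twist F M) N) \<longleftrightarrow>
      (\<forall>C\<in>conj_classes G. \<exists>\<phi>. rep_iso G r C \<phi> (collection_twist G r F (bimod_collection G r M)) (bimod_collection G r N))"
    if F: "gauge G F" and c: "cocycle_eq G \<Phi>' (cocycle_twist G F \<Phi>)" for F
  proof
    have MF: "majid_bimodule G \<Phi>' (bimod_twist F M)"
      using majid_bimodule.majid_bimodule_cong[OF M.majid_bimodule_twist[OF F] c] .
    assume "\<forall>C\<in>conj_classes G. \<exists>\<phi>. rep_iso G r C \<phi> (collection_twist G r F (bimod_collection G r M)) (bimod_collection G r N)"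
    then show "\<exists>\<phi>. bimod_iso G \<phi> (bimod_twist F M) N"
      using tw[OF _ F] by (intro collection_iso_imp_bimod_iso[OF MF N r]) auto
  next
    assume "\<exists>\<phi>. bimod_iso G \<phi> (bimod_twist F M) N"
    then obtain \<phi> where \<phi>: "bimod_iso G \<phi> (bimod_twist F M) N" by blast
    have "rep_iso G r C \<phi> (bimod_collection G r (bimod_twist F M)) (bimod_collection G r N)"
      if C: "C \<in> conj_classes G" for C
    proof -
      have b: "bij_betw \<phi> (homog M (r C) \<one>\<^bsub>G\<^esub>) (homog N (r C) \<one>\<^bsub>G\<^esub>)"
        using bimod_iso_homog[OF bicomodule_twist[OF M.bicomodule_axioms] N.bicomodule_axioms \<phi>] by simp
      have l: "lin (scl M) (scl N) \<phi>" using \<phi> by (simp add: bimod_iso_def)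
      have "\<phi> (adj G (bimod_twist F M) f m) = adj G N f (\<phi> m)" if "f \<in> centralizer_of G (r C)" for f m
        using \<phi> M.centralizer_of_closed(1)[OF rc[OF C] that] by (simp add: bimod_iso_def adj_def)
      thus ?thesis using b lin_on_linear[OF l] by (simp add: rep_iso_def)
    qed
    thus "\<forall>C\<in>conj_classes G. \<exists>\<phi>. rep_iso G r C \<phi> (collection_twist G r F (bimod_collection G r M)) (bimod_collection G r N)"
      using tw[OF _ F] by blast
  qed
  thus ?thesis
    using is_collection_bimod_collection[OF M r] is_collection_bimod_collection[OF N r]
    unfolding bimod_gauge_equiv_def collection_gauge_equiv_def by blast
qed

lemma collection_gauge_iff_uniformly_projective:
  "collection_gauge_equiv G r \<Phi> X \<Phi>' Y \<longleftrightarrow> uniformly_projective_equiv G r \<Phi> X \<Phi>' Y"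
proof -
  have "rep_iso G r C \<phi> (collection_twist G r F X) Y \<longleftrightarrow>
      lin_on (cscl X) (cscl Y) (space X C) \<phi> \<and> bij_betw \<phi> (space X C) (space Y C) \<and>
      (\<forall>f\<in>centralizer_of G (r C). \<forall>m\<in>space X C.
         act Y C f (\<phi> m) = cscl Y (gauge_mu G r F C f) (\<phi> (act X C f m)))"
    if X: "is_collection G r \<Phi> X" and C: "C \<in> conj_classes G" for F C \<phi>
  proof -
    have "act X C f m \<in> space X C" if "f \<in> centralizer_of G (r C)" "m \<in> space X C" for f m
      using X C that unfolding is_collection_def bij_betw_def by blast
    then have eq: "\<phi> (cscl X c (act X C f m)) = cscl Y c (\<phi> (act X C f m))"
      if "lin_on (cscl X) (cscl Y) (space X C) \<phi>" "f \<in> centralizer_of G (r C)" "m \<in> space X C" for c f m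
      using that unfolding lin_on_def by blast
    show ?thesis unfolding rep_iso_def collection_twist_sel
      by (intro conj_cong refl ball_cong) (simp add: eq eq_commute)
  qed
  thus ?thesis unfolding collection_gauge_equiv_def uniformly_projective_equiv_def by blast
qed

section \<open>Lifting bimodule maps to path coalgebras\<close>

text \<open>A map \<open>\<chi>\<close> of bicomodules, to be extended from arrows to paths.\<close>

locale HM_pair = H: HM_algebra G R \<Phi> H M \<theta> + H': HM_algebra G R' \<Phi>' H' N \<theta>'
  for G (structure) and R :: "'a set \<Rightarrow> nat" and \<Phi> :: "'a \<Rightarrow> 'a \<Rightarrow> 'a \<Rightarrow> 'k::field"
    and H :: "('a path, 'k) majid" and M :: "('k, 'a, 'm::ab_group_add) bimod" and \<theta>
    and R' :: "'a set \<Rightarrow> nat" and \<Phi>' :: "'a \<Rightarrow> 'a \<Rightarrow> 'a \<Rightarrow> 'k"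
    and H' :: "('a path, 'k) majid" and N :: "('k, 'a, 'n::ab_group_add) bimod" and \<theta>' +
  fixes \<chi> :: "'m \<Rightarrow> 'n"
  assumes \<chi>_linear: "lin (scl M) (scl N) \<chi>"
    and \<chi>_homog: "g \<in> carrier G \<Longrightarrow> h \<in> carrier G \<Longrightarrow> m \<in> homog M g h \<Longrightarrow> \<chi> m \<in> homog N g h"
begin

definition arrow_elt :: "'a arrow \<Rightarrow> 'm" where
  "arrow_elt a = inv_into UNIV \<theta> (bas (fst a, [a]))"

definition arrow_coeff :: "'a arrow \<Rightarrow> 'a arrow \<Rightarrow> 'k" where
  "arrow_coeff a b = coeff (\<theta>' (\<chi> (arrow_elt a))) (fst b, [b])"

abbreviation lift :: "('a path \<Rightarrow>\<^sub>0 'k) \<Rightarrow> ('a path \<Rightarrow>\<^sub>0 'k)" where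
  "lift \<equiv> path_map arrow_coeff"

lemma \<theta>_arrow_elt:
  assumes "a \<in> arcs H.Q" shows "\<theta> (arrow_elt a) = bas (fst a, [a])"
proof -
  have "bas (fst a, [a]) \<in> path_degree H.Q 1"
    using H.bas_degree[of "fst a" "[a]"] assms H.arc_carrier[of a R] by simp
  thus ?thesis using H.\<theta>_bij unfolding arrow_elt_def by (intro f_inv_into_f) (auto simp: bij_betw_def)
qed

lemma arrow_elt_homog:
  assumes "a \<in> arcs H.Q" shows "arrow_elt a \<in> homog M (fst (snd a) \<otimes> fst a) (fst a)"
proof -
  note c = H.arc_carrier[OF assms]
  have "bas (fst a, [a]) \<in> H.arrows_between (fst a) (fst (snd a) \<otimes> fst a)"
    unfolding H.arrows_between_def mem_Collect_eq
  proof (intro allI impI)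
    fix x assume "coeff (bas (fst a, [a]) :: 'a path \<Rightarrow>\<^sub>0 'k) x \<noteq> 0"
    then have "x = (fst a, [a])" by (simp add: lookup_bas split: if_splits)
    thus "x \<in> paths H.Q \<and> (\<exists>b. x = (fst a, [b]) \<and> head H.Q b = fst (snd a) \<otimes> fst a)"
      using assms c by simp
  qed
  thus ?thesis using H.\<theta>_homog_iff[OF c(3,1)] \<theta>_arrow_elt[OF assms] by simp
qed

lemma arrow_image:
  assumes "a \<in> arcs H.Q"
  shows "\<theta>' (\<chi> (arrow_elt a)) \<in> H'.arrows_between (fst a) (fst (snd a) \<otimes> fst a)"
  using H.arc_carrier[OF assms] arrow_elt_homog[OF assms] by (intro H'.\<theta>_between \<chi>_homog)

sublocale am: arrow_map G R R' arrow_coeff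
proof
  fix a
  have "{b. arrow_coeff a b \<noteq> 0} \<subseteq> (\<lambda>x. hd (snd x)) ` keys (\<theta>' (\<chi> (arrow_elt a)))"
  proof
    fix b assume "b \<in> {b. arrow_coeff a b \<noteq> 0}"
    then have "(fst b, [b]) \<in> keys (\<theta>' (\<chi> (arrow_elt a)))"
      by (simp add: arrow_coeff_def in_keys_iff)
    then show "b \<in> (\<lambda>x. hd (snd x)) ` keys (\<theta>' (\<chi> (arrow_elt a)))"
      by (rule rev_image_eqI) simp
  qed
  thus "finite {b. arrow_coeff a b \<noteq> 0}" by (rule finite_subset) simp
next
  fix a b assume a: "a \<in> arcs (hopf_quiver G R)" and b: "arrow_coeff a b \<noteq> 0"
  have "(fst b, [b]) \<in> paths H'.Q \<and> (\<exists>e. (fst b, [b]) = (fst a, [e]) \<and> head H'.Q e = fst (snd a) \<otimes> fst a)"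
    using arrow_image[OF a] b unfolding H'.arrows_between_def arrow_coeff_def by blast
  thus "b \<in> arcs (hopf_quiver G R') \<and> fst b = fst a \<and> fst (snd b) \<otimes> fst b = fst (snd a) \<otimes> fst a"
    by auto
qed

lemma lift_arrow:
  assumes a: "a \<in> arcs H.Q"
  shows "lift (bas (fst a, [a])) = \<theta>' (\<chi> (arrow_elt a))"
proof (rule poly_mapping_eqI)
  fix x :: "'a path" obtain v q where x: "x = (v, q)" by fastforce
  let ?z = "\<theta>' (\<chi> (arrow_elt a))"
  have supp: "v = fst a \<and> (\<exists>b. q = [b] \<and> fst b = v)" if "coeff ?z (v, q) \<noteq> 0" for v q
  proof -
    have "(v, q) \<in> paths H'.Q \<and> (\<exists>e. (v, q) = (fst a, [e]) \<and> head H'.Q e = fst (snd a) \<otimes> fst a)"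
      using arrow_image[OF a] that unfolding H'.arrows_between_def by blast
    thus ?thesis by auto
  qed
  show "coeff (lift (bas (fst a, [a]))) x = coeff ?z x"
  proof (cases "\<exists>b. q = [b]")
    case False
    then have "coeff ?z (v, q) = 0" using supp[of v q] by blast
    moreover have "path_coeff arrow_coeff [a] q = 0"
      using False path_coeff_length[of arrow_coeff "[a]" q] by (auto simp: length_Suc_conv)
    ultimately show ?thesis by (simp add: x am.lookup_pm)
  next
    case True
    then obtain b where q: "q = [b]" by blast
    have "coeff (lift (bas (fst a, [a]))) x = (if v = fst a then coeff ?z (fst b, [b]) else 0)"
      by (simp add: x q am.lookup_pm arrow_coeff_def)
    also have "\<dots> = coeff ?z (v, [b])"
    proof (cases "v = fst a \<and> fst b = v")
      case False
      then have "coeff ?z (v, [b]) = 0" using supp[of v "[b]"] by blast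
      moreover have "v = fst a \<Longrightarrow> coeff ?z (fst b, [b]) = 0" using supp[of "fst b" "[b]"] False by metis
      ultimately show ?thesis by simp
    qed simp
    finally show ?thesis by (simp add: x q)
  qed
qed

lemma lift_\<theta>: "lift (\<theta> m) = \<theta>' (\<chi> m)"
proof -
  let ?K = "keys (\<theta> m)"
  have K: "\<exists>a\<in>arcs H.Q. x = (fst a, [a])" if x: "x \<in> ?K" for x
  proof -
    have "x \<in> paths H.Q \<and> length (snd x) = 1"
      using H.\<theta>_degree[of m] x unfolding path_degree_iff in_keys_iff by blast
    thus ?thesis by (cases x) (auto simp: length_Suc_conv)
  qed
  let ?e = "\<lambda>x. arrow_elt (hd (snd x))"
  have \<theta>e: "\<theta> (?e x) = bas x" and le: "lift (bas x) = \<theta>' (\<chi> (?e x))" if "x \<in> ?K" for x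
    using K[OF that] \<theta>_arrow_elt lift_arrow by auto
  have "\<theta> m = (\<Sum>x\<in>?K. fscale (coeff (\<theta> m) x) (\<theta> (?e x)))"
    by (rule trans[OF expand_bas]) (rule sum.cong[OF refl], simp add: \<theta>e)
  also have "\<dots> = \<theta> (\<Sum>x\<in>?K. scl M (coeff (\<theta> m) x) (?e x))"
    by (simp add: lin_sum[OF H.\<theta>_linear] lin_scale[OF H.\<theta>_linear])
  finally have m: "m = (\<Sum>x\<in>?K. scl M (coeff (\<theta> m) x) (?e x))" using H.\<theta>_inj by blast
  have "lift (\<theta> m) = (\<Sum>x\<in>?K. fscale (coeff (\<theta> m) x) (lift (bas x)))"
    by (rule linear_expand[OF linear_path_map])
  also have "\<dots> = (\<Sum>x\<in>?K. fscale (coeff (\<theta> m) x) (\<theta>' (\<chi> (?e x))))"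
    by (rule sum.cong[OF refl]) (simp add: le)
  also have "\<dots> = \<theta>' (\<chi> (\<Sum>x\<in>?K. scl M (coeff (\<theta> m) x) (?e x)))"
    by (simp add: lin_sum[OF H'.\<theta>_linear] lin_scale[OF H'.\<theta>_linear] lin_sum[OF \<chi>_linear] lin_scale[OF \<chi>_linear])
  finally show ?thesis using m by simp
qed

lemma lift_degree: "x \<in> paths H.Q \<Longrightarrow> lift (bas x) \<in> path_degree H'.Q (length (snd x))"
  using am.path_map_degree[of "fst x" "snd x"] by simp

lemma lift_car: "a \<in> car H \<Longrightarrow> lift a \<in> car H'"
  using am.path_map_keys by (auto simp: H.car_path H'.car_path)

lemma lift_ends: "a \<in> car H \<Longrightarrow> lift (restr (H.ends s t) a) = restr (H.ends s t) (lift a)"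
proof (rule linear_eq_on_bas[where f = "\<lambda>a. lift (restr (H.ends s t) a)" and g = "\<lambda>a. restr (H.ends s t) (lift a)"])
  show "lin fscale fscale (\<lambda>a. lift (restr (H.ends s t) a))"
    by (rule linear_comp[OF linear_path_map linear_restr])
  show "lin fscale fscale (\<lambda>a. restr (H.ends s t) (lift a))"
    by (rule linear_comp[OF linear_restr linear_path_map])
  fix x assume "a \<in> car H" "x \<in> keys a"
  then have x: "(fst x, snd x) \<in> paths H.Q" by (auto simp: H.car_path)
  have e: "H.ends s t y \<longleftrightarrow> H.ends s t x" if "coeff (lift (bas x)) y \<noteq> 0" for y
  proof -
    have "coeff (lift (bas (fst x, snd x))) (fst y, snd y) \<noteq> 0" using that by simp
    then have "fst y = fst x" "path_coeff arrow_coeff (snd x) (snd y) \<noteq> 0"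
      unfolding am.lookup_pm by (auto split: if_splits)
    thus ?thesis using am.path_coeff_paths[OF x] by (simp add: H.ends_def)
  qed
  show "lift (restr (H.ends s t) (bas x)) = restr (H.ends s t) (lift (bas x))"
  proof (rule poly_mapping_eqI)
    fix y
    show "coeff (lift (restr (H.ends s t) (bas x))) y = coeff (restr (H.ends s t) (lift (bas x))) y"
      using e[of y] by (cases "H.ends s t x") (auto simp: lin_zero[OF linear_path_map])
  qed
qed

lemma comul_lift:
  assumes "a \<in> car H"
  shows "comul H' (lift a) = sw2 fscale H a (\<lambda>a1 a2. tens (lift a1) (lift a2))"
  using am.path_comul_path_map[of a] assms
  by (simp add: sw2_lext H'.comul_path lift_car H.comul_path H.car_path)

lemma counit_lift:
  assumes a: "a \<in> car H" shows "counit H' (lift a) = counit H a"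
proof (rule linear_eq_on_bas[where f = "\<lambda>a. counit H' (lift a)"])
  show "lin fscale (*) (\<lambda>a. counit H' (lift a))"
    by (rule linear_comp[OF H'.counit_linear linear_path_map])
  fix x assume "x \<in> keys a"
  then have x: "(fst x, snd x) \<in> paths H.Q" using a by (auto simp: H.car_path)
  show "counit H' (lift (bas x)) = counit H (bas x)"
  proof (cases "snd x = []")
    case True
    then have "bas x = (vertex (fst x) :: 'a path \<Rightarrow>\<^sub>0 'k)" by (cases x) (simp add: vertex_def)
    then show ?thesis using H.path_start[OF x] by (simp add: am.path_map_vertex H.counit_vertex H'.counit_vertex)
  next
    case False
    then have "counit H' (lift (bas x)) = 0" using H'.gr_counit[OF lift_degree] x by simp
    then show ?thesis using H.counit_bas[OF x] False by simp
  qed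
qed (rule H.counit_linear)

end

text \<open>Both the composition and the identity are graded and compatible with coproducts, and they agree on
  vertices and arrows.\<close>

lemma path_map_inverse:
  assumes "HM_pair G R \<Phi> H M \<theta> R' \<Phi>' H' N \<theta>' \<chi>" "HM_pair G R' \<Phi>' H' N \<theta>' R \<Phi> H M \<theta> \<chi>'"
    and inv: "\<And>m. \<chi>' (\<chi> m) = m" and a: "a \<in> car H"
  shows "path_map (HM_pair.arrow_coeff \<theta>' \<theta> \<chi>') (path_map (HM_pair.arrow_coeff \<theta> \<theta>' \<chi>) a) = a"
proof -
  interpret A: HM_pair G R \<Phi> H M \<theta> R' \<Phi>' H' N \<theta>' \<chi> by fact
  interpret B: HM_pair G R' \<Phi>' H' N \<theta>' R \<Phi> H M \<theta> \<chi>' by fact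
  let ?l = "\<lambda>(u, p) i. (target G u (take i p), drop i p)" and ?r = "\<lambda>(u, p) i. (u, take i p)"
  have bas: "B.lift (A.lift (bas x)) = bas x" if "x \<in> paths A.H.Q" for x
    using that
  proof (rule cofree_unique[where X = "paths A.H.Q" and J = "\<lambda>(u, p). {..length p}" and l = ?l and r = ?r and
        ?D1.0 = "\<lambda>x. B.lift (A.lift (bas x))" and ?D2.0 = bas and d = "\<lambda>x. length (snd x)", rotated -1])
    fix x assume x: "x \<in> paths A.H.Q"
    obtain u p where up: "x = (u, p)" by fastforce
    have xp: "(u, p) \<in> paths A.H.Q" using x up by simp
    show "bas x \<in> path_degree A.H.Q (length (snd x))" using A.H.bas_degree[OF xp] up by simp
    show "B.lift (A.lift (bas x)) \<in> path_degree A.H.Q (length (snd x))"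
    proof (rule linear_in_subspace[OF linear_path_map path_degree_subspace])
      fix y assume "y \<in> keys (A.lift (bas x))"
      then have "y \<in> paths A.H'.Q \<and> length (snd y) = length (snd x)"
        using A.lift_degree[OF x] unfolding path_degree_iff in_keys_iff by blast
      thus "B.lift (bas y) \<in> path_degree A.H.Q (length (snd x))" using B.lift_degree[of y] by simp
    qed
    show "path_comul A.H.Q (bas x) = (\<Sum>j\<in>(case x of (u, p) \<Rightarrow> {..length p}). tens (bas (?l x j)) (bas (?r x j)))"
      by (simp add: up path_comul_bas)
    show "path_comul A.H.Q (B.lift (A.lift (bas x))) = (\<Sum>j\<in>(case x of (u, p) \<Rightarrow> {..length p}).
        tens (B.lift (A.lift (bas (?l x j)))) (B.lift (A.lift (bas (?r x j)))))"
      unfolding up prod.case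
      by (rule B.am.path_comul_path_map_sum[OF A.am.path_map_keys A.am.path_comul_path_map_sum])
        (use xp in \<open>auto simp: path_comul_bas\<close>)
    show "?l x j \<in> paths A.H.Q \<and> ?r x j \<in> paths A.H.Q \<and> length (snd (?l x j)) + length (snd (?r x j)) = length (snd x)"
      if "j \<in> (case x of (u, p) \<Rightarrow> {..length p})" for j
      using A.H.path_cut[OF xp, of j] that by (simp add: up)
    show "B.lift (A.lift (bas x)) = bas x" if "length (snd x) \<le> 1"
    proof (cases p)
      case Nil
      then show ?thesis by (simp add: up A.am.path_map_vertex B.am.path_map_vertex flip: vertex_def)
    next
      case (Cons e q)
      then have e: "p = [e]" using that up by simp
      then have "e \<in> arcs A.H.Q" "x = (fst e, [e])" using xp up by auto
      then show ?thesis using A.\<theta>_arrow_elt[of e] A.lift_\<theta>[of "A.arrow_elt e"] B.lift_\<theta>[of "\<chi> (A.arrow_elt e)"]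
        by (simp add: inv)
    qed
  qed
  show ?thesis
    by (rule linear_eq_on_bas[OF linear_comp[OF linear_path_map linear_path_map] lin_id[OF free.vector_space_axioms]])
      (use a bas in \<open>auto simp: A.H.car_path\<close>)
qed

subsection \<open>The lift is multiplicative\<close>

text \<open>Now \<open>\<chi>\<close> is a morphism of bimodules from \<open>M\<^sub>F\<close> to \<open>N\<close>.\<close>

locale HM_gauge = HM_pair G R \<Phi> H M \<theta> R' \<Phi>' H' N \<theta>' \<chi>
  for G (structure) and R :: "'a set \<Rightarrow> nat" and \<Phi> :: "'a \<Rightarrow> 'a \<Rightarrow> 'a \<Rightarrow> 'k::field"
    and H :: "('a path, 'k) majid" and M :: "('k, 'a, 'm::ab_group_add) bimod" and \<theta>
    and R' :: "'a set \<Rightarrow> nat" and \<Phi>' :: "'a \<Rightarrow> 'a \<Rightarrow> 'a \<Rightarrow> 'k"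
    and H' :: "('a path, 'k) majid" and N :: "('k, 'a, 'n::ab_group_add) bimod" and \<theta>' and \<chi> +
  fixes F :: "'a \<Rightarrow> 'a \<Rightarrow> 'k"
  assumes F: "gauge G F" and cocyc: "cocycle_eq G \<Phi>' (cocycle_twist G F \<Phi>)"
    and \<chi>_lact: "u \<in> carrier G \<Longrightarrow> \<chi> (lact (bimod_twist F M) u m) = lact N u (\<chi> m)"
    and \<chi>_ract: "u \<in> carrier G \<Longrightarrow> \<chi> (ract (bimod_twist F M) m u) = ract N (\<chi> m) u"
begin

abbreviation "HF \<equiv> majid_twist H (vertex_form F) (vertex_form (\<lambda>g h. 1 / F g h))"

abbreviation "\<kappa> \<equiv> H.twist_factor F"

lemmas F_nz = H.F_nonzero[OF F]
  and prd_HF_bas = H.prd_twist_bas[OF F]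
  and bilin_HF = H.bilin_prd_twist[OF F]

text \<open>When two paths are cut, the values of \<open>F\<close> at the two cutting points cancel.  Hence the twisted product
  is again compatible with coproducts.\<close>

lemma \<kappa>_mult:
  assumes "(u, p) \<in> paths H.Q" "(v, q) \<in> paths H.Q"
  shows "\<kappa> (u, p) (v, q) = \<kappa> (target G u (take i p), drop i p) (target G v (take j q), drop j q) *
    \<kappa> (u, take i p) (v, take j q)"
  using F_nz H.path_target[OF H.path_cut(1)[OF assms(1), of i]] H.path_target[OF H.path_cut(1)[OF assms(2), of j]]
  by (simp add: H.twist_factor_def[OF F] target_cut[of G u i p] target_cut[of G v j q])

lemma comul_prd_sum:
  assumes K: "HM_algebra G R0 \<Phi>0 K L \<eta>" and ab: "a \<in> car K" "b \<in> car K"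
    and ca: "comul K a = (\<Sum>i\<in>I. tens (s i) (t i))" and cb: "comul K b = (\<Sum>j\<in>J. tens (s' j) (t' j))"
  shows "comul K (prd K a b) = (\<Sum>(i, j)\<in>I \<times> J. tens (prd K (s i) (s' j)) (prd K (t i) (t' j)))"
proof -
  interpret K: HM_algebra G R0 \<Phi>0 K L \<eta> by fact
  note vs = free.vector_space_axioms
  have l: "lin fscale fscale (\<lambda>a1. tens (prd K a1 b1) c)"
    "lin fscale fscale (\<lambda>b1. tens (prd K a1' b1) c)"
    "lin fscale fscale (\<lambda>a1. tens c (prd K a1 b1))"
    "lin fscale fscale (\<lambda>b1. tens c (prd K a1' b1))" for b1 c a1'
    by (intro lin_intros K.linear_prd1 K.linear_prd2)+
  have "comul K (prd K a b) = sw2 fscale K a (\<lambda>a1 a2. sw2 fscale K b (\<lambda>b1 b2. tens (prd K a1 b1) (prd K a2 b2)))"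
    by (rule K.comul_prd[OF ab])
  also have "\<dots> = (\<Sum>i\<in>I. sw2 fscale K b (\<lambda>b1 b2. tens (prd K (s i) b1) (prd K (t i) b2)))"
    by (rule sw2_sum_tens[OF bilinI ca]) (intro linear_sw2_arg l vs)+
  also have "\<dots> = (\<Sum>i\<in>I. \<Sum>j\<in>J. tens (prd K (s i) (s' j)) (prd K (t i) (t' j)))"
    by (intro sum.cong refl sw2_sum_tens[OF bilinI cb] l)
  finally show ?thesis by (simp add: sum.cartesian_product)
qed

text \<open>The product of a vertex and an arrow in the twist of \<open>H(M)\<close> is the action of \<open>G\<close> on \<open>M\<^sub>F\<close>.\<close>

lemma lift_prd_base:
  assumes up: "(u, p) \<in> paths H.Q" and vq: "(v, q) \<in> paths H.Q" and len: "length p + length q \<le> 1"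
  shows "lift (prd HF (bas (u, p)) (bas (v, q))) = prd H' (lift (bas (u, p))) (lift (bas (v, q)))"
proof -
  note c = H.path_start[OF up] H.path_start[OF vq]
  consider "p = []" "q = []" | a where "p = []" "q = [a]" | a where "p = [a]" "q = []"
    using len by (cases p; cases q) auto
  then show ?thesis
  proof cases
    case 1
    then show ?thesis using c F_nz prd_HF_bas[OF up vq]
      by (simp add: H.twist_factor_def[OF F] H.prd_vertex H'.prd_vertex am.path_map_vertex flip: vertex_def)
  next
    case 2
    then have a: "a \<in> arcs H.Q" "v = fst a" using vq by auto
    let ?m = "arrow_elt a"
    have m: "bas (v, q) = \<theta> ?m" using \<theta>_arrow_elt[OF a(1)] a 2 by simp
    have "prd HF (bas (u, p)) (bas (v, q)) = fscale (F u (fst a) / F u (fst (snd a) \<otimes> fst a)) (prd H (vertex u) (\<theta> ?m))"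
      using prd_HF_bas[OF up vq] m by (simp add: H.twist_factor_def[OF F] 2 a(2) vertex_def)
    also have "\<dots> = \<theta> (lact (bimod_twist F M) u ?m)"
      using H.lact_twist[OF c(1) arrow_elt_homog[OF a(1)], of F] c(1)
      by (simp add: H.prd_lact lin_scale[OF H.\<theta>_linear])
    finally have "lift (prd HF (bas (u, p)) (bas (v, q))) = \<theta>' (lact N u (\<chi> ?m))"
      using c(1) by (simp add: lift_\<theta> \<chi>_lact)
    thus ?thesis using c(1) 2 m by (simp add: lift_\<theta> H'.prd_lact am.path_map_vertex flip: vertex_def)
  next
    case 3
    then have a: "a \<in> arcs H.Q" "u = fst a" using up by auto
    let ?m = "arrow_elt a"
    have m: "bas (u, p) = \<theta> ?m" using \<theta>_arrow_elt[OF a(1)] a 3 by simp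
    have "prd HF (bas (u, p)) (bas (v, q)) = fscale (F (fst a) v / F (fst (snd a) \<otimes> fst a) v) (prd H (\<theta> ?m) (vertex v))"
      using prd_HF_bas[OF up vq] m by (simp add: H.twist_factor_def[OF F] 3 a(2) vertex_def)
    also have "\<dots> = \<theta> (ract (bimod_twist F M) ?m v)"
      using H.ract_twist[OF c(2) arrow_elt_homog[OF a(1)], of F] c(2)
      by (simp add: H.prd_ract lin_scale[OF H.\<theta>_linear])
    finally have "lift (prd HF (bas (u, p)) (bas (v, q))) = \<theta>' (ract N (\<chi> ?m) v)"
      using c(2) by (simp add: lift_\<theta> \<chi>_ract)
    thus ?thesis using c(2) 3 m by (simp add: lift_\<theta> H'.prd_ract am.path_map_vertex flip: vertex_def)
  qed
qed

text \<open>Both sides are graded maps on pairs of paths that are compatible with coproducts.\<close>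

lemma lift_prd_bas:
  assumes "x \<in> paths H.Q" "y \<in> paths H.Q"
  shows "lift (prd HF (bas x) (bas y)) = prd H' (lift (bas x)) (lift (bas y))"
proof -
  let ?D1 = "\<lambda>(x, y). lift (prd HF (bas x) (bas y))"
  let ?D2 = "\<lambda>(x, y). prd H' (lift (bas x)) (lift (bas y))"
  let ?d = "\<lambda>(x, y). length (snd x) + length (snd y)"
  let ?J = "\<lambda>((u, p), (v, q)). {..length p} \<times> {..length q}"
  let ?l = "\<lambda>((u, p), (v, q)) (i, j). ((target G u (take i p), drop i p), (target G v (take j q), drop j q))"
  let ?r = "\<lambda>((u, p), (v, q)) (i, j). ((u, take i p), (v, take j q))"
  have "?D1 z = ?D2 z" if "z \<in> paths H.Q \<times> paths H.Q" for z
    using that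
  proof (rule cofree_unique[where X = "paths H.Q \<times> paths H.Q" and J = ?J and l = ?l and r = ?r and
        ?D1.0 = ?D1 and ?D2.0 = ?D2 and d = ?d, rotated -1])
    fix z assume z: "z \<in> paths H.Q \<times> paths H.Q"
    obtain u p v q where upvq: "z = ((u, p), (v, q))" by (metis surj_pair)
    have up: "(u, p) \<in> paths H.Q" and vq: "(v, q) \<in> paths H.Q" using z upvq by auto
    have hdeg: "prd HF (bas (u, p)) (bas (v, q)) \<in> path_degree H.Q (length p + length q)"
      using H.gr_prd[OF H.bas_degree[OF up] H.bas_degree[OF vq]]
      by (simp add: prd_HF_bas up vq free.subspace_scale[OF path_degree_subspace])
    show "?D1 z \<in> path_degree H'.Q (?d z)"
      unfolding upvq prod.case snd_conv
    proof (rule linear_in_subspace[OF linear_path_map path_degree_subspace])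
      fix y assume "y \<in> keys (prd HF (bas (u, p)) (bas (v, q)))"
      then have "y \<in> paths H.Q \<and> length (snd y) = length p + length q"
        using hdeg unfolding path_degree_iff in_keys_iff by blast
      thus "lift (bas y) \<in> path_degree H'.Q (length p + length q)" using lift_degree[of y] by simp
    qed
    show "?D2 z \<in> path_degree H'.Q (?d z)"
      using H'.gr_prd[OF lift_degree[OF up] lift_degree[OF vq]] by (simp add: upvq)
    let ?a = "\<lambda>i. bas (target G u (take i p), drop i p) :: 'a path \<Rightarrow>\<^sub>0 'k"
      and ?a' = "\<lambda>i. bas (u, take i p) :: 'a path \<Rightarrow>\<^sub>0 'k"
      and ?b = "\<lambda>j. bas (target G v (take j q), drop j q) :: 'a path \<Rightarrow>\<^sub>0 'k"
      and ?b' = "\<lambda>j. bas (v, take j q) :: 'a path \<Rightarrow>\<^sub>0 'k"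
    show "path_comul H'.Q (?D2 z) = (\<Sum>j\<in>?J z. tens (?D2 (?l z j)) (?D2 (?r z j)))"
    proof -
      have cl: "comul H' (lift (bas (w, s))) =
          (\<Sum>i\<le>length s. tens (lift (bas (target G w (take i s), drop i s))) (lift (bas (w, take i s))))"
        if "(w, s) \<in> paths H.Q" for w s
        using am.path_map_comul_bas[OF that] H'.comul_path[OF lift_car[OF H.bas_car[OF that]]] by simp
      have "prd H' (lift (bas (u, p))) (lift (bas (v, q))) \<in> car H'"
        using up vq by (intro H'.prd_closed lift_car H.bas_car)
      then have "path_comul H'.Q (prd H' (lift (bas (u, p))) (lift (bas (v, q)))) =
          comul H' (prd H' (lift (bas (u, p))) (lift (bas (v, q))))"
        by (rule H'.comul_path[symmetric])
      also have "\<dots> = (\<Sum>(i, j)\<in>{..length p} \<times> {..length q}.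
          tens (prd H' (lift (?a i)) (lift (?b j)))
            (prd H' (lift (?a' i)) (lift (?b' j))))"
        by (rule comul_prd_sum[OF H'.HM_algebra_axioms lift_car[OF H.bas_car[OF up]] lift_car[OF H.bas_car[OF vq]] cl[OF up] cl[OF vq]])
      finally show ?thesis by (simp add: upvq case_prod_unfold)
    qed
    show "path_comul H'.Q (?D1 z) = (\<Sum>j\<in>?J z. tens (?D1 (?l z j)) (?D1 (?r z j)))"
    proof -
      have cl: "comul H (bas (w, s)) = (\<Sum>i\<le>length s. tens (bas (target G w (take i s), drop i s)) (bas (w, take i s)))"
        if "(w, s) \<in> paths H.Q" for w s
        using H.comul_path[OF H.bas_car[OF that]] by (simp add: path_comul_bas)
      have car_prd: "prd H (bas (u, p)) (bas (v, q)) \<in> car H"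
        using up vq by (intro H.prd_closed H.bas_car)
      have "path_comul H.Q (prd H (bas (u, p)) (bas (v, q))) = (\<Sum>(i, j)\<in>{..length p} \<times> {..length q}.
          tens (prd H (?a i) (?b j))
            (prd H (?a' i) (?b' j)))"
        using comul_prd_sum[OF H.HM_algebra_axioms H.bas_car[OF up] H.bas_car[OF vq] cl[OF up] cl[OF vq]] H.comul_path[OF car_prd] by simp
      then have "path_comul H.Q (prd HF (bas (u, p)) (bas (v, q))) = (\<Sum>ij\<in>{..length p} \<times> {..length q}.
          fscale (\<kappa> (u, p) (v, q)) (tens (prd H (?a (fst ij)) (?b (snd ij)))
            (prd H (?a' (fst ij)) (?b' (snd ij)))))"
        by (simp add: prd_HF_bas up vq lin_scale[OF linear_path_comul] free.scale_sum_right case_prod_unfold)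
      also have "\<dots> = (\<Sum>ij\<in>{..length p} \<times> {..length q}.
          tens (prd HF (?a (fst ij)) (?b (snd ij)))
            (prd HF (?a' (fst ij)) (?b' (snd ij))))"
      proof (rule sum.cong[OF refl])
        fix ij
        show "fscale (\<kappa> (u, p) (v, q)) (tens (prd H (?a (fst ij)) (?b (snd ij))) (prd H (?a' (fst ij)) (?b' (snd ij)))) =
          tens (prd HF (?a (fst ij)) (?b (snd ij))) (prd HF (?a' (fst ij)) (?b' (snd ij)))"
          unfolding prd_HF_bas[OF H.path_cut(2)[OF up] H.path_cut(2)[OF vq]] prd_HF_bas[OF H.path_cut(1)[OF up] H.path_cut(1)[OF vq]]
            \<kappa>_mult[OF up vq, of "fst ij" "snd ij"]
          by (rule lookup_eqI) simp
      qed
      finally have "path_comul H.Q (prd HF (bas (u, p)) (bas (v, q))) = \<dots>" .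
      moreover have "keys (prd HF (bas (u, p)) (bas (v, q))) \<subseteq> paths H.Q"
        using hdeg by (auto simp: path_degree_def)
      ultimately show ?thesis
        using am.path_comul_path_map_sum by (simp add: upvq case_prod_unfold)
    qed
    show "?l z j \<in> paths H.Q \<times> paths H.Q \<and> ?r z j \<in> paths H.Q \<times> paths H.Q \<and> ?d (?l z j) + ?d (?r z j) = ?d z"
      if "j \<in> ?J z" for j
      using H.path_cut[OF up, of "fst j"] H.path_cut[OF vq, of "snd j"] that by (auto simp: upvq case_prod_unfold)
    show "?D1 z = ?D2 z" if "?d z \<le> 1"
      using lift_prd_base[OF up vq] that by (simp add: upvq)
  qed
  from this[of "(x, y)"] show ?thesis using assms by simp
qed

lemma lift_prd:
  assumes a: "a \<in> car H" and b: "b \<in> car H"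
  shows "lift (prd HF a b) = prd H' (lift a) (lift b)"
proof (rule bilin_eq_on_bas[where f = "\<lambda>a b. lift (prd HF a b)" and g = "\<lambda>a b. prd H' (lift a) (lift b)"])
  show "bilin fscale (\<lambda>a b. lift (prd HF a b))"
    by (intro bilinI linear_comp[OF linear_path_map] bilinD[OF bilin_HF])
  show "bilin fscale (\<lambda>a b. prd H' (lift a) (lift b))"
    by (intro bilinI linear_comp[OF H'.linear_prd1 linear_path_map] linear_comp[OF H'.linear_prd2 linear_path_map])
  fix x y assume "x \<in> keys a" "y \<in> keys b"
  then have "x \<in> paths H.Q" "y \<in> paths H.Q" using a b by (auto simp: H.car_path)
  thus "lift (prd HF (bas x) (bas y)) = prd H' (lift (bas x)) (lift (bas y))" by (rule lift_prd_bas)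
qed

lemma lift_reass:
  assumes a: "a \<in> car H" and b: "b \<in> car H" and c: "c \<in> car H"
  shows "reass H' (lift a) (lift b) (lift c) = reass HF a b c"
proof -
  have tri: "trilin (*) (reass H')" using H'.reass_inverse by (auto simp: conv_inverse3_def)
  then have t: "lin fscale (*) (\<lambda>c. reass H' x y (lift c))"
    "lin fscale (*) (\<lambda>b. reass H' x (lift b) z)"
    "lin fscale (*) (\<lambda>a. reass H' (lift a) y z)" for x y z
    unfolding trilin_def bilin_def by (auto intro: linear_comp[OF _ linear_path_map])
  note t' = H.trilin_reass_twist[OF F]
  have p: "x \<in> paths H.Q" if "x \<in> keys a \<or> x \<in> keys b \<or> x \<in> keys c" for x
    using that a b c by (auto simp: H.car_path)
  have base: "reass H' (lift (bas x)) (lift (bas y)) (lift (bas z)) = reass HF (bas x) (bas y) (bas z)"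
    if P: "x \<in> paths H.Q" "y \<in> paths H.Q" "z \<in> paths H.Q" for x y z
  proof (cases "snd x = [] \<and> snd y = [] \<and> snd z = []")
    case True
    then have v: "bas x = (vertex (fst x) :: 'a path \<Rightarrow>\<^sub>0 'k)" "bas y = (vertex (fst y) :: 'a path \<Rightarrow>\<^sub>0 'k)" "bas z = (vertex (fst z) :: 'a path \<Rightarrow>\<^sub>0 'k)"
      by (cases x; cases y; cases z; simp add: vertex_def)+
    have g: "fst x \<in> carrier G" "fst y \<in> carrier G" "fst z \<in> carrier G"
      using H.path_start[of "fst x" "snd x" R] H.path_start[of "fst y" "snd y" R]
        H.path_start[of "fst z" "snd z" R] P by simp_all
    have "reass H' (lift (bas x)) (lift (bas y)) (lift (bas z)) = \<Phi>' (fst x) (fst y) (fst z)"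
      using g by (simp add: v am.path_map_vertex H'.reass_vertex)
    also have "\<dots> = reass HF (bas x) (bas y) (bas z)"
      using cocyc g True by (simp add: H.reass_twist_bas[OF F P] cocycle_eq_def)
    finally show ?thesis .
  next
    case False
    then have "reass H' (lift (bas x)) (lift (bas y)) (lift (bas z)) = 0"
      by (intro H'.gr_reass[OF lift_degree[OF P(1)] lift_degree[OF P(2)] lift_degree[OF P(3)]]) auto
    moreover have "reass HF (bas x) (bas y) (bas z) = 0"
      unfolding H.reass_twist_bas[OF F P] using False by (simp only: if_False)
    ultimately show ?thesis by simp
  qed
  show ?thesis
  proof (rule linear_eq_on_bas[OF t(3) t'(3)])
    fix x assume x: "x \<in> keys a"
    show "reass H' (lift (bas x)) (lift b) (lift c) = reass HF (bas x) b c"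
    proof (rule linear_eq_on_bas[OF t(2) t'(2)])
      fix y assume y: "y \<in> keys b"
      show "reass H' (lift (bas x)) (lift (bas y)) (lift c) = reass HF (bas x) (bas y) c"
        by (rule linear_eq_on_bas[OF t(1) t'(1)]) (use x y p base in blast)
    qed
  qed
qed

lemma split_ends:
  assumes "a \<in> car H"
  obtains E where "finite E" "E \<subseteq> carrier G \<times> carrier G" "a = (\<Sum>(s, t)\<in>E. restr (H.ends s t) a)"
proof
  define e where "e x = (fst x, target G (fst x) (snd x))" for x :: "'a path"
  show "finite (e ` keys a)" by simp
  show "e ` keys a \<subseteq> carrier G \<times> carrier G"
  proof
    fix st assume "st \<in> e ` keys a"
    then obtain x where x: "st = e x" "x \<in> keys a" by blast
    then have "(fst x, snd x) \<in> paths H.Q" using assms by (auto simp: H.car_path)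
    thus "st \<in> carrier G \<times> carrier G" using H.path_start[of "fst x" "snd x" R] H.path_target[of "fst x" "snd x" R]
      by (simp add: x e_def)
  qed
  have "H.ends s t = (\<lambda>x. e x = (s, t))" for s t by (auto simp: fun_eq_iff H.ends_def e_def)
  then show "a = (\<Sum>(s, t)\<in>e ` keys a. restr (H.ends s t) a)"
    using split_restr[of a e] by (simp add: case_prod_unfold)
qed

lemma prd_HF_ends:
  assumes a: "a \<in> car H" and b: "b \<in> car H"
  shows "prd HF (restr (H.ends s t) a) (restr (H.ends s' t') b) =
    fscale (F s s' / F t t') (prd H (restr (H.ends s t) a) (restr (H.ends s' t') b))"
proof -
  let ?f = "\<lambda>a b. prd HF (restr (H.ends s t) a) (restr (H.ends s' t') b)"
  let ?g = "\<lambda>a b. fscale (F s s' / F t t') (prd H (restr (H.ends s t) a) (restr (H.ends s' t') b))"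
  show "?f a b = ?g a b"
  proof (rule bilin_eq_on_bas[where f = ?f and g = ?g])
    show "bilin fscale ?f"
      by (intro bilinI linear_comp[OF bilinD(1)[OF bilin_HF] linear_restr] linear_comp[OF bilinD(2)[OF bilin_HF] linear_restr])
    show "bilin fscale ?g"
      by (intro bilinI linear_fscale linear_comp[OF H.linear_prd1 linear_restr] linear_comp[OF H.linear_prd2 linear_restr])
    fix x y assume "x \<in> keys a" "y \<in> keys b"
    then have "x \<in> paths H.Q" "y \<in> paths H.Q" using a b by (auto simp: H.car_path)
    thus "?f (bas x) (bas y) = ?g (bas x) (bas y)"
      by (auto simp: prd_HF_bas H.twist_factor_def[OF F] H.ends_def lin_zero[OF bilinD(1)[OF bilin_HF]]
          lin_zero[OF bilinD(2)[OF bilin_HF]] lin_zero[OF H.linear_prd1] lin_zero[OF H.linear_prd2])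
  qed
qed

lemma expand_ends:
  assumes "a = (\<Sum>(s, t)\<in>E. restr (H.ends s t) a)" "b = (\<Sum>(s, t)\<in>E'. restr (H.ends s t) b)"
    and p: "bilin fscale p"
  shows "p a b = (\<Sum>(s, t)\<in>E. \<Sum>(s', t')\<in>E'. p (restr (H.ends s t) a) (restr (H.ends s' t') b))"
proof -
  have 1: "p a' b = (\<Sum>(s', t')\<in>E'. p a' (restr (H.ends s' t') b))" for a'
    using arg_cong[OF assms(2), of "p a'"] by (simp add: lin_sum[OF bilinD(1)[OF p]] case_prod_unfold)
  have "p a b = (\<Sum>(s, t)\<in>E. p (restr (H.ends s t) a) b)"
    using arg_cong[OF assms(1), of "\<lambda>a. p a b"] by (simp add: lin_sum[OF bilinD(2)[OF p]] case_prod_unfold)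
  also have "\<dots> = (\<Sum>(s, t)\<in>E. \<Sum>(s', t')\<in>E'. p (restr (H.ends s t) a) (restr (H.ends s' t') b))"
    unfolding 1 ..
  finally show ?thesis .
qed

lemma gen_sub: "H.gen \<subseteq> car H" and gen_sub': "H'.gen \<subseteq> car H'"
  using H.gen_car H'.gen_car by blast+

text \<open>Splitting both factors by end points, where twisted and original products are proportional, transfers
  closure under one product to the other.\<close>

lemma gen_HF:
  assumes a: "a \<in> H.gen" and b: "b \<in> H.gen"
  shows "prd HF a b \<in> H.gen"
proof -
  note ac = H.gen_car[OF a] and bc = H.gen_car[OF b]
  obtain E where E: "a = (\<Sum>(s, t)\<in>E. restr (H.ends s t) a)" using split_ends[OF ac] by blast
  obtain E' where E': "b = (\<Sum>(s, t)\<in>E'. restr (H.ends s t) b)" using split_ends[OF bc] by blast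
  have r: "restr (H.ends s t) c \<in> H.gen" if "c \<in> H.gen" for c s t
    by (rule H.restr_ends[OF gen_sub H.gen_subspace H.gen_comul that])
  show ?thesis
    unfolding expand_ends[OF E E' bilin_HF] case_prod_unfold prd_HF_ends[OF ac bc]
    by (intro free.subspace_sum[OF H.gen_subspace] H.gen.scale H.gen.prd r a b)
qed

lemma lift_gen: "a \<in> H.gen \<Longrightarrow> lift a \<in> H'.gen"
proof (induction rule: H.gen.induct)
  case (bas x)
  obtain u p where x: "x = (u, p)" by fastforce
  show ?case
  proof (cases p)
    case Nil
    then show ?thesis using bas H'.vertex_gen[of u] by (simp add: x am.path_map_vertex flip: vertex_def)
  next
    case (Cons e q)
    then have "lift (bas x) \<in> path_degree H'.Q 1" using lift_degree[OF bas(1)] bas(2) by (simp add: x)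
    then show ?thesis by (rule H'.degree1_gen)
  qed
next
  case (prd a b)
  note ac = H.gen_car[OF prd(1)] and bc = H.gen_car[OF prd(2)]
  obtain E where E: "a = (\<Sum>(s, t)\<in>E. restr (H.ends s t) a)" "E \<subseteq> carrier G \<times> carrier G" using split_ends[OF ac] by blast
  obtain E' where E': "b = (\<Sum>(s, t)\<in>E'. restr (H.ends s t) b)" "E' \<subseteq> carrier G \<times> carrier G" using split_ends[OF bc] by blast
  have r: "restr (H.ends s t) c \<in> car H" if "c \<in> car H" for c s t
    using that unfolding H.in_car_iff by (simp split: if_splits)
  have r': "restr (H.ends s t) c \<in> H'.gen" if "c \<in> H'.gen" for c s t
    using H'.restr_ends[OF gen_sub' H'.gen_subspace H'.gen_comul that] by (simp add: H.ends_def[abs_def] H'.ends_def[abs_def])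
  have piece: "lift (prd H (restr (H.ends s t) a) (restr (H.ends s' t') b)) \<in> H'.gen"
    if st: "s \<in> carrier G" "t \<in> carrier G" "s' \<in> carrier G" "t' \<in> carrier G" for s t s' t'
  proof -
    have "lift (prd HF (restr (H.ends s t) a) (restr (H.ends s' t') b)) \<in> H'.gen"
      unfolding lift_prd[OF r[OF ac] r[OF bc]] lift_ends[OF ac] lift_ends[OF bc]
      by (intro H'.gen.prd r' prd)
    then have "fscale (F s s' / F t t') (lift (prd H (restr (H.ends s t) a) (restr (H.ends s' t') b))) \<in> H'.gen"
      by (simp add: prd_HF_ends[OF ac bc] lin_scale[OF linear_path_map])
    from H'.gen.scale[OF this, of "F t t' / F s s'"] show ?thesis using F_nz st by simp
  qed
  show ?case
    unfolding expand_ends[OF E(1) E'(1) H.prd_bilin] lin_sum[OF linear_path_map] case_prod_unfold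
    using E(2) E'(2) by (intro free.subspace_sum[OF H'.gen_subspace] piece) auto
qed (auto simp: lin_zero[OF linear_path_map] lin_add[OF linear_path_map] lin_scale[OF linear_path_map] intro: H'.gen.intros)

end

text \<open>The isomorphism of bimodules and its inverse lift to mutually inverse maps of path coalgebras.\<close>

theorem bimod_gauge_imp_majid_gauge:
  fixes G :: "('g, 'x) monoid_scheme" and H H' :: "('g path, 'k::field) majid"
    and M :: "('k, 'g, 'm::ab_group_add) bimod" and N :: "('k, 'g, 'n::ab_group_add) bimod"
  assumes H: "HM_algebra G R \<Phi> H M \<theta>" and H': "HM_algebra G R' \<Phi>' H' N \<theta>'"
    and eq: "bimod_gauge_equiv G \<Phi> M \<Phi>' N"
  shows "\<exists>F Fi f. majid_gauge H F Fi \<and> majid_iso f (majid_twist H F Fi) H' \<and>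
    (\<forall>g\<in>carrier G. f (vertex g) = vertex g) \<and>
    bij_betw f (path_majid.gen G R H) (path_majid.gen G R' H')"
proof -
  interpret H: HM_algebra G R \<Phi> H M \<theta> by fact
  interpret H': HM_algebra G R' \<Phi>' H' N \<theta>' by fact
  obtain F \<chi> where F: "gauge G F" and c: "cocycle_eq G \<Phi>' (cocycle_twist G F \<Phi>)"
    and \<chi>: "bimod_iso G \<chi> (bimod_twist F M) N"
    using eq unfolding bimod_gauge_equiv_def by blast
  have l: "lin (scl M) (scl N) \<chi>" and b: "bij \<chi>"
    using \<chi> by (auto simp: bimod_iso_def)
  have hb: "bij_betw \<chi> (homog M g h) (homog N g h)" for g h
    using bimod_iso_homog[OF bicomodule_twist[OF H.bicomodule_axioms] H'.bicomodule_axioms \<chi>] by simp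
  define \<chi>' where "\<chi>' = inv_into UNIV \<chi>"
  have inv: "\<chi>' (\<chi> m) = m" "\<chi> (\<chi>' n) = n" for m n
    using b by (simp_all add: \<chi>'_def bij_is_inj bij_is_surj surj_f_inv_f)
  have l': "lin (scl N) (scl M) \<chi>'"
  proof (rule linearI'[OF H'.vector_space H.vector_space])
    show "\<chi>' (x + y) = \<chi>' x + \<chi>' y" for x y
      by (metis inv lin_add[OF l])
    show "\<chi>' (scl N c x) = scl M c (\<chi>' x)" for c x
      by (metis inv lin_scale[OF l])
  qed
  interpret A: HM_gauge G R \<Phi> H M \<theta> R' \<Phi>' H' N \<theta>' \<chi> F
  proof (intro HM_gauge.intro HM_pair.intro HM_pair_axioms.intro HM_gauge_axioms.intro H H' l F c)
    show "\<chi> m \<in> homog N g h" if "m \<in> homog M g h" for g h m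
      using hb that bij_betwE by blast
  qed (use \<chi> in \<open>auto simp: bimod_iso_def\<close>)
  interpret B: HM_pair G R' \<Phi>' H' N \<theta>' R \<Phi> H M \<theta> \<chi>'
  proof (intro HM_pair.intro HM_pair_axioms.intro H H' l')
    show "\<chi>' m \<in> homog M g h" if "m \<in> homog N g h" for g h m
    proof -
      have "m \<in> \<chi> ` homog M g h" using hb[of g h] that by (simp add: bij_betw_def)
      then obtain m' where "m' \<in> homog M g h" "m = \<chi> m'" by blast
      thus ?thesis by (simp add: inv)
    qed
  qed
  have BA: "B.lift (A.lift a) = a" if "a \<in> car H" for a
    by (rule path_map_inverse[OF A.HM_pair_axioms B.HM_pair_axioms inv(1) that])
  have AB: "A.lift (B.lift a) = a" if "a \<in> car H'" for a
    by (rule path_map_inverse[OF B.HM_pair_axioms A.HM_pair_axioms inv(2) that])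
  have bij: "bij_betw A.lift (car H) (car H')"
    by (rule bij_betw_byWitness[where f' = B.lift]) (auto simp: BA AB A.lift_car B.lift_car)
  have iso: "majid_iso A.lift A.HF H'"
    unfolding majid_iso_def
    by (auto simp: linear_path_map bij A.comul_lift A.counit_lift A.lift_prd A.lift_reass
        H.unt_vertex H'.unt_vertex A.am.path_map_vertex)
  have Bgen: "B.lift a \<in> H.gen" if "a \<in> H'.gen" for a
    using that
  proof (induction rule: H'.gen.induct)
    case (bas x)
    obtain u p where x: "x = (u, p)" by fastforce
    show ?case
    proof (cases p)
      case Nil
      then show ?thesis using bas H.vertex_gen[of u] by (simp add: x B.am.path_map_vertex flip: vertex_def)
    next
      case (Cons e q)
      then have "B.lift (bas x) \<in> path_degree H.Q 1" using B.lift_degree[OF bas(1)] bas(2) by (simp add: x)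
      then show ?thesis by (rule H.degree1_gen)
    qed
  next
    case (prd a b)
    note ac = H'.gen_car[OF prd(1)] and bc = H'.gen_car[OF prd(2)]
    have "prd H' a b = A.lift (prd A.HF (B.lift a) (B.lift b))"
      using A.lift_prd[OF B.lift_car[OF ac] B.lift_car[OF bc]] by (simp add: AB ac bc)
    moreover have g: "prd A.HF (B.lift a) (B.lift b) \<in> H.gen" by (rule A.gen_HF[OF prd(3,4)])
    ultimately show ?case using BA[OF H.gen_car[OF g]] by simp
  qed (auto simp: lin_zero[OF linear_path_map] lin_add[OF linear_path_map] lin_scale[OF linear_path_map] intro: H.gen.intros)
  have "bij_betw A.lift H.gen H'.gen"
    by (rule bij_betw_byWitness[where f' = B.lift])
      (use BA AB H.gen_car H'.gen_car A.lift_gen Bgen in auto)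
  thus ?thesis using H.majid_gauge_vertex_form[OF F] iso A.am.path_map_vertex by blast
qed

section \<open>The equivalence of the five conditions\<close>

lemma is_HM_imp_HM_algebra:
  assumes M: "majid_bimodule G \<Phi> M" and H: "is_HM G r \<Phi> M H"
  shows "\<exists>\<theta>. HM_algebra G (\<lambda>C. vector_space.dim (scl M) (homog M (r C) \<one>\<^bsub>G\<^esub>)) \<Phi> H M \<theta>"
proof -
  let ?R = "\<lambda>C. vector_space.dim (scl M) (homog M (r C) \<one>\<^bsub>G\<^esub>)"
  interpret M: majid_bimodule G \<Phi> M by fact
  have Q: "bimod_quiver G r M = hopf_quiver G ?R" by (simp add: bimod_quiver_def)
  have "graded_majid_algebra H (path_degree (hopf_quiver G ?R))"
    and ax: "path_majid_axioms G ?R \<Phi> H"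
    using H by (auto simp: is_HM_def Let_def Q path_majid_axioms_def path_coalgebra_def)
  then have P: "path_majid G ?R \<Phi> H" by (intro path_majid.intro M.is_group)
  have "\<exists>\<theta>. arrow_identification G (hopf_quiver G ?R) M \<theta> \<and>
        (\<forall>f\<in>carrier G. \<forall>m. prd H (vertex f) (\<theta> m) = \<theta> (lact M f m) \<and>
                            prd H (\<theta> m) (vertex f) = \<theta> (ract M m f))"
    using H unfolding is_HM_def Let_def Q by blast
  then obtain \<theta> where "HM_algebra_axioms G ?R H M \<theta>"
    unfolding HM_algebra_axioms_def by blast
  thus ?thesis using P M by (blast intro: HM_algebra.intro)
qed

lemma majid_gauge_restrict:
  assumes "majid_gauge H F Fi" "majid_iso f (majid_twist H F Fi) H'"
    and W: "W \<subseteq> car H" "W' \<subseteq> car H'" "bij_betw f W W'"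
  shows "majid_gauge (H\<lparr>car := W\<rparr>) F Fi"
    and "majid_iso f (majid_twist (H\<lparr>car := W\<rparr>) F Fi) (H'\<lparr>car := W'\<rparr>)"
  using assms unfolding majid_gauge_def majid_iso_def conv_inverse2_def
  by (auto simp: subset_iff)

theorem theorem4p3:
  fixes G :: "('g, 'x) monoid_scheme" and r :: "'g set \<Rightarrow> 'g"
    and \<Phi> \<Phi>' :: "'g \<Rightarrow> 'g \<Rightarrow> 'g \<Rightarrow> 'k::field"
    and M :: "('k, 'g, 'm::ab_group_add) bimod" and N :: "('k, 'g, 'n::ab_group_add) bimod"
    and HM HN :: "('g path, 'k) majid"
  assumes "group G"
    and "\<And>C. C \<in> conj_classes G \<Longrightarrow> r C \<in> C"
    and "majid_bimodule G \<Phi> M" and "majid_bimodule G \<Phi>' N"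
    and "\<And>C. C \<in> conj_classes G \<Longrightarrow> finite_dim (scl M) (homog M (r C) \<one>\<^bsub>G\<^esub>)"
    and "\<And>C. C \<in> conj_classes G \<Longrightarrow> finite_dim (scl N) (homog N (r C) \<one>\<^bsub>G\<^esub>)"
    and "is_HM G r \<Phi> M HM" and "is_HM G r \<Phi>' N HN"
  shows "(majid_gauge_equiv G HM HN \<longleftrightarrow>
            majid_gauge_equiv G (B_of G r M HM) (B_of G r N HN)) \<and>
         (majid_gauge_equiv G (B_of G r M HM) (B_of G r N HN) \<longleftrightarrow>
            bimod_gauge_equiv G \<Phi> M \<Phi>' N) \<and>
         (bimod_gauge_equiv G \<Phi> M \<Phi>' N \<longleftrightarrow>
            collection_gauge_equiv G r \<Phi> (bimod_collection G r M) \<Phi>' (bimod_collection G r N)) \<and>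
         (collection_gauge_equiv G r \<Phi> (bimod_collection G r M) \<Phi>' (bimod_collection G r N) \<longleftrightarrow>
            uniformly_projective_equiv G r \<Phi> (bimod_collection G r M) \<Phi>' (bimod_collection G r N))"
proof -
  let ?R = "\<lambda>C. vector_space.dim (scl M) (homog M (r C) \<one>\<^bsub>G\<^esub>)"
  let ?R' = "\<lambda>C. vector_space.dim (scl N) (homog N (r C) \<one>\<^bsub>G\<^esub>)"
  obtain \<theta> where HM: "HM_algebra G ?R \<Phi> HM M \<theta>"
    using is_HM_imp_HM_algebra[OF assms(3,7)] by blast
  obtain \<theta>' where HN: "HM_algebra G ?R' \<Phi>' HN N \<theta>'"
    using is_HM_imp_HM_algebra[OF assms(4,8)] by blast
  interpret H: HM_algebra G ?R \<Phi> HM M \<theta> by fact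
  interpret H': HM_algebra G ?R' \<Phi>' HN N \<theta>' by fact
  have BM: "B_of G r M HM = HM\<lparr>car := H.gen\<rparr>" and BN: "B_of G r N HN = HN\<lparr>car := H'.gen\<rparr>"
    using H.gen_eq_Inter[OF H.nonzero] H'.gen_eq_Inter[OF H'.nonzero]
    by (simp_all add: B_of_def bimod_quiver_def)
  have 13: "bimod_gauge_equiv G \<Phi> M \<Phi>' N" if eq: "majid_gauge_equiv G HM HN"
  proof -
    obtain F Fi f where f: "majid_gauge HM F Fi" "majid_iso f (majid_twist HM F Fi) HN"
      "\<And>g. g \<in> carrier G \<Longrightarrow> f (vertex g) = vertex g"
      using eq unfolding majid_gauge_equiv_def by blast
    show ?thesis
      by (rule majid_gauge_imp_bimod_gauge[OF HM HN subset_refl H.subspace _ _ H.comul_closed subset_refl,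
            of F Fi f])
        (use f H.vertex_car H'.vertex_car H.degree_car H'.degree_car in auto)
  qed
  have 23: "bimod_gauge_equiv G \<Phi> M \<Phi>' N" if eq: "majid_gauge_equiv G (B_of G r M HM) (B_of G r N HN)"
  proof -
    obtain F Fi f where f: "majid_gauge (HM\<lparr>car := H.gen\<rparr>) F Fi"
      "majid_iso f (majid_twist (HM\<lparr>car := H.gen\<rparr>) F Fi) (HN\<lparr>car := H'.gen\<rparr>)"
      "\<And>g. g \<in> carrier G \<Longrightarrow> f (vertex g) = vertex g"
      using eq unfolding majid_gauge_equiv_def BM BN by blast
    show ?thesis
      by (rule majid_gauge_imp_bimod_gauge[OF HM HN _ H.gen_subspace _ _ H.gen_comul _ _ _ f])
        (use H.gen_car H'.gen_car H.vertex_gen H'.vertex_gen H.degree1_gen H'.degree1_gen in auto)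
  qed
  have 312: "majid_gauge_equiv G HM HN \<and> majid_gauge_equiv G (B_of G r M HM) (B_of G r N HN)"
    if eq: "bimod_gauge_equiv G \<Phi> M \<Phi>' N"
  proof -
    obtain F Fi f where f: "majid_gauge HM F Fi" "majid_iso f (majid_twist HM F Fi) HN"
      "\<forall>g\<in>carrier G. f (vertex g) = vertex g" "bij_betw f H.gen H'.gen"
      using bimod_gauge_imp_majid_gauge[OF HM HN eq] by blast
    have "H.gen \<subseteq> car HM" "H'.gen \<subseteq> car HN" using H.gen_car H'.gen_car by blast+
    from majid_gauge_restrict[OF f(1,2) this f(4)] show ?thesis
      using f(1-3) unfolding majid_gauge_equiv_def BM BN by blast
  qed
  show ?thesis
    using 13 23 312 bimod_gauge_iff_collection_gauge[OF assms(3,4,2)]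
      collection_gauge_iff_uniformly_projective by blast
qed

end
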